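(* (1) The composition problem (for two isomorphisms between essential right ideals) is in $\mathrm{AC}^0$. (2) The word problem of the Thompson group $V$ is in $\mathrm{AC}^1$.
   Context: Let $A$ be a finite alphabet with at least two letters and let $A^*$ be the free monoid of all words over $A$. A right ideal of $A^*$ is a subset $R$ with $RA^*\subseteq R$; it is essential if it has non-empty intersection with every (non-empty) right ideal. A prefix code is a set of words no one of which is a strict prefix of another; it is maximal if it is not strictly contained in another prefix code. Every right ideal is $PA^*$ for a unique prefix code $P$; it is finitely generated iff $P$ is finite, and essential iff $P$ is maximal. A right-ideal isomorphism is a bijection $\varphi:R_1\to R_2$ between right ideals with $\varphi(ux)=\varphi(u)x$ for all $u\in R_1$, $x\in A^*$. If $\varphi:PA^*\to QA^*$ is a right-ideal isomorphism ($P,Q$ prefix codes), it restricts to a bijection $P\to Q$ which determines it; this bijection, given as $\{(p,\varphi(p)):p\in P\}\subseteq P\times Q$, is the table of $\varphi$. Every isomorphism $\varphi$ between essential right ideals has a unique maximum extension $\mathsf{max}\,\varphi$ to a right-ideal isomorphism. The Thompson group $V$ (here $A=\{a,b\}$) consists of all maximal isomorphisms between finitely generated essential right ideals of $\{a,b\}^*$, with multiplication $\varphi\cdot\psi=\mathsf{max}(\varphi\circ\psi)$; its identity $\mathbf 1$ is the identity map on $A^*$. Composition problem. Input: two isomorphisms between essential right ideals $\varphi:P_1A^*\to Q_1A^*$ and $\psi:P_2A^*\to Q_2A^*$, where $P_1,Q_1,P_2,Q_2$ are (finite) maximal prefix codes; each of $\varphi,\psi$ is described by its finite table. Output: the functional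 composite $\psi\circ\varphi$, described by a finite table. Word problem of $V$ (with $A=\{a,b\}$). Input: a sequence $(\psi_1,\dots,\psi_n)$ ($n$ is also variable) of isomorphisms between essential right ideals $\psi_i:P_iA^*\to Q_iA^*$, where $P_i,Q_i$ are (finite) maximal prefix codes; each $\psi_i$ is described by its finite table. Output: "yes" if $\psi_1\cdot\ldots\cdot\psi_n=\mathbf 1$ (i.e., the product in $V$ is the identity map on $A^*$); "no" otherwise. $\mathrm{AC}^k$ is the class of problems whose output can be computed by acyclic boolean circuits with gates of unbounded finite fan-in, of depth $O((\log N)^k)$ and of size polynomial in $N$, where $N$ is the input length. *)

theory Defs
  imports
    Complex_Main
    "HOL-Library.Cardinality"
    "HOL-Library.Sublist"
    "HOL-Library.Landau_Symbols"
    "HOL-Algebra.Group"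
begin

section \<open>Right ideals, prefix codes and right-ideal isomorphisms\<close>

definition right_ideal :: "'a list set \<Rightarrow> bool" where
  "right_ideal R \<longleftrightarrow> (\<forall>u\<in>R. \<forall>x. u @ x \<in> R)"

definition essential :: "'a list set \<Rightarrow> bool" where
  "essential R \<longleftrightarrow> right_ideal R \<and> (\<forall>S. right_ideal S \<and> S \<noteq> {} \<longrightarrow> R \<inter> S \<noteq> {})"

definition prefix_code :: "'a list set \<Rightarrow> bool" where
  "prefix_code P \<longleftrightarrow> (\<forall>u\<in>P. \<forall>v\<in>P. \<not> strict_prefix u v)"

definition maximal_prefix_code :: "'a list set \<Rightarrow> bool" where
  "maximal_prefix_code P \<longleftrightarrow> prefix_code P \<and> \<not> (\<exists>Q. prefix_code Q \<and> P \<subset> Q)"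

definition generated_ideal :: "'a list set \<Rightarrow> 'a list set" where
  "generated_ideal P = {p @ x | p x. p \<in> P}"

definition finitely_generated :: "'a list set \<Rightarrow> bool" where
  "finitely_generated R \<longleftrightarrow> (\<exists>P. finite P \<and> R = generated_ideal P)"

text \<open>A right-ideal isomorphism \<open>R\<^sub>1 \<rightarrow> R\<^sub>2\<close> is a partial function with domain \<open>R\<^sub>1\<close> and range \<open>R\<^sub>2\<close>.\<close>

definition right_ideal_iso :: "('a list \<rightharpoonup> 'a list) \<Rightarrow> bool" where
  "right_ideal_iso \<phi> \<longleftrightarrow>
     right_ideal (dom \<phi>) \<and> right_ideal (ran \<phi>) \<and>
     bij_betw (\<lambda>u. the (\<phi> u)) (dom \<phi>) (ran \<phi>) \<and>
     (\<forall>u\<in>dom \<phi>. \<forall>x. the (\<phi> (u @ x)) = the (\<phi> u) @ x)"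

definition essential_iso :: "('a list \<rightharpoonup> 'a list) \<Rightarrow> bool" where
  "essential_iso \<phi> \<longleftrightarrow> right_ideal_iso \<phi> \<and> essential (dom \<phi>) \<and> essential (ran \<phi>)"

definition finite_essential_iso :: "('a list \<rightharpoonup> 'a list) \<Rightarrow> bool" where
  "finite_essential_iso \<phi> \<longleftrightarrow> essential_iso \<phi> \<and>
     (\<exists>P Q. finite P \<and> finite Q \<and> maximal_prefix_code P \<and> maximal_prefix_code Q \<and>
        dom \<phi> = generated_ideal P \<and> ran \<phi> = generated_ideal Q)"

text \<open>The prefix code generating a given right ideal is unique.\<close>

definition ideal_code :: "'a list set \<Rightarrow> 'a list set" where
  "ideal_code R = (THE P. prefix_code P \<and> R = generated_ideal P)"

definition table :: "('a list \<rightharpoonup> 'a list) \<Rightarrow> ('a list \<times> 'a list) set" where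
  "table \<phi> = {(p, the (\<phi> p)) | p. p \<in> ideal_code (dom \<phi>)}"

definition max_extension :: "('a list \<rightharpoonup> 'a list) \<Rightarrow> ('a list \<rightharpoonup> 'a list)" where
  "max_extension \<phi> = (THE \<Phi>. right_ideal_iso \<Phi> \<and> \<phi> \<subseteq>\<^sub>m \<Phi> \<and>
     (\<forall>\<Psi>. right_ideal_iso \<Psi> \<and> \<phi> \<subseteq>\<^sub>m \<Psi> \<longrightarrow> \<Psi> \<subseteq>\<^sub>m \<Phi>))"


section \<open>The Thompson group\<close>

datatype ab = Letter_a | Letter_b

definition thompson_V :: "(ab list \<rightharpoonup> ab list) monoid" where
  "thompson_V =
     \<lparr> carrier = {\<phi>. essential_iso \<phi> \<and> finitely_generated (dom \<phi>) \<and> finitely_generated (ran \<phi>) \<and>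
                     max_extension \<phi> = \<phi>},
       mult = (\<lambda>\<phi> \<psi>. max_extension (\<phi> \<circ>\<^sub>m \<psi>)),
       one = Some \<rparr>"

text \<open>The product \<open>\<psi>\<^sub>1 \<cdot> \<dots> \<cdot> \<psi>\<^sub>n\<close> in \<open>V\<close> of isomorphisms that need not be maximal themselves; each
  \<open>\<psi>\<^sub>i\<close> stands for the element \<open>max \<psi>\<^sub>i\<close> of \<open>V\<close>.\<close>

definition V_product :: "(ab list \<rightharpoonup> ab list) list \<Rightarrow> (ab list \<rightharpoonup> ab list)" where
  "V_product \<psi>s = foldr (mult thompson_V) (map max_extension \<psi>s) \<one>\<^bsub>thompson_V\<^esub>"


section \<open>Boolean circuits and the classes \<open>AC\<^sup>k\<close>\<close>

text \<open>A circuit is a list of gates, topologically sorted (hence acyclic): gate \<open>i\<close> may only refer to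
  gates with number less than \<open>i\<close>.\<close>

datatype gate = Input nat | Neg nat | Conj "nat set" | Disj "nat set"

record circuit =
  gates :: "gate list"
  outputs :: "nat list"

fun wf_gate :: "nat \<Rightarrow> nat \<Rightarrow> gate \<Rightarrow> bool" where
  "wf_gate n i (Input j) \<longleftrightarrow> j < n"
| "wf_gate n i (Neg j) \<longleftrightarrow> j < i"
| "wf_gate n i (Conj J) \<longleftrightarrow> J \<subseteq> {..<i}"
| "wf_gate n i (Disj J) \<longleftrightarrow> J \<subseteq> {..<i}"

definition wf_circuit :: "nat \<Rightarrow> circuit \<Rightarrow> bool" where
  "wf_circuit n C \<longleftrightarrow>
     (\<forall>i<length (gates C). wf_gate n i (gates C ! i)) \<and>
     set (outputs C) \<subseteq> {..<length (gates C)}"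

text \<open>The lists \<open>vs\<close> and \<open>ds\<close> hold the values and depths of the preceding gates.\<close>

fun gate_value :: "bool list \<Rightarrow> bool list \<Rightarrow> gate \<Rightarrow> bool" where
  "gate_value x vs (Input j) = x ! j"
| "gate_value x vs (Neg j) = (\<not> vs ! j)"
| "gate_value x vs (Conj J) = (\<forall>j\<in>J. vs ! j)"
| "gate_value x vs (Disj J) = (\<exists>j\<in>J. vs ! j)"

fun gate_depth :: "nat list \<Rightarrow> gate \<Rightarrow> nat" where
  "gate_depth ds (Input j) = 0"
| "gate_depth ds (Neg j) = Suc (ds ! j)"
| "gate_depth ds (Conj J) = Suc (Max (insert 0 ((!) ds ` J)))"
| "gate_depth ds (Disj J) = Suc (Max (insert 0 ((!) ds ` J)))"

definition gate_values :: "circuit \<Rightarrow> bool list \<Rightarrow> bool list" where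
  "gate_values C x = foldl (\<lambda>vs g. vs @ [gate_value x vs g]) [] (gates C)"

definition gate_depths :: "circuit \<Rightarrow> nat list" where
  "gate_depths C = foldl (\<lambda>ds g. ds @ [gate_depth ds g]) [] (gates C)"

definition circuit_output :: "circuit \<Rightarrow> bool list \<Rightarrow> bool list" where
  "circuit_output C x = map ((!) (gate_values C x)) (outputs C)"

definition circuit_depth :: "circuit \<Rightarrow> nat" where
  "circuit_depth C = Max (insert 0 (set (gate_depths C)))"

definition circuit_size :: "circuit \<Rightarrow> nat" where
  "circuit_size C = length (gates C) + length (outputs C)"

text \<open>A computational problem is a set of pairs \<open>(x, Y)\<close>: \<open>x\<close> encodes an instance, and \<open>Y\<close> is the set
  of all encodings of its answer (an answer such as a table can be written down in several ways).
  Nothing is required on bit strings that encode no instance.\<close>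

type_synonym problem = "(bool list \<times> bool list set) set"

definition AC :: "nat \<Rightarrow> problem set" where
  "AC k = {Prob. \<exists>C :: nat \<Rightarrow> circuit.
     (\<forall>N. wf_circuit N (C N)) \<and>
     (\<lambda>N. real (circuit_depth (C N))) \<in> O(\<lambda>N. log 2 (real N) ^ k) \<and>
     (\<exists>d. (\<lambda>N. real (circuit_size (C N))) \<in> O(\<lambda>N. real N ^ d)) \<and>
     (\<forall>(x, Y)\<in>Prob. circuit_output (C (length x)) x \<in> Y)}"


section \<open>Encoding tables as bit strings\<close>

datatype 'a symbol = Letter 'a | Comma | Semicolon | Bar | Blank

text \<open>An entry \<open>(p, q)\<close> is written \<open>p,q;\<close> and a table is written as the sequence of its entries, in
  any order. Blanks may occur before, between and after entries, but not inside an entry: the length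
  of the output of a circuit depends only on the length of its input, while the number and the lengths
  of the entries of a composite do not.\<close>

inductive writes :: "'a symbol list \<Rightarrow> ('a list \<times> 'a list) list \<Rightarrow> bool" where
  "writes [] []"
| "writes s es \<Longrightarrow> writes (Blank # s) es"
| "writes s es \<Longrightarrow>
     writes (map Letter p @ [Comma] @ map Letter q @ [Semicolon] @ s) ((p, q) # es)"

definition describes :: "'a symbol list \<Rightarrow> ('a list \<rightharpoonup> 'a list) \<Rightarrow> bool" where
  "describes s \<phi> \<longleftrightarrow> (\<exists>es. distinct es \<and> set es = table \<phi> \<and> writes s es)"

definition join :: "'a symbol list list \<Rightarrow> 'a symbol list" where
  "join ss = concat (map (\<lambda>s. s @ [Bar]) ss)"

definition binary_code :: "('a symbol \<Rightarrow> bool list) \<Rightarrow> bool" where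
  "binary_code c \<longleftrightarrow> inj c \<and> (\<exists>w. \<forall>s. length (c s) = w)"

definition to_bits :: "('a symbol \<Rightarrow> bool list) \<Rightarrow> 'a symbol list \<Rightarrow> bool list" where
  "to_bits c s = concat (map c s)"


section \<open>The two problems\<close>

definition composition_problem :: "('a symbol \<Rightarrow> bool list) \<Rightarrow> problem" where
  "composition_problem c =
     {(to_bits c (join [s, t]), {to_bits c u | u. describes u (\<psi> \<circ>\<^sub>m \<phi>)}) | s t \<phi> \<psi>.
        finite_essential_iso \<phi> \<and> finite_essential_iso \<psi> \<and> describes s \<phi> \<and> describes t \<psi>}"

definition word_problem_V :: "(ab symbol \<Rightarrow> bool list) \<Rightarrow> problem" where
  "word_problem_V c =
     {(to_bits c (join ss), {[V_product \<psi>s = \<one>\<^bsub>thompson_V\<^esub>]}) | ss \<psi>s.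
        \<psi>s \<noteq> [] \<and> (\<forall>\<psi>\<in>set \<psi>s. finite_essential_iso \<psi>) \<and> list_all2 describes ss \<psi>s}"

end

theory Submission
  imports Defs "HOL-Library.Log_Nat"
begin

text \<open>A table is stored as a list of slots \<open>(valid, p, q)\<close>. Every entry of a composite table arises from an entry
  \<open>(p, q)\<close> of the first table for which \<open>q\<close> has a (necessarily unique) prefix in the domain code of the
  second table, or from an entry \<open>(p', q')\<close> of the second table for which \<open>p'\<close> properly extends a unique
  \<open>q\<close> of the first one. Hence the composite needs only as many slots as its two factors together, and
  each bit of it is a first-order formula, with quantifiers ranging over polynomially many positions, in
  the bits of the factors: composition is in \<open>AC\<^sup>0\<close>.

  For the word problem, the product in \<open>V\<close> is the maximal extension of the plain composite, so it is
  the identity iff every entry \<open>(p, q)\<close> of the table of the composite satisfies \<open>p = q\<close>. That table is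
  computed by a balanced binary tree of compositions. The leaves of the tree are the positions of the
  input string rather than the factors, since locating the \<open>i\<close>-th factor would require counting: the bar
  that ends a factor carries that factor, every other position carries the identity. Slot counts and
  word lengths at most double from one of the \<open>O(log N)\<close> levels to the next, so they stay polynomial.\<close>

section \<open>Maximal extensions and products in V\<close>

text \<open>Unfolding one formula through all \<open>O(log N)\<close> levels of the tree would cost
  \<open>m + 2\<close> to a power of order \<open>log N\<close>, which is not polynomial. Therefore
  the bits of all tables on a level become gates before the next level starts, and each level is a
  formula of constant depth over the gates of the level below: gate counts add up instead of
  multiplying. A circuit computes a total function, so slot counts and length bounds must hold for
  every bit string, not only for encodings. This is why decoding falls back to blanks and why a
  matching slot is taken to be the first match, with an invalid slot as default, although in genuine
  tables it is unique. A shift by the length of a word is done by guessing that length; arithmetic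
  on positions then takes place between constants only. On the algebraic side, every word can be
  extended into the domains considered, so an extension is forced pointwise, and replacing factors
  by their maximal extensions does not affect the maximal extension of the product. Tables are
  described by a condition symmetric in sources and targets, which survives composition.\<close>

lemma right_ideal_isoD:
  assumes "right_ideal_iso \<phi>" "\<phi> u = Some v"
  shows "\<phi> (u @ x) = Some (v @ x)"
proof -
  have u: "u \<in> dom \<phi>" using assms by auto
  hence "u @ x \<in> dom \<phi>" "the (\<phi> (u @ x)) = the (\<phi> u) @ x"
    using assms(1) unfolding right_ideal_iso_def right_ideal_def by blast+
  thus ?thesis using assms(2) by auto
qed

lemma right_ideal_iso_inj:
  assumes "right_ideal_iso \<phi>" "\<phi> u = Some v" "\<phi> u' = Some v"
  shows "u = u'"
proof -
  have "inj_on (\<lambda>u. the (\<phi> u)) (dom \<phi>)"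
    using assms(1) unfolding right_ideal_iso_def bij_betw_def by blast
  thus ?thesis using assms(2,3) by (metis domI inj_onD option.sel)
qed

lemma right_ideal_isoI:
  fixes \<phi> :: "'a list \<rightharpoonup> 'a list"
  assumes "\<And>u v x. \<phi> u = Some v \<Longrightarrow> \<phi> (u @ x) = Some (v @ x)"
    and "\<And>u u' v. \<phi> u = Some v \<Longrightarrow> \<phi> u' = Some v \<Longrightarrow> u = u'"
  shows "right_ideal_iso \<phi>"
proof -
  have "right_ideal (dom \<phi>)" "right_ideal (ran \<phi>)"
    using assms(1) unfolding right_ideal_def dom_def ran_def by blast+
  moreover have "bij_betw (\<lambda>u. the (\<phi> u)) (dom \<phi>) (ran \<phi>)"
    unfolding bij_betw_def
  proof
    show "inj_on (\<lambda>u. the (\<phi> u)) (dom \<phi>)"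
      by (rule inj_onI) (metis assms(2) domD option.sel)
    show "(\<lambda>u. the (\<phi> u)) ` dom \<phi> = ran \<phi>" by (force simp: ran_def)
  qed
  moreover have "\<forall>u\<in>dom \<phi>. \<forall>x. the (\<phi> (u @ x)) = the (\<phi> u) @ x"
    using assms(1) by fastforce
  ultimately show ?thesis by (simp add: right_ideal_iso_def)
qed

lemma right_ideal_iso_Some: "right_ideal_iso Some"
  by (rule right_ideal_isoI) auto

text \<open>It suffices to test the principal right ideals, because every non-empty right ideal
  contains one.\<close>

lemma essential_iff:
  fixes R :: "'a list set"
  shows "essential R \<longleftrightarrow> right_ideal R \<and> (\<forall>u. \<exists>x. u @ x \<in> R)"
proof (cases "right_ideal R")
  case True
  have "(\<forall>S. right_ideal S \<and> S \<noteq> {} \<longrightarrow> R \<inter> S \<noteq> {}) \<longleftrightarrow> (\<forall>u. \<exists>x. u @ x \<in> R)"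
  proof (intro iffI allI impI)
    fix u :: "'a list" assume *: "\<forall>S. right_ideal S \<and> S \<noteq> {} \<longrightarrow> R \<inter> S \<noteq> {}"
    have "right_ideal (range ((@) u))" by (auto simp: right_ideal_def)
    with * have "R \<inter> range ((@) u) \<noteq> {}" by blast
    thus "\<exists>x. u @ x \<in> R" by auto
  next
    fix S :: "'a list set" assume *: "\<forall>u. \<exists>x. u @ x \<in> R" and S: "right_ideal S \<and> S \<noteq> {}"
    then obtain u where "u \<in> S" by auto
    with S * show "R \<inter> S \<noteq> {}" by (fastforce simp: right_ideal_def)
  qed
  thus ?thesis by (simp add: essential_def)
qed (simp add: essential_def)

text \<open>The invariant for reasoning about \<open>V\<close>: it is closed under composition and
  maximal extension, and it makes extensions unique, all without carrying finite prefix codes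
  along.\<close>

definition dense_iso :: "('a list \<rightharpoonup> 'a list) \<Rightarrow> bool" where
  "dense_iso \<phi> \<longleftrightarrow> right_ideal_iso \<phi> \<and> (\<forall>u. \<exists>x. u @ x \<in> dom \<phi>)"

lemma finite_essential_iso_dense: "finite_essential_iso \<phi> \<Longrightarrow> dense_iso \<phi>"
  by (auto simp: finite_essential_iso_def essential_iso_def dense_iso_def essential_iff)

text \<open>A word is lengthened until \<psi> is defined on it, and then further until the image
  enters the domain of \<phi>; by equivariance the second extension can be made at the
  source.\<close>

lemma dense_iso_comp:
  assumes "dense_iso \<phi>" "dense_iso \<psi>"
  shows "dense_iso (\<phi> \<circ>\<^sub>m \<psi>)"
proof -
  have i: "right_ideal_iso \<phi>" "right_ideal_iso \<psi>" using assms by (auto simp: dense_iso_def)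
  have "right_ideal_iso (\<phi> \<circ>\<^sub>m \<psi>)"
  proof (rule right_ideal_isoI)
    show "(\<phi> \<circ>\<^sub>m \<psi>) (u @ x) = Some (v @ x)" if "(\<phi> \<circ>\<^sub>m \<psi>) u = Some v" for u v x
      using that right_ideal_isoD[OF i(1)] right_ideal_isoD[OF i(2)]
      unfolding map_comp_Some_iff by blast
    show "u = u'" if "(\<phi> \<circ>\<^sub>m \<psi>) u = Some v" "(\<phi> \<circ>\<^sub>m \<psi>) u' = Some v" for u u' v
      using that right_ideal_iso_inj[OF i(1)] right_ideal_iso_inj[OF i(2)]
      unfolding map_comp_Some_iff by metis
  qed
  moreover have "\<exists>x. u @ x \<in> dom (\<phi> \<circ>\<^sub>m \<psi>)" for u
  proof -
    obtain x v where x: "\<psi> (u @ x) = Some v" using assms(2) unfolding dense_iso_def dom_def by blast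
    obtain y w where y: "\<phi> (v @ y) = Some w" using assms(1) unfolding dense_iso_def dom_def by blast
    have "\<psi> (u @ x @ y) = Some (v @ y)" using right_ideal_isoD[OF i(2) x] by simp
    thus ?thesis using y by (intro exI[of _ "x @ y"]) (auto simp: map_comp_Some_iff)
  qed
  ultimately show ?thesis by (simp add: dense_iso_def)
qed

lemma dense_iso_Some: "dense_iso Some"
  by (simp add: dense_iso_def right_ideal_iso_Some)

text \<open>The value that every extension of \<open>\<phi>\<close> is forced to take at \<open>u\<close>, if it is defined there; essentiality of
  the domain makes it unique.\<close>

definition germ :: "('a list \<rightharpoonup> 'a list) \<Rightarrow> 'a list \<Rightarrow> 'a list \<Rightarrow> bool" where
  "germ \<phi> u v \<longleftrightarrow> (\<forall>x. u @ x \<in> dom \<phi> \<longrightarrow> \<phi> (u @ x) = Some (v @ x))"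

lemma germ_unique: "dense_iso \<phi> \<Longrightarrow> germ \<phi> u v \<Longrightarrow> germ \<phi> u v' \<Longrightarrow> v = v'"
  unfolding dense_iso_def germ_def by (metis append_same_eq option.sel)

text \<open>\<open>max_extension\<close> is a definite description and says nothing until a largest
  extension is exhibited. The candidate sends each word to its germ, where there is one;
  equivariance forces any other extension to agree with it.\<close>

lemma max_extension_char:
  assumes \<phi>: "dense_iso \<phi>"
  shows "right_ideal_iso (max_extension \<phi>)" "\<phi> \<subseteq>\<^sub>m max_extension \<phi>"
    "\<And>u v. max_extension \<phi> u = Some v \<longleftrightarrow> germ \<phi> u v"
    "\<And>\<Psi>. right_ideal_iso \<Psi> \<Longrightarrow> \<phi> \<subseteq>\<^sub>m \<Psi> \<Longrightarrow> \<Psi> \<subseteq>\<^sub>m max_extension \<phi>"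
proof -
  have iso: "right_ideal_iso \<phi>" and ess: "\<And>u. \<exists>x. u @ x \<in> dom \<phi>"
    using \<phi> by (auto simp: dense_iso_def)
  define \<Phi> where "\<Phi> = (\<lambda>u. if \<exists>v. germ \<phi> u v then Some (THE v. germ \<phi> u v) else None)"
  have \<Phi>: "\<Phi> u = Some v \<longleftrightarrow> germ \<phi> u v" for u v
  proof -
    have "(THE v. germ \<phi> u v) = v" if "germ \<phi> u v" for v
      by (rule the_equality) (use that germ_unique[OF \<phi>] in blast)+
    thus ?thesis unfolding \<Phi>_def by auto
  qed
  have 1: "right_ideal_iso \<Phi>"
  proof (rule right_ideal_isoI)
    show "\<Phi> (u @ x) = Some (v @ x)" if "\<Phi> u = Some v" for u v x
      using that unfolding \<Phi> germ_def by simp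
    fix u u' v assume a: "\<Phi> u = Some v" "\<Phi> u' = Some v"
    \<comment> \<open>A common suffix \<open>x @ y\<close> moves both arguments into the domain of
      \<phi>, where injectivity applies; the suffix is then cancelled.\<close>
    obtain x where x: "u @ x \<in> dom \<phi>" using ess by blast
    obtain y where y: "(u' @ x) @ y \<in> dom \<phi>" using ess by blast
    have "\<phi> (u @ x) = Some (v @ x)" using a(1) x by (auto simp: \<Phi> germ_def)
    from right_ideal_isoD[OF iso this, of y] have "\<phi> (u @ x @ y) = Some (v @ x @ y)" by simp
    moreover have "\<phi> (u' @ x @ y) = Some (v @ x @ y)" using a(2) y by (auto simp: \<Phi> germ_def)
    ultimately show "u = u'" using right_ideal_iso_inj[OF iso] by blast
  qed
  have 2: "\<phi> \<subseteq>\<^sub>m \<Phi>"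
    unfolding map_le_def
  proof
    fix u assume "u \<in> dom \<phi>"
    then obtain v where v: "\<phi> u = Some v" by auto
    hence "germ \<phi> u v" using right_ideal_isoD[OF iso] by (simp add: germ_def)
    thus "\<phi> u = \<Phi> u" using v \<Phi>[of u v] by simp
  qed
  have 3: "\<Psi> \<subseteq>\<^sub>m \<Phi>" if "right_ideal_iso \<Psi>" "\<phi> \<subseteq>\<^sub>m \<Psi>" for \<Psi>
    unfolding map_le_def
  proof
    fix u assume "u \<in> dom \<Psi>"
    then obtain v where v: "\<Psi> u = Some v" by auto
    have "germ \<phi> u v"
      unfolding germ_def using that(2) right_ideal_isoD[OF that(1) v] by (auto simp: map_le_def)
    thus "\<Psi> u = \<Phi> u" using v \<Phi>[of u v] by simp
  qed
  have "max_extension \<phi> = \<Phi>"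
    unfolding max_extension_def
    by (rule the_equality) (use 1 2 3 map_le_antisym in blast)+
  thus "right_ideal_iso (max_extension \<phi>)" "\<phi> \<subseteq>\<^sub>m max_extension \<phi>"
    "\<And>u v. max_extension \<phi> u = Some v \<longleftrightarrow> germ \<phi> u v"
    "\<And>\<Psi>. right_ideal_iso \<Psi> \<Longrightarrow> \<phi> \<subseteq>\<^sub>m \<Psi> \<Longrightarrow> \<Psi> \<subseteq>\<^sub>m max_extension \<phi>"
    using 1 2 3 \<Phi> by auto
qed

lemma dense_iso_max_extension:
  assumes "dense_iso \<phi>"
  shows "dense_iso (max_extension \<phi>)"
  using max_extension_char(1)[OF assms] map_le_implies_dom_le[OF max_extension_char(2)[OF assms]] assms
  unfolding dense_iso_def by fast

text \<open>Germs can be tested on any smaller dense domain, so restricting an isomorphism loses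
  nothing.\<close>

lemma max_extension_cong:
  assumes "dense_iso \<phi>" "dense_iso \<theta>" "\<phi> \<subseteq>\<^sub>m \<theta>"
  shows "max_extension \<phi> = max_extension \<theta>"
proof (rule map_le_antisym)
  show "max_extension \<theta> \<subseteq>\<^sub>m max_extension \<phi>"
    by (rule max_extension_char(4)[OF assms(1) max_extension_char(1)[OF assms(2)]
          map_le_trans[OF assms(3) max_extension_char(2)[OF assms(2)]]])
  show "max_extension \<phi> \<subseteq>\<^sub>m max_extension \<theta>"
    unfolding map_le_def
  proof
    fix u assume "u \<in> dom (max_extension \<phi>)"
    then obtain v where v: "max_extension \<phi> u = Some v" by auto
    have "germ \<theta> u v"
      unfolding germ_def
    proof (intro allI impI)
      fix x assume "u @ x \<in> dom \<theta>"
      then obtain w where w: "\<theta> (u @ x) = Some w" by auto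
      \<comment> \<open>The value of \<theta> at \<open>u @ x\<close> is pinned down by continuing
        into the smaller domain and cancelling \<open>y\<close>.\<close>
      obtain y where y: "(u @ x) @ y \<in> dom \<phi>" using assms(1) unfolding dense_iso_def by blast
      have "\<phi> (u @ x @ y) = Some (v @ x @ y)"
        using v y max_extension_char(3)[OF assms(1)] by (simp add: germ_def)
      moreover have "\<theta> (u @ x @ y) = Some (w @ y)"
        using right_ideal_isoD[where \<phi> = \<theta>, of "u @ x" w y] w assms(2) by (simp add: dense_iso_def)
      moreover have "\<phi> (u @ x @ y) = \<theta> (u @ x @ y)" using assms(3) y by (auto simp: map_le_def)
      ultimately show "\<theta> (u @ x) = Some (v @ x)" using w by simp
    qed
    thus "max_extension \<phi> u = max_extension \<theta> u" using v max_extension_char(3)[OF assms(2), of u v] by simp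
  qed
qed

text \<open>The identity is total, so once it extends \<phi> no extension can be larger. Equality
  with the identity of \<open>V\<close> is thus decided on \<phi> itself.\<close>

lemma max_extension_eq_Some_iff:
  assumes "dense_iso \<phi>"
  shows "max_extension \<phi> = Some \<longleftrightarrow> \<phi> \<subseteq>\<^sub>m Some"
proof
  assume "\<phi> \<subseteq>\<^sub>m Some"
  hence "Some \<subseteq>\<^sub>m max_extension \<phi>"
    by (rule max_extension_char(4)[OF assms right_ideal_iso_Some])
  thus "max_extension \<phi> = Some" by (auto simp: map_le_def)
qed (use max_extension_char(2)[OF assms] in simp)

section \<open>Products in V and plain composites\<close>

lemma map_comp_mono: "\<phi> \<subseteq>\<^sub>m \<phi>' \<Longrightarrow> \<psi> \<subseteq>\<^sub>m \<psi>' \<Longrightarrow> \<phi> \<circ>\<^sub>m \<psi> \<subseteq>\<^sub>m \<phi>' \<circ>\<^sub>m \<psi>'"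
  unfolding map_le_def by (auto simp: map_comp_Some_iff dom_def)

text \<open>The last map of the list acts first, as in the products of \<open>V\<close>.\<close>

definition composite :: "('a \<rightharpoonup> 'a) list \<Rightarrow> 'a \<rightharpoonup> 'a" where
  "composite \<psi>s = foldr (\<circ>\<^sub>m) \<psi>s Some"

lemma composite_simps [simp]:
  "composite [] = Some" "composite (\<psi> # \<psi>s) = \<psi> \<circ>\<^sub>m composite \<psi>s"
  by (simp_all add: composite_def)

lemma map_comp_Some [simp]: "\<phi> \<circ>\<^sub>m Some = \<phi>" "Some \<circ>\<^sub>m \<phi> = \<phi>"
  by (auto simp: map_comp_def split: option.splits)

lemma map_comp_assoc: "(\<phi> \<circ>\<^sub>m \<psi>) \<circ>\<^sub>m \<theta> = \<phi> \<circ>\<^sub>m (\<psi> \<circ>\<^sub>m \<theta>)"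
  by (auto simp: map_comp_def split: option.splits)

lemma composite_append [simp]: "composite (\<psi>s @ \<psi>s') = composite \<psi>s \<circ>\<^sub>m composite \<psi>s'"
  by (induction \<psi>s) (simp_all add: map_comp_assoc)

lemma dense_iso_composite: "(\<And>\<psi>. \<psi> \<in> set \<psi>s \<Longrightarrow> dense_iso \<psi>) \<Longrightarrow> dense_iso (composite \<psi>s)"
  by (induction \<psi>s) (simp_all add: dense_iso_Some dense_iso_comp)

text \<open>Maximizing the factors and the partial products only enlarges the composite, and by
  \<open>max_extension_cong\<close> an enlargement has the same maximal extension.\<close>

lemma V_product_eq:
  assumes "\<And>\<psi>. \<psi> \<in> set \<psi>s \<Longrightarrow> dense_iso \<psi>"
  shows "V_product \<psi>s = max_extension (composite \<psi>s)"
  using assms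
proof (induction \<psi>s)
  case Nil
  show ?case using max_extension_eq_Some_iff[OF dense_iso_Some]
    by (simp add: V_product_def thompson_V_def eq_commute)
next
  case (Cons \<psi> \<psi>s)
  have d: "dense_iso \<psi>" "dense_iso (composite \<psi>s)"
    using Cons.prems by (auto intro: dense_iso_composite)
  have "V_product (\<psi> # \<psi>s) = max_extension (max_extension \<psi> \<circ>\<^sub>m V_product \<psi>s)"
    by (simp add: V_product_def thompson_V_def)
  also have "\<dots> = max_extension (max_extension \<psi> \<circ>\<^sub>m max_extension (composite \<psi>s))"
    using Cons by simp
  also have "\<dots> = max_extension (\<psi> \<circ>\<^sub>m composite \<psi>s)"
    by (rule max_extension_cong[symmetric])
      (auto intro!: d dense_iso_comp dense_iso_max_extension map_comp_mono max_extension_char(2))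
  finally show ?case by simp
qed

lemma V_product_eq_one_iff:
  assumes "\<And>\<psi>. \<psi> \<in> set \<psi>s \<Longrightarrow> dense_iso \<psi>"
  shows "V_product \<psi>s = \<one>\<^bsub>thompson_V\<^esub> \<longleftrightarrow> composite \<psi>s \<subseteq>\<^sub>m Some"
  using V_product_eq[OF assms] max_extension_eq_Some_iff[OF dense_iso_composite[OF assms]]
  by (simp add: thompson_V_def)

section \<open>Tables as relations between words\<close>

text \<open>Equivalently, both projections of \<open>E\<close> are injective and have prefix codes
  as images. Stating this symmetrically lets sources and targets be treated alike.\<close>

definition bicode :: "('a list \<times> 'a list) set \<Rightarrow> bool" where
  "bicode E \<longleftrightarrow> (\<forall>p q p' q'. (p, q) \<in> E \<longrightarrow> (p', q') \<in> E \<longrightarrow> prefix p p' \<or> prefix q q' \<longrightarrow> p = p' \<and> q = q')"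

lemma bicodeD:
  assumes "bicode E" "(p, q) \<in> E" "(p', q') \<in> E" "prefix p p' \<or> prefix p' p \<or> prefix q q' \<or> prefix q' q"
  shows "p = p' \<and> q = q'"
  using assms unfolding bicode_def by blast

text \<open>A link between maps and relations that avoids the description operator in
  \<open>table\<close>; the link to \<open>table\<close> itself is made once, in
  \<open>presents_table\<close>.\<close>

definition presents :: "('a list \<times> 'a list) set \<Rightarrow> ('a list \<rightharpoonup> 'a list) \<Rightarrow> bool" where
  "presents E \<phi> \<longleftrightarrow> bicode E \<and> (\<forall>u v. \<phi> u = Some v \<longleftrightarrow> (\<exists>p q x. (p, q) \<in> E \<and> u = p @ x \<and> v = q @ x))"

lemma presents_apply:
  assumes "presents E \<phi>" "(p, q) \<in> E"
  shows "\<phi> (p @ x) = Some (q @ x)"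
  using assms(1)[unfolded presents_def, THEN conjunct2, rule_format, of "p @ x" "q @ x"] assms(2) by blast

lemma presents_cases:
  assumes "presents E \<phi>" "\<phi> u = Some v"
  obtains p q x where "(p, q) \<in> E" "u = p @ x" "v = q @ x"
  using assms(1)[unfolded presents_def, THEN conjunct2, rule_format, of u v] assms(2) by blast

lemma presentsI:
  assumes "bicode E" "\<And>u v. \<phi> u = Some v \<Longrightarrow> \<exists>p q x. (p, q) \<in> E \<and> u = p @ x \<and> v = q @ x"
    "\<And>p q x. (p, q) \<in> E \<Longrightarrow> \<phi> (p @ x) = Some (q @ x)"
  shows "presents E \<phi>"
  unfolding presents_def using assms by blast

text \<open>Either the target of the first entry is at least as long as the source of the second, or
  it is at most as long. The two cases overlap at \<open>x = []\<close>.\<close>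

definition compose_rel :: "('a list \<times> 'a list) set \<Rightarrow> ('a list \<times> 'a list) set \<Rightarrow> ('a list \<times> 'a list) set" where
  "compose_rel E E' = {(p, q' @ x) |p p' q' x. (p, p' @ x) \<in> E \<and> (p', q') \<in> E'} \<union>
     {(p @ x, q') |p q x q'. (p, q) \<in> E \<and> (q @ x, q') \<in> E'}"

text \<open>The difference of the lengths of \<open>a\<close> and \<open>b\<close> tells which
  suffix is empty and how long the other one is.\<close>

lemma append_eq_cases:
  assumes "a @ x = b @ y" "a @ x' = b @ y'" "x = [] \<or> y = []" "x' = [] \<or> y' = []"
  shows "x = x' \<and> y = y'"
proof -
  have l: "length x = length x' \<and> length y = length y'"
    using arg_cong[OF assms(1), of length] arg_cong[OF assms(2), of length] assms(3,4) by auto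
  from assms(3) show ?thesis
  proof
    assume "x = []"
    thus ?thesis using l assms(1,2) by simp
  next
    assume "y = []"
    hence "a @ x = a @ x'" using l assms(1,2) by simp
    thus ?thesis using l \<open>y = []\<close> by simp
  qed
qed

text \<open>An entry of the composite is a pair of entries whose middle words become equal after
  appending suffixes, one of them empty. If two composite entries are comparable on one outer side,
  the factor on that side is the same entry; cancelling it makes the middle words comparable, so the
  other factor is the same entry too.\<close>

lemma bicode_compose:
  assumes E: "bicode E" and E': "bicode E'"
  shows "bicode (compose_rel E E')"
  unfolding bicode_def
proof (intro allI impI)
  fix p q p' q' assume a: "(p, q) \<in> compose_rel E E'" "(p', q') \<in> compose_rel E E'" "prefix p p' \<or> prefix q q'"
  have *: "\<exists>p0 q0 r0 s0 x y. (p0, q0) \<in> E \<and> (r0, s0) \<in> E' \<and> q0 @ x = r0 @ y \<and> p = p0 @ x \<and> q = s0 @ y \<and> (x = [] \<or> y = [])"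
    if "(p, q) \<in> compose_rel E E'" for p q
    using that unfolding compose_rel_def by fastforce
  obtain p0 q0 r0 s0 x y where 1: "(p0, q0) \<in> E" "(r0, s0) \<in> E'" "q0 @ x = r0 @ y" "p = p0 @ x" "q = s0 @ y" "x = [] \<or> y = []"
    using *[OF a(1)] by blast
  obtain p0' q0' r0' s0' x' y' where 2: "(p0', q0') \<in> E" "(r0', s0') \<in> E'" "q0' @ x' = r0' @ y'" "p' = p0' @ x'" "q' = s0' @ y'" "x' = [] \<or> y' = []"
    using *[OF a(2)] by blast
  have "p0 = p0' \<and> q0 = q0' \<and> r0 = r0' \<and> s0 = s0'"
    using a(3)
  proof
    assume "prefix p p'"
    then obtain z where "p0' @ x' = p0 @ x @ z" using 1 2 by (auto simp: prefix_def)
    hence "prefix p0 p0' \<or> prefix p0' p0" by (metis prefixI prefix_same_cases)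
    hence e: "p0 = p0' \<and> q0 = q0'" using bicodeD[OF E 1(1) 2(1)] by blast
    hence "r0' @ y' = r0 @ y @ z" using \<open>p0' @ x' = p0 @ x @ z\<close> 1(3) 2(3)
      by (metis append_assoc same_append_eq)
    hence "prefix r0 r0' \<or> prefix r0' r0" by (metis prefixI prefix_same_cases)
    thus ?thesis using e bicodeD[OF E' 1(2) 2(2)] by blast
  next
    assume "prefix q q'"
    then obtain z where "s0' @ y' = s0 @ y @ z" using 1 2 by (auto simp: prefix_def)
    hence "prefix s0 s0' \<or> prefix s0' s0" by (metis prefixI prefix_same_cases)
    hence e: "r0 = r0' \<and> s0 = s0'" using bicodeD[OF E' 1(2) 2(2)] by blast
    hence "q0' @ x' = q0 @ x @ z" using \<open>s0' @ y' = s0 @ y @ z\<close> 1(3) 2(3)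
      by (metis append_assoc same_append_eq)
    hence "prefix q0 q0' \<or> prefix q0' q0" by (metis prefixI prefix_same_cases)
    thus ?thesis using e bicodeD[OF E 1(1) 2(1)] by blast
  qed
  hence e: "p0 = p0'" "q0 = q0'" "r0 = r0'" "s0 = s0'" by blast+
  have "x = x' \<and> y = y'"
    by (rule append_eq_cases[OF 1(3) _ 1(6) 2(6)]) (simp only: e 2(3))
  thus "p = p' \<and> q = q'" by (simp only: 1(4,5) 2(4,5) e)
qed

lemma presents_compose:
  assumes "presents E \<phi>" "presents E' \<psi>"
  shows "presents (compose_rel E E') (\<psi> \<circ>\<^sub>m \<phi>)"
proof (rule presentsI)
  show "bicode (compose_rel E E')" using assms bicode_compose unfolding presents_def by fast
next
  fix u w assume "(\<psi> \<circ>\<^sub>m \<phi>) u = Some w"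
  then obtain v where v: "\<phi> u = Some v" "\<psi> v = Some w" by (auto simp: map_comp_Some_iff)
  obtain p q x where 1: "(p, q) \<in> E" "u = p @ x" "v = q @ x"
    using presents_cases[OF assms(1) v(1)] .
  obtain p' q' x' where 2: "(p', q') \<in> E'" "v = p' @ x'" "w = q' @ x'"
    using presents_cases[OF assms(2) v(2)] .
  from 1(3) 2(2) have "q @ x = p' @ x'" by simp
  \<comment> \<open>Two prefixes of one word are comparable; the two alternatives are the two halves
    of \<open>compose_rel\<close>.\<close>
  then obtain z where "q = p' @ z \<and> z @ x = x' \<or> q @ z = p' \<and> x = z @ x'"
    unfolding append_eq_append_conv2 by blast
  thus "\<exists>p q x. (p, q) \<in> compose_rel E E' \<and> u = p @ x \<and> w = q @ x"
  proof
    assume z: "q = p' @ z \<and> z @ x = x'"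
    hence "(p, q' @ z) \<in> compose_rel E E'" using 1(1) 2(1) unfolding compose_rel_def by fast
    moreover have "w = (q' @ z) @ x" using 2(3) z by simp
    ultimately show ?thesis using 1(2) by blast
  next
    assume z: "q @ z = p' \<and> x = z @ x'"
    hence "(p @ z, q') \<in> compose_rel E E'" using 1(1) 2(1) unfolding compose_rel_def by fast
    moreover have "u = (p @ z) @ x'" using 1(2) z by simp
    ultimately show ?thesis using 2(3) by blast
  qed
next
  fix p q x assume "(p, q) \<in> compose_rel E E'"
  thus "(\<psi> \<circ>\<^sub>m \<phi>) (p @ x) = Some (q @ x)"
    unfolding compose_rel_def
  proof (elim UnE CollectE exE conjE)
    fix p0 p' q' y assume "(p, q) = (p0, q' @ y)" "(p0, p' @ y) \<in> E" "(p', q') \<in> E'"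
    thus ?thesis
      using presents_apply[OF assms(1), of p "p' @ y" x] presents_apply[OF assms(2), of p' q' "y @ x"] by simp
  next
    fix p0 q0 y q' assume "(p, q) = (p0 @ y, q')" "(p0, q0) \<in> E" "(q0 @ y, q') \<in> E'"
    thus ?thesis
      using presents_apply[OF assms(1), of p0 q0 "y @ x"] presents_apply[OF assms(2), of "q0 @ y" q' x] by simp
  qed
qed

lemma presents_Some: "presents {([], [])} Some"
  by (rule presentsI) (simp_all add: bicode_def)

lemma presents_le_Some_iff:
  assumes "presents E \<phi>"
  shows "\<phi> \<subseteq>\<^sub>m Some \<longleftrightarrow> (\<forall>(p, q)\<in>E. p = q)"
proof
  assume *: "\<phi> \<subseteq>\<^sub>m Some"
  have "p = q" if "(p, q) \<in> E" for p q
  proof -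
    have "\<phi> p = Some q" using presents_apply[OF assms that, of "[]"] by simp
    moreover from this have "\<phi> p = Some p" using * unfolding map_le_def by blast
    ultimately show ?thesis by simp
  qed
  thus "\<forall>(p, q)\<in>E. p = q" by blast
next
  assume *: "\<forall>(p, q)\<in>E. p = q"
  show "\<phi> \<subseteq>\<^sub>m Some"
    unfolding map_le_def
  proof
    fix u assume "u \<in> dom \<phi>"
    then obtain v where v: "\<phi> u = Some v" by blast
    obtain p q x where "(p, q) \<in> E" "u = p @ x" "v = q @ x" using presents_cases[OF assms v] .
    thus "\<phi> u = Some u" using * v by auto
  qed
qed

section \<open>Prefix codes of right ideals and their tables\<close>

lemma generated_idealI: "p \<in> P \<Longrightarrow> p @ x \<in> generated_ideal P"
  unfolding generated_ideal_def by blast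

lemma generated_ideal_superset: "P \<subseteq> generated_ideal P"
  using generated_idealI[where x = "[]"] by auto

lemma generated_idealE:
  assumes "u \<in> generated_ideal P"
  obtains p x where "p \<in> P" "u = p @ x"
  using assms unfolding generated_ideal_def by blast

text \<open>A word of one code has a prefix in the other, which in turn has a prefix in the first;
  within a prefix code the ends of this chain coincide, and hence so does the middle.\<close>

lemma ideal_code_eq:
  assumes "prefix_code P" "R = generated_ideal P"
  shows "ideal_code R = P"
proof -
  have *: "A \<subseteq> B" if A: "prefix_code A" and B: "prefix_code B" "generated_ideal A = generated_ideal B" for A B :: "'a list set"
  proof
    fix p assume p: "p \<in> A"
    hence "p \<in> generated_ideal B" using B(2) generated_ideal_superset[of A] by blast
    then obtain q x where q: "q \<in> B" "p = q @ x" by (rule generated_idealE)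
    hence "q \<in> generated_ideal A" using B(2) generated_ideal_superset[of B] by blast
    then obtain r y where r: "r \<in> A" "q = r @ y" by (rule generated_idealE)
    have "prefix r p" using q r by simp
    hence "r = p" using A p r(1) unfolding prefix_code_def strict_prefix_def by blast
    hence "x = []" using q r by simp
    thus "p \<in> B" using q by simp
  qed
  show ?thesis
    unfolding ideal_code_def
  proof (rule the_equality)
    show "prefix_code P \<and> R = generated_ideal P" using assms by blast
    fix Q assume Q: "prefix_code Q \<and> R = generated_ideal Q"
    show "Q = P"
      using *[of Q P] *[of P Q] Q assms by simp
  qed
qed

text \<open>The sources form a prefix code generating the domain, and there is only one such code.
  So whatever relation is computed for a composite is its table, with no separate minimality
  argument.\<close>

lemma presents_table:
  assumes "presents E \<phi>"
  shows "table \<phi> = E"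
proof -
  have val: "\<phi> p = Some q" if "(p, q) \<in> E" for p q
    using presents_apply[OF assms that, of "[]"] by simp
  have "prefix_code (fst ` E)"
    using assms unfolding presents_def bicode_def prefix_code_def strict_prefix_def by auto
  moreover have "dom \<phi> = generated_ideal (fst ` E)"
  proof (intro equalityI subsetI)
    fix u assume "u \<in> dom \<phi>"
    then obtain v where v: "\<phi> u = Some v" by blast
    obtain p q x where "(p, q) \<in> E" "u = p @ x" "v = q @ x" using presents_cases[OF assms v] .
    thus "u \<in> generated_ideal (fst ` E)" using generated_idealI[of p "fst ` E" x] by force
  next
    fix u assume "u \<in> generated_ideal (fst ` E)"
    then obtain p x where "p \<in> fst ` E" "u = p @ x" by (rule generated_idealE)
    thus "u \<in> dom \<phi>" using presents_apply[OF assms] by auto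
  qed
  ultimately have "ideal_code (dom \<phi>) = fst ` E" by (rule ideal_code_eq)
  hence "table \<phi> = (\<lambda>p. (p, the (\<phi> p))) ` fst ` E" unfolding table_def by blast
  also have "\<dots> = id ` E" unfolding image_image by (rule image_cong) (auto simp: val)
  finally show ?thesis by simp
qed

lemma finite_essential_iso_presents:
  assumes "finite_essential_iso \<phi>"
  shows "presents (table \<phi>) \<phi>"
proof -
  obtain P where P: "maximal_prefix_code P" "dom \<phi> = generated_ideal P"
    using assms unfolding finite_essential_iso_def by blast
  have iso: "right_ideal_iso \<phi>"
    using assms unfolding finite_essential_iso_def essential_iso_def by blast
  have pc: "prefix_code P" using P by (simp add: maximal_prefix_code_def)
  have sub: "P \<subseteq> dom \<phi>" unfolding P(2) by (rule generated_ideal_superset)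
  have t: "table \<phi> = {(p, the (\<phi> p)) |p. p \<in> P}"
    unfolding table_def using ideal_code_eq[OF pc P(2)] by simp
  hence tD: "(p, q) \<in> table \<phi> \<longleftrightarrow> p \<in> P \<and> \<phi> p = Some q" for p q
    using sub by auto
  have "bicode (table \<phi>)"
    unfolding bicode_def
  proof (intro allI impI)
    fix p q p' q' assume a: "(p, q) \<in> table \<phi>" "(p', q') \<in> table \<phi>" "prefix p p' \<or> prefix q q'"
    \<comment> \<open>A prefix relation between targets is pulled back by injectivity, which reduces
      both cases to the prefix code of the domain.\<close>
    have "prefix p p'"
    proof (cases "prefix q q'")
      case True
      then obtain x where "q' = q @ x" by (auto simp: prefix_def)
      hence "\<phi> (p @ x) = Some q'" using a tD right_ideal_isoD[OF iso] by blast
      hence "p @ x = p'" using a tD right_ideal_iso_inj[OF iso] by blast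
      thus ?thesis by auto
    qed (use a in blast)
    hence "p = p'" using pc a unfolding tD prefix_code_def strict_prefix_def by blast
    thus "p = p' \<and> q = q'" using a by (simp add: tD)
  qed
  thus ?thesis
  proof (rule presentsI)
    fix u v assume a: "\<phi> u = Some v"
    hence "u \<in> generated_ideal P" using P(2) by auto
    then obtain p x where p: "p \<in> P" "u = p @ x" by (rule generated_idealE)
    then obtain q where q: "\<phi> p = Some q" using sub by auto
    hence "v = q @ x" using right_ideal_isoD[OF iso q, of x] a p by simp
    thus "\<exists>p q x. (p, q) \<in> table \<phi> \<and> u = p @ x \<and> v = q @ x" using p q tD by blast
  qed (use tD right_ideal_isoD[OF iso] in blast)
qed

section \<open>Composing tables slot by slot\<close>

type_synonym 'a entry = "bool \<times> 'a list \<times> 'a list"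

abbreviation flag :: "'a entry \<Rightarrow> bool" where "flag \<equiv> fst"
abbreviation src :: "'a entry \<Rightarrow> 'a list" where "src e \<equiv> fst (snd e)"
abbreviation tgt :: "'a entry \<Rightarrow> 'a list" where "tgt e \<equiv> snd (snd e)"

definition entries :: "'a entry list \<Rightarrow> ('a list \<times> 'a list) list" where
  "entries T = map snd (filter flag T)"

lemma entries_simps [simp]:
  "entries [] = []" "entries (e # T) = (if flag e then snd e # entries T else entries T)"
  "entries (T @ T') = entries T @ entries T'"
  by (simp_all add: entries_def)

lemma in_entries_iff: "pq \<in> set (entries T) \<longleftrightarrow> (True, pq) \<in> set T"
  by (induction T) auto

text \<open>Taking the first match keeps this a first-order formula in the slots for arbitrary
  \<open>T\<close>. The default is marked invalid, and its empty words respect every length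
  bound.\<close>

definition pick :: "('a entry \<Rightarrow> bool) \<Rightarrow> 'a entry list \<Rightarrow> 'a entry" where
  "pick P T = (case find P T of None \<Rightarrow> (False, [], []) | Some e \<Rightarrow> e)"

lemma pick_cases:
  obtains "pick P T \<in> set T" "P (pick P T)" | "pick P T = (False, [], [])" "\<And>e. e \<in> set T \<Longrightarrow> \<not> P e"
proof (cases "find P T")
  case None
  hence "pick P T = (False, [], [])" "\<And>e. e \<in> set T \<Longrightarrow> \<not> P e"
    using None by (simp_all add: pick_def) (auto simp: find_None_iff)
  thus thesis by (rule that(2))
next
  case (Some e)
  hence "e \<in> set T" "P e" by (auto simp: find_Some_iff)
  thus thesis using that(1) Some by (simp add: pick_def)
qed

definition follow :: "'a entry list \<Rightarrow> 'a entry \<Rightarrow> 'a entry" where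
  "follow T' e = (let e' = pick (\<lambda>e'. flag e' \<and> prefix (src e') (tgt e)) T'
     in (flag e \<and> flag e', src e, tgt e' @ drop (length (src e')) (tgt e)))"

text \<open>Strictness leaves equal middle words to \<open>follow\<close>, so that no entry of the
  composite is produced twice.\<close>

definition precede :: "'a entry list \<Rightarrow> 'a entry \<Rightarrow> 'a entry" where
  "precede T e' = (let e = pick (\<lambda>e. flag e \<and> strict_prefix (tgt e) (src e')) T
     in (flag e' \<and> flag e, src e @ drop (length (tgt e)) (src e'), tgt e'))"

definition comp_table :: "'a entry list \<Rightarrow> 'a entry list \<Rightarrow> 'a entry list" where
  "comp_table T T' = map (follow T') T @ map (precede T) T'"

lemma in_entries_follow:
  assumes E': "bicode (set (entries T'))"
  shows "pq \<in> set (entries (map (follow T') T)) \<longleftrightarrow>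
    (\<exists>p p' q' x. pq = (p, q' @ x) \<and> (p, p' @ x) \<in> set (entries T) \<and> (p', q') \<in> set (entries T'))"
proof
  assume "pq \<in> set (entries (map (follow T') T))"
  then obtain e where e: "e \<in> set T" "(True, pq) = follow T' e" unfolding in_entries_iff by auto
  define e' where "e' = pick (\<lambda>e'. flag e' \<and> prefix (src e') (tgt e)) T'"
  have f: "follow T' e = (flag e \<and> flag e', src e, tgt e' @ drop (length (src e')) (tgt e))"
    by (simp add: follow_def e'_def Let_def)
  have fl: "flag e" "flag e'" using e(2) f by auto
  have e': "e' \<in> set T'" "prefix (src e') (tgt e)"
    using fl(2) unfolding e'_def by (cases rule: pick_cases[of "\<lambda>e'. flag e' \<and> prefix (src e') (tgt e)" T'], simp_all)+
  then obtain x where x: "tgt e = src e' @ x" by (auto simp: prefix_def)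
  have "(src e, src e' @ x) \<in> set (entries T)" "(src e', tgt e') \<in> set (entries T')"
    using e(1) e'(1) fl x[symmetric] by (simp_all add: in_entries_iff) (metis prod.collapse)+
  moreover have "pq = (src e, tgt e' @ x)" using e(2) f x by simp
  ultimately show "\<exists>p p' q' x. pq = (p, q' @ x) \<and> (p, p' @ x) \<in> set (entries T) \<and> (p', q') \<in> set (entries T')"
    by blast
next
  assume "\<exists>p p' q' x. pq = (p, q' @ x) \<and> (p, p' @ x) \<in> set (entries T) \<and> (p', q') \<in> set (entries T')"
  then obtain p p' q' x where *: "pq = (p, q' @ x)" "(p, p' @ x) \<in> set (entries T)" "(p', q') \<in> set (entries T')"
    by blast
  define P where "P = (\<lambda>e' :: 'a entry. flag e' \<and> prefix (src e') (p' @ x))"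
  have e': "pick P T' \<in> set T' \<and> P (pick P T')"
  proof (cases rule: pick_cases[of P T'])
    case 2
    from 2(2)[of "(True, p', q')"] *(3) show ?thesis by (simp add: P_def in_entries_iff)
  qed simp
  obtain v'' p'' q'' where pk: "pick P T' = (v'', p'', q'')" by (metis prod.exhaust)
  have m: "(p'', q'') \<in> set (entries T')" "v''" "prefix p'' (p' @ x)"
    using e'[unfolded pk] by (auto simp: P_def in_entries_iff)
  \<comment> \<open>Prefixes of one word are comparable, and \<open>bicode\<close> turns comparable
    entries into equal ones: the first match is the intended match.\<close>
  have "prefix p'' p' \<or> prefix p' p''" using m(3) by (metis prefixI prefix_same_cases)
  hence "p'' = p' \<and> q'' = q'" using bicodeD[OF E' m(1) *(3)] by blast
  hence "follow T' (True, p, p' @ x) = (True, pq)"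
    using pk[unfolded P_def] m(2) by (simp add: follow_def Let_def *(1))
  moreover have "(True, p, p' @ x) \<in> set T" using *(2) by (simp add: in_entries_iff)
  ultimately show "pq \<in> set (entries (map (follow T') T))"
    unfolding in_entries_iff set_map by (metis imageI)
qed

lemma in_entries_precede:
  assumes E: "bicode (set (entries T))"
  shows "pq \<in> set (entries (map (precede T) T')) \<longleftrightarrow>
    (\<exists>p q x q'. pq = (p @ x, q') \<and> x \<noteq> [] \<and> (p, q) \<in> set (entries T) \<and> (q @ x, q') \<in> set (entries T'))"
proof
  assume "pq \<in> set (entries (map (precede T) T'))"
  then obtain e' where e': "e' \<in> set T'" "(True, pq) = precede T e'" unfolding in_entries_iff by auto
  define e where "e = pick (\<lambda>e. flag e \<and> strict_prefix (tgt e) (src e')) T"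
  have f: "precede T e' = (flag e' \<and> flag e, src e @ drop (length (tgt e)) (src e'), tgt e')"
    by (simp add: precede_def e_def Let_def)
  have fl: "flag e" "flag e'" using e'(2) f by auto
  have e: "e \<in> set T" "strict_prefix (tgt e) (src e')"
    using fl(1) unfolding e_def by (cases rule: pick_cases[of "\<lambda>e. flag e \<and> strict_prefix (tgt e) (src e')" T], simp_all)+
  then obtain x where x: "src e' = tgt e @ x" "x \<noteq> []" by (auto simp: strict_prefix_def prefix_def)
  have "(src e, tgt e) \<in> set (entries T)" "(tgt e @ x, tgt e') \<in> set (entries T')"
    using e(1) e'(1) fl x(1)[symmetric] by (simp_all add: in_entries_iff) (metis prod.collapse)+
  moreover have "pq = (src e @ x, tgt e')" using e'(2) f x by simp
  ultimately show "\<exists>p q x q'. pq = (p @ x, q') \<and> x \<noteq> [] \<and> (p, q) \<in> set (entries T) \<and> (q @ x, q') \<in> set (entries T')"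
    using x(2) by blast
next
  assume "\<exists>p q x q'. pq = (p @ x, q') \<and> x \<noteq> [] \<and> (p, q) \<in> set (entries T) \<and> (q @ x, q') \<in> set (entries T')"
  then obtain p q x q' where *: "pq = (p @ x, q')" "x \<noteq> []" "(p, q) \<in> set (entries T)" "(q @ x, q') \<in> set (entries T')"
    by blast
  define P where "P = (\<lambda>e :: 'a entry. flag e \<and> strict_prefix (tgt e) (q @ x))"
  have e: "pick P T \<in> set T \<and> P (pick P T)"
  proof (cases rule: pick_cases[of P T])
    case 2
    from 2(2)[of "(True, p, q)"] *(2,3) show ?thesis by (simp add: P_def in_entries_iff strict_prefix_def)
  qed simp
  obtain v'' p'' q'' where pk: "pick P T = (v'', p'', q'')" by (metis prod.exhaust)
  have m: "(p'', q'') \<in> set (entries T)" "v''" "prefix q'' (q @ x)"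
    using e[unfolded pk] by (auto simp: P_def in_entries_iff)
  have "prefix q'' q \<or> prefix q q''" using m(3) by (metis prefixI prefix_same_cases)
  hence "p'' = p \<and> q'' = q" using bicodeD[OF E m(1) *(3)] by blast
  hence "precede T (True, q @ x, q') = (True, pq)"
    using pk[unfolded P_def] m(2) by (simp add: precede_def Let_def *(1))
  moreover have "(True, q @ x, q') \<in> set T'" using *(4) by (simp add: in_entries_iff)
  ultimately show "pq \<in> set (entries (map (precede T) T'))"
    unfolding in_entries_iff set_map by (metis imageI)
qed

lemma set_entries_comp_table:
  assumes "bicode (set (entries T))" "bicode (set (entries T'))"
  shows "set (entries (comp_table T T')) = compose_rel (set (entries T)) (set (entries T'))"
proof -
  {
    fix pq
    have "pq \<in> set (entries (comp_table T T')) \<longleftrightarrow>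
        (\<exists>p p' q' x. pq = (p, q' @ x) \<and> (p, p' @ x) \<in> set (entries T) \<and> (p', q') \<in> set (entries T')) \<or>
        (\<exists>p q x q'. pq = (p @ x, q') \<and> x \<noteq> [] \<and> (p, q) \<in> set (entries T) \<and> (q @ x, q') \<in> set (entries T'))"
      unfolding comp_table_def entries_simps(3) set_append Un_iff in_entries_follow[OF assms(2)]
        in_entries_precede[OF assms(1)] by (rule refl)
    also have "\<dots> \<longleftrightarrow> pq \<in> compose_rel (set (entries T)) (set (entries T'))" (is "?l \<longleftrightarrow> ?r")
    proof
      assume ?l
      thus ?r unfolding compose_rel_def by blast
    next
      assume ?r
      then consider p p' q' x where "pq = (p, q' @ x)" "(p, p' @ x) \<in> set (entries T)" "(p', q') \<in> set (entries T')"
        | p q x q' where "pq = (p @ x, q')" "(p, q) \<in> set (entries T)" "(q @ x, q') \<in> set (entries T')"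
        unfolding compose_rel_def by blast
      thus ?l
      proof cases
        case 2
        show ?thesis
        \<comment> \<open>For \<open>x = []\<close> the entry also has the first form, although
          \<open>precede\<close> skips it.\<close>
        proof (cases "x = []")
          case True
          have "pq = (p, q' @ [])" "(p, q @ []) \<in> set (entries T)" "(q, q') \<in> set (entries T')"
            using 2 True by simp_all
          thus ?thesis by blast
        qed (use 2 in blast)
      qed blast
    qed
    finally have "pq \<in> set (entries (comp_table T T')) \<longleftrightarrow> pq \<in> compose_rel (set (entries T)) (set (entries T'))" .
  }
  thus ?thesis by blast
qed

lemma presents_comp_table:
  assumes "presents (set (entries T)) \<phi>" "presents (set (entries T')) \<psi>"
  shows "presents (set (entries (comp_table T T'))) (\<psi> \<circ>\<^sub>m \<phi>)"
proof -
  have "bicode (set (entries T))" "bicode (set (entries T'))"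
    using assms unfolding presents_def by fast+
  thus ?thesis using presents_compose[OF assms] set_entries_comp_table by metis
qed

lemma bicode_inj_on:
  assumes "bicode E"
  shows "inj_on fst E" "inj_on snd E"
  by (rule inj_onI; use assms in \<open>auto dest: bicodeD\<close>)+

text \<open>\<open>follow\<close> keeps the sources of \<open>T\<close> and \<open>precede\<close>
  keeps the targets of \<open>T'\<close>, and in a \<open>bicode\<close> either coordinate
  identifies an entry. No entry arises in both ways: its source would be a code word of
  \<open>T\<close> in one case and a proper extension of a code word in the other.\<close>

lemma distinct_entries_comp_table:
  assumes E: "bicode (set (entries T))" "distinct (entries T)"
    and E': "bicode (set (entries T'))" "distinct (entries T')"
  shows "distinct (entries (comp_table T T'))"
proof -
  have "\<exists>Q. map fst (entries (map (follow T') T)) = map fst (filter Q (entries T))"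
    by (rule exI[of _ "\<lambda>pq. flag (pick (\<lambda>e'. flag e' \<and> prefix (src e') (snd pq)) T')"])
      (induction T, simp_all add: follow_def Let_def)
  moreover have "distinct (map fst (filter Q (entries T)))" for Q
    using E bicode_inj_on(1)[OF E(1)] by (simp add: distinct_map inj_on_def)
  ultimately have 1: "distinct (entries (map (follow T') T))" by (metis distinct_map)
  have "\<exists>Q. map snd (entries (map (precede T) T')) = map snd (filter Q (entries T'))"
    by (rule exI[of _ "\<lambda>pq. flag (pick (\<lambda>e. flag e \<and> strict_prefix (tgt e) (fst pq)) T)"])
      (induction T', simp_all add: precede_def Let_def)
  moreover have "distinct (map snd (filter Q (entries T')))" for Q
    using E' bicode_inj_on(2)[OF E'(1)] by (simp add: distinct_map inj_on_def)
  ultimately have 2: "distinct (entries (map (precede T) T'))" by (metis distinct_map)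
  have "pq \<notin> set (entries (map (precede T) T'))" if pq: "pq \<in> set (entries (map (follow T') T))" for pq
  proof
    assume "pq \<in> set (entries (map (precede T) T'))"
    then obtain p q x q' where a: "pq = (p @ x, q')" "x \<noteq> []" "(p, q) \<in> set (entries T)"
      unfolding in_entries_precede[OF E(1)] by blast
    obtain p0 q0 y where b: "pq = (p0, y)" "(p0, q0) \<in> set (entries T)"
      using pq unfolding in_entries_follow[OF E'(1)] by blast
    have "p = p0" using bicodeD[OF E(1) a(3) b(2)] a(1) b(1) by simp
    thus False using a b by simp
  qed
  thus ?thesis using 1 2 by (auto simp: comp_table_def)
qed

section \<open>Reading tables off a string\<close>

definition is_letter :: "'a symbol \<Rightarrow> bool" where
  "is_letter \<sigma> \<longleftrightarrow> (\<exists>a. \<sigma> = Letter a)"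

definition the_letter :: "'a symbol \<Rightarrow> 'a" where
  "the_letter \<sigma> = (THE a. \<sigma> = Letter a)"

lemma letter_simps [simp]:
  "is_letter (Letter a)" "\<not> is_letter Comma" "\<not> is_letter Semicolon" "\<not> is_letter Bar" "\<not> is_letter Blank"
  "the_letter (Letter a) = a"
  by (simp_all add: is_letter_def the_letter_def)

definition run :: "'a symbol list \<Rightarrow> 'a list" where
  "run z = map the_letter (takeWhile is_letter z)"

lemma run_letters: "z = [] \<or> \<not> is_letter (hd z) \<Longrightarrow> run (map Letter p @ z) = p"
  by (induction p) (cases z; auto simp: run_def)+

text \<open>An entry is addressed by the position of its comma: its words are the maximal runs of letters on both
  sides of it.\<close>

definition src_at :: "'a symbol list \<Rightarrow> nat \<Rightarrow> 'a list" where
  "src_at z i = rev (run (rev (take i z)))"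

definition tgt_at :: "'a symbol list \<Rightarrow> nat \<Rightarrow> 'a list" where
  "tgt_at z i = run (drop (Suc i) z)"

text \<open>Every position of the string owns a slot, valid or not, so the number of slots is known
  without counting entries.\<close>

definition parse :: "'a symbol list \<Rightarrow> (nat \<Rightarrow> bool) \<Rightarrow> 'a entry list" where
  "parse z Q = map (\<lambda>i. (z ! i = Comma \<and> Q i, src_at z i, tgt_at z i)) [0..<length z]"

lemma entries_parse:
  "entries (parse z Q) = map (\<lambda>i. (src_at z i, tgt_at z i)) (filter (\<lambda>i. z ! i = Comma \<and> Q i) [0..<length z])"
proof -
  have "entries (map (\<lambda>i. (R i, src_at z i, tgt_at z i)) is) = map (\<lambda>i. (src_at z i, tgt_at z i)) (filter R is)"
    for R "is" by (induction "is") simp_all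
  thus ?thesis by (simp add: parse_def)
qed

lemma writes_no_Bar: "writes s es \<Longrightarrow> Bar \<notin> set s"
  by (induction rule: writes.induct) auto

lemma upt_split: "i \<le> j \<Longrightarrow> j \<le> k \<Longrightarrow> [i..<k] = [i..<j] @ [j..<k]"
  by (metis le_add_diff_inverse upt_add_eq_append)

text \<open>Sources are read backwards, so something other than a letter has to stop the run before
  the first entry; this is the condition on \<open>pre\<close>. To the right, the semicolon of the
  entry stops the run.\<close>

lemma parse_writes:
  assumes "writes s es" "pre = [] \<or> \<not> is_letter (last pre)" "z = pre @ s @ suf"
  shows "map (\<lambda>i. (src_at z i, tgt_at z i)) (filter (\<lambda>i. z ! i = Comma) [length pre..<length pre + length s]) = es"
  using assms
proof (induction arbitrary: pre rule: writes.induct)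
  case 1
  thus ?case by simp
next
  case (2 s es)
  have "[length pre..<length pre + length (Blank # s)] = length pre # [length (pre @ [Blank])..<length (pre @ [Blank]) + length s]"
    by (simp add: upt_rec)
  moreover have "z ! length pre = Blank" using 2 by simp
  moreover have "map (\<lambda>i. (src_at z i, tgt_at z i))
      (filter (\<lambda>i. z ! i = Comma) [length (pre @ [Blank])..<length (pre @ [Blank]) + length s]) = es"
    using 2 by (intro 2(2)) simp_all
  ultimately show ?case by simp
next
  case (3 s es p q)
  let ?f = "\<lambda>xs. map (\<lambda>i. (src_at z i, tgt_at z i)) (filter (\<lambda>i. z ! i = Comma) xs)"
  define w where "w = map Letter p @ [Comma] @ map Letter q @ [Semicolon]"
  define l where "l = length pre"
  have z: "z = pre @ map Letter p @ Comma # map Letter q @ Semicolon # s @ suf" using 3 by simp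
  have zn: "z ! (l + i) = (map Letter p @ Comma # map Letter q @ Semicolon # s @ suf) ! i" for i
    unfolding z l_def by simp
  \<comment> \<open>The range is cut at the comma and at the semicolon of the first entry. The two
    stretches around the comma consist of letters, so the comma is the only position kept.\<close>
  have "[l..<l + (length w + length s)] = [l..<l + length p] @ (l + length p) #
      [Suc (l + length p)..<Suc (l + length p) + length q] @ (Suc (l + length p) + length q) # [l + length w..<l + length w + length s]"
  proof -
    have "[l..<l + (length w + length s)] = [l..<l + length p] @ [l + length p..<l + (length w + length s)]"
      by (rule upt_split) (simp_all add: w_def)
    also have "[l + length p..<l + (length w + length s)] = (l + length p) # [Suc (l + length p)..<l + (length w + length s)]"
      by (rule upt_conv_Cons) (simp add: w_def)
    also have "[Suc (l + length p)..<l + (length w + length s)] =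
        [Suc (l + length p)..<Suc (l + length p) + length q] @ [Suc (l + length p) + length q..<l + (length w + length s)]"
      by (rule upt_split) (simp_all add: w_def)
    also have "[Suc (l + length p) + length q..<l + (length w + length s)] =
        (Suc (l + length p) + length q) # [Suc (Suc (l + length p) + length q)..<l + (length w + length s)]"
      by (rule upt_conv_Cons) (simp add: w_def)
    finally show ?thesis by (simp add: w_def ac_simps)
  qed
  moreover have "filter (\<lambda>i. z ! i = Comma) [l..<l + length p] = []"
  proof -
    have "z ! i \<noteq> Comma" if "i \<in> {l..<l + length p}" for i
      using that zn[of "i - l"] by (auto simp: nth_append)
    thus ?thesis unfolding filter_empty_conv set_upt by blast
  qed
  moreover have "z ! (l + length p) = Comma" using zn[of "length p"] by (simp add: nth_append)
  moreover have "filter (\<lambda>i. z ! i = Comma) [Suc (l + length p)..<Suc (l + length p) + length q] = []"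
  proof -
    have "z ! i \<noteq> Comma" if i: "i \<in> {Suc (l + length p)..<Suc (l + length p) + length q}" for i
    proof -
      obtain j where "i = l + (length p + Suc j)" "j < length q"
        using i by (intro that[of "i - Suc (l + length p)"]) auto
      thus ?thesis using zn[of "length p + Suc j"] by (simp add: nth_append)
    qed
    thus ?thesis unfolding filter_empty_conv set_upt by blast
  qed
  moreover have "z ! (Suc (l + length p) + length q) = Semicolon"
    using zn[of "length p + Suc (length q)"] by (simp add: nth_append add.assoc)
  moreover have "?f [l + length w..<l + length w + length s] = es"
    using 3(2)[of "pre @ w"] 3(4) by (simp add: l_def w_def)
  moreover have "src_at z (l + length p) = p"
  proof -
    have "run (map Letter (rev p) @ rev pre) = rev p"
      using 3(3) by (intro run_letters) (auto simp: hd_rev)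
    thus ?thesis unfolding src_at_def z l_def by (simp add: rev_map)
  qed
  moreover have "tgt_at z (l + length p) = q"
    unfolding tgt_at_def z l_def by (simp add: run_letters)
  ultimately have "?f [l..<l + (length w + length s)] = (p, q) # es" by simp
  moreover have "length (map Letter p @ [Comma] @ map Letter q @ [Semicolon] @ s) = length w + length s"
    by (simp add: w_def)
  ultimately show ?case unfolding l_def by (simp only:)
qed

text \<open>The selector is constrained at commas only, which gives selectors defined through bars
  some freedom at the bars themselves.\<close>

lemma entries_parse_segment:
  assumes "writes s es" "pre = [] \<or> \<not> is_letter (last pre)" "z = pre @ s @ suf"
    and Q: "\<And>i. i < length z \<Longrightarrow> z ! i = Comma \<Longrightarrow> Q i \<longleftrightarrow> length pre \<le> i \<and> i < length pre + length s"
  shows "entries (parse z Q) = es"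
proof -
  have "[0..<length z] = [0..<length pre] @ [length pre..<length pre + length s] @ [length pre + length s..<length z]"
    using upt_split[of 0 "length pre" "length z"] upt_split[of "length pre" "length pre + length s" "length z"] assms(3)
    by simp
  moreover have "filter (\<lambda>i. z ! i = Comma \<and> Q i) [0..<length pre] = []"
    using Q assms(3) by (auto simp: filter_empty_conv)
  moreover have "filter (\<lambda>i. z ! i = Comma \<and> Q i) [length pre + length s..<length z] = []"
    using Q by (auto simp: filter_empty_conv)
  moreover have "filter (\<lambda>i. z ! i = Comma \<and> Q i) [length pre..<length pre + length s] =
      filter (\<lambda>i. z ! i = Comma) [length pre..<length pre + length s]"
    using Q assms(3) by (intro filter_cong) auto
  ultimately show ?thesis
    unfolding entries_parse using parse_writes[OF assms(1-3)] by simp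
qed

section \<open>The balanced tree of tables\<close>

text \<open>Positions beyond the end of the string pad the leaves to a power of two. Both branches
  have \<open>length z\<close> slots, so all leaves have the same shape.\<close>

definition leaf :: "'a symbol list \<Rightarrow> nat \<Rightarrow> 'a entry list" where
  "leaf z t = (if t < length z \<and> z ! t = Bar then parse z (\<lambda>i. i < t \<and> (\<forall>j\<in>{i..<t}. z ! j \<noteq> Bar))
     else map (\<lambda>i. (i = 0, [], [])) [0..<length z])"

text \<open>The right half is the first argument of \<open>comp_table\<close>, because the later
  factors of a product act first.\<close>

fun node :: "'a symbol list \<Rightarrow> nat \<Rightarrow> nat \<Rightarrow> 'a entry list" where
  "node z 0 b = leaf z b"
| "node z (Suc l) b = comp_table (node z l (2 * b + 1)) (node z l (2 * b))"

lemma presents_node: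
  assumes "\<And>t. presents (set (entries (leaf z t))) (M t)"
  shows "presents (set (entries (node z l b))) (composite (map M [b * 2 ^ l..<(b + 1) * 2 ^ l]))"
proof (induction l arbitrary: b)
  case 0
  thus ?case using assms by simp
next
  case (Suc l)
  have "[b * 2 ^ Suc l..<(b + 1) * 2 ^ Suc l] = [2 * b * 2 ^ l..<(2 * b + 1) * 2 ^ l] @ [(2 * b + 1) * 2 ^ l..<(2 * b + 1 + 1) * 2 ^ l]"
    using upt_split[of "2 * b * 2 ^ l" "(2 * b + 1) * 2 ^ l" "(2 * b + 1 + 1) * 2 ^ l"]
    by (simp add: algebra_simps)
  thus ?case
    using presents_comp_table[OF Suc.IH[of "2 * b + 1"] Suc.IH[of "2 * b"]] by simp
qed

lemma entries_leaf_identity: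
  assumes "z \<noteq> []" "\<not> (t < length z \<and> z ! t = Bar)"
  shows "entries (leaf z t) = [([], [])]"
proof -
  have "leaf z t = map (\<lambda>i. (i = 0, [], [])) (0 # [1..<length z])"
    unfolding leaf_def if_not_P[OF assms(2)] using assms(1) by (simp add: upt_conv_Cons del: upt_Suc)
  moreover have "entries (map (\<lambda>i. (i = (0::nat), [], [])) [1..<n]) = []" for n
    by (auto simp: entries_def filter_empty_conv)
  ultimately show ?thesis by simp
qed

lemma composite_replicate_Some: "(\<And>i. i \<in> set xs \<Longrightarrow> M i = Some) \<Longrightarrow> composite (map M xs) = Some"
  by (induction xs) simp_all

text \<open>The induction consumes segments while \<open>z\<close> stays fixed and
  \<open>pre\<close> grows, since a leaf looks at the whole string. Allowing every
  \<open>n \<ge> length z\<close> covers the padding of the tree.\<close>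

lemma leaves_join:
  assumes "list_all2 describes ss \<psi>s" "\<forall>\<psi>\<in>set \<psi>s. finite_essential_iso \<psi>"
    and "z = pre @ join ss" "z \<noteq> []" "pre = [] \<or> last pre = Bar"
  shows "\<exists>M. (\<forall>t\<ge>length pre. presents (set (entries (leaf z t))) (M t)) \<and>
     (\<forall>n\<ge>length z. composite (map M [length pre..<n]) = composite \<psi>s)"
  using assms
proof (induction ss \<psi>s arbitrary: pre rule: list_all2_induct)
  case Nil
  hence "\<forall>t\<ge>length pre. presents (set (entries (leaf z t))) Some"
    using entries_leaf_identity[of z] presents_Some by (auto simp: join_def not_less)
  thus ?case by (intro exI[of _ "\<lambda>_. Some"]) (simp add: composite_replicate_Some)
next
  case (Cons s ss \<psi> \<psi>s)
  define l where "l = length pre + length s"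
  have z: "z = pre @ s @ Bar # join ss" using Cons.prems(2) by (simp add: join_def)
  obtain es where es: "set es = table \<psi>" "writes s es" using Cons.hyps(1) by (auto simp: describes_def)
  have nb: "z ! i \<noteq> Bar" if i: "length pre \<le> i" "i < l" for i
  proof -
    obtain k where "i = length pre + k" "k < length s"
      using i by (intro that[of "i - length pre"]) (auto simp: l_def)
    hence "z ! i = s ! k" "k < length s" by (simp_all add: z nth_append)
    thus ?thesis using writes_no_Bar[OF es(2)] by (metis nth_mem)
  qed
  have bar: "z ! l = Bar" by (simp add: z l_def nth_append)
  obtain M where M: "\<And>t. length (pre @ s @ [Bar]) \<le> t \<Longrightarrow> presents (set (entries (leaf z t))) (M t)"
    "\<And>n. length z \<le> n \<Longrightarrow> composite (map M [length (pre @ s @ [Bar])..<n]) = composite \<psi>s"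
  proof -
    have "\<exists>M. (\<forall>t\<ge>length (pre @ s @ [Bar]). presents (set (entries (leaf z t))) (M t)) \<and>
       (\<forall>n\<ge>length z. composite (map M [length (pre @ s @ [Bar])..<n]) = composite \<psi>s)"
      using Cons.prems z by (intro Cons.IH) simp_all
    thus thesis using that by blast
  qed
  define M' where "M' = (\<lambda>t. if t < l then Some else if t = l then \<psi> else M t)"
  have "entries (leaf z l) = es"
  proof -
    have "leaf z l = parse z (\<lambda>i. i < l \<and> (\<forall>j\<in>{i..<l}. z ! j \<noteq> Bar))"
      using bar by (simp add: leaf_def z l_def)
    also have "entries \<dots> = es"
    proof (rule entries_parse_segment[OF es(2) _ z])
      show "pre = [] \<or> \<not> is_letter (last pre)" using Cons.prems(4) by auto
      fix i assume i: "i < length z" "z ! i = Comma"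
      \<comment> \<open>A position left of the segment is separated from \<open>l\<close> by the bar
        that ends \<open>pre\<close>.\<close>
      have "z ! (length pre - 1) = Bar \<and> length pre - 1 \<in> {i..<l}" if "i < length pre"
        using that Cons.prems(4) by (cases "pre = []") (auto simp: z l_def nth_append last_conv_nth)
      thus "(i < l \<and> (\<forall>j\<in>{i..<l}. z ! j \<noteq> Bar)) \<longleftrightarrow> length pre \<le> i \<and> i < length pre + length s"
        using nb by (force simp: l_def not_less)
    qed
    finally show ?thesis .
  qed
  moreover have "finite_essential_iso \<psi>" using Cons.prems(1) by simp
  ultimately have "presents (set (entries (leaf z l))) \<psi>"
    using es(1) finite_essential_iso_presents by metis
  moreover have "presents (set (entries (leaf z t))) Some" if "length pre \<le> t" "t < l" for t
    using nb[OF that] entries_leaf_identity[OF Cons.prems(3), of t] presents_Some by simp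
  ultimately have "\<forall>t\<ge>length pre. presents (set (entries (leaf z t))) (M' t)"
    using M(1) by (auto simp: M'_def l_def)
  moreover have "composite (map M' [length pre..<n]) = composite (\<psi> # \<psi>s)" if n: "length z \<le> n" for n
  proof -
    have "[length pre..<n] = [length pre..<l] @ l # [Suc l..<n]"
      using n upt_split[of "length pre" l n] by (simp add: z l_def upt_conv_Cons)
    moreover have "map M' [Suc l..<n] = map M [Suc l..<n]" by (simp add: M'_def)
    hence "composite (map M' [Suc l..<n]) = composite (map M [Suc l..<n])" by (rule arg_cong)
    hence "composite (map M' [Suc l..<n]) = composite \<psi>s" using M(2)[OF n] by (simp add: l_def)
    moreover have "composite (map M' [length pre..<l]) = Some"
      by (rule composite_replicate_Some) (simp add: M'_def)
    moreover have "M' l = \<psi>" by (simp add: M'_def)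
    ultimately show ?thesis by simp
  qed
  ultimately show ?case by blast
qed

lemma presents_root:
  assumes "list_all2 describes ss \<psi>s" "\<forall>\<psi>\<in>set \<psi>s. finite_essential_iso \<psi>" "\<psi>s \<noteq> []"
    and "length (join ss) \<le> 2 ^ l"
  shows "presents (set (entries (node (join ss) l 0))) (composite \<psi>s)"
proof -
  have "join ss \<noteq> []" using assms(1,3) by (cases ss) (auto simp: join_def)
  then obtain M where M: "\<forall>t. presents (set (entries (leaf (join ss) t))) (M t)"
    "\<forall>n\<ge>length (join ss). composite (map M [0..<n]) = composite \<psi>s"
    using leaves_join[OF assms(1,2), of "join ss" "[]"] by auto
  have "presents (set (entries (node (join ss) l 0))) (composite (map M [0 * 2 ^ l..<(0 + 1) * 2 ^ l]))"
    using M(1) by (intro presents_node) blast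
  thus ?thesis using M(2) assms(4) by simp
qed

section \<open>Circuits computing families of boolean functions\<close>

definition vals :: "bool list \<Rightarrow> gate list \<Rightarrow> bool list" where
  "vals x gs = foldl (\<lambda>vs g. vs @ [gate_value x vs g]) [] gs"

definition depths :: "gate list \<Rightarrow> nat list" where
  "depths gs = foldl (\<lambda>ds g. ds @ [gate_depth ds g]) [] gs"

lemma vals_simps [simp]: "vals x [] = []" "vals x (gs @ [g]) = vals x gs @ [gate_value x (vals x gs) g]"
  by (simp_all add: vals_def)

lemma depths_simps [simp]: "depths [] = []" "depths (gs @ [g]) = depths gs @ [gate_depth (depths gs) g]"
  by (simp_all add: depths_def)

lemma length_vals [simp]: "length (vals x gs) = length gs"
  by (induction gs rule: rev_induct) simp_all

lemma length_depths [simp]: "length (depths gs) = length gs"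
  by (induction gs rule: rev_induct) simp_all

text \<open>Gates refer backwards only, so the constructions below may append gates freely.\<close>

lemma vals_append: "i < length gs \<Longrightarrow> vals x (gs @ hs) ! i = vals x gs ! i"
  by (induction hs rule: rev_induct) (simp_all add: nth_append flip: append_assoc)

lemma depths_append: "i < length gs \<Longrightarrow> depths (gs @ hs) ! i = depths gs ! i"
  by (induction hs rule: rev_induct) (simp_all add: nth_append flip: append_assoc)

definition wf_gates :: "nat \<Rightarrow> gate list \<Rightarrow> bool" where
  "wf_gates N gs \<longleftrightarrow> (\<forall>i<length gs. wf_gate N i (gs ! i))"

lemma wf_gates_snoc: "wf_gates N (gs @ [g]) \<longleftrightarrow> wf_gates N gs \<and> wf_gate N (length gs) g"
  by (auto simp: wf_gates_def nth_append less_Suc_eq)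

text \<open>Agreement on lists of every length lets a boolean function serve as the name of a
  gate.\<close>

definition computes :: "gate list \<Rightarrow> nat \<Rightarrow> (bool list \<Rightarrow> bool) \<Rightarrow> bool" where
  "computes gs D f \<longleftrightarrow> (\<exists>i<length gs. depths gs ! i \<le> D \<and> (\<forall>x. vals x gs ! i = f x))"

lemma computes_append: "computes gs D f \<Longrightarrow> computes (gs @ hs) D f"
  unfolding computes_def by (metis depths_append vals_append length_append trans_less_add1)

lemma computes_mono: "computes gs D f \<Longrightarrow> D \<le> D' \<Longrightarrow> computes gs D' f"
  unfolding computes_def using le_trans by blast

text \<open>Formulas of depth \<open>d\<close> over the functions in \<open>F\<close>. The fan-in bound is \<open>m + 2\<close> rather than \<open>m\<close>, so that binary
  disjunctions and quantifiers over \<open>{..m}\<close> come for free; it also bounds the number of gates by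
  \<open>(m + 2) ^ d\<close>, so that only depths have to be tracked, and those generously.\<close>

inductive fo :: "(bool list \<Rightarrow> bool) set \<Rightarrow> nat \<Rightarrow> nat \<Rightarrow> (bool list \<Rightarrow> bool) \<Rightarrow> bool" for F m where
  fo_base: "f \<in> F \<Longrightarrow> fo F m d f"
| fo_neg: "fo F m d f \<Longrightarrow> fo F m (Suc d) (\<lambda>x. \<not> f x)"
| fo_disj: "finite G \<Longrightarrow> card G \<le> m + 2 \<Longrightarrow> (\<And>g. g \<in> G \<Longrightarrow> fo F m d g) \<Longrightarrow> fo F m (Suc d) (\<lambda>x. \<exists>g\<in>G. g x)"

text \<open>A statement relative to any circuit that already provides \<open>F\<close>, so that
  several constructions can be appended one after another and share the gates for
  \<open>F\<close>.\<close>

definition extends :: "nat \<Rightarrow> (bool list \<Rightarrow> bool) set \<Rightarrow> nat \<Rightarrow> nat \<Rightarrow> nat \<Rightarrow> (bool list \<Rightarrow> bool) set \<Rightarrow> bool" where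
  "extends N F D d s G \<longleftrightarrow> (\<forall>gs. wf_gates N gs \<and> (\<forall>f\<in>F. computes gs D f) \<longrightarrow>
     (\<exists>hs. wf_gates N (gs @ hs) \<and> length hs \<le> s \<and>
       (\<forall>i\<in>{length gs..<length gs + length hs}. depths (gs @ hs) ! i \<le> D + d) \<and>
       (\<forall>g\<in>G. computes (gs @ hs) (D + d) g)))"

lemma extendsE:
  assumes "extends N F D d s G" "wf_gates N gs" "\<And>f. f \<in> F \<Longrightarrow> computes gs D f"
  obtains hs where "wf_gates N (gs @ hs)" "length hs \<le> s"
    "\<And>i. length gs \<le> i \<Longrightarrow> i < length gs + length hs \<Longrightarrow> depths (gs @ hs) ! i \<le> D + d"
    "\<And>g. g \<in> G \<Longrightarrow> computes (gs @ hs) (D + d) g"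
  using assms(1)[unfolded extends_def, rule_format, of gs] assms(2,3) by auto

text \<open>The second construction is appended to the outcome of the first but still builds on
  \<open>F\<close> at depth \<open>D\<close>; hence sizes add up and depths do not.\<close>

lemma extends_union:
  assumes "extends N F D d s G" "extends N F D d s' G'"
  shows "extends N F D d (s + s') (G \<union> G')"
  unfolding extends_def
proof (intro allI impI, elim conjE)
  fix gs assume gs: "wf_gates N gs" "\<forall>f\<in>F. computes gs D f"
  obtain hs where hs: "wf_gates N (gs @ hs)" "length hs \<le> s"
    "\<And>i. length gs \<le> i \<Longrightarrow> i < length gs + length hs \<Longrightarrow> depths (gs @ hs) ! i \<le> D + d"
    "\<And>g. g \<in> G \<Longrightarrow> computes (gs @ hs) (D + d) g"
    using extendsE[OF assms(1) gs(1)] gs(2) by metis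
  obtain hs' where hs': "wf_gates N ((gs @ hs) @ hs')" "length hs' \<le> s'"
    "\<And>i. length (gs @ hs) \<le> i \<Longrightarrow> i < length (gs @ hs) + length hs' \<Longrightarrow> depths ((gs @ hs) @ hs') ! i \<le> D + d"
    "\<And>g. g \<in> G' \<Longrightarrow> computes ((gs @ hs) @ hs') (D + d) g"
    using extendsE[OF assms(2) hs(1)] gs(2) computes_append by metis
  have "depths ((gs @ hs) @ hs') ! i \<le> D + d" if "i \<in> {length gs..<length gs + length (hs @ hs')}" for i
  proof (cases "i < length (gs @ hs)")
    case True
    thus ?thesis using hs(3)[of i] that by (simp add: depths_append del: append_assoc)
  next
    case False
    thus ?thesis using hs'(3)[of i] that by simp
  qed
  moreover have "computes ((gs @ hs) @ hs') (D + d) g" if "g \<in> G \<union> G'" for g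
    using that hs(4) hs'(4) computes_append by blast
  moreover have "length (hs @ hs') \<le> s + s'" using hs(2) hs'(2) by simp
  ultimately show "\<exists>hs. wf_gates N (gs @ hs) \<and> length hs \<le> s + s' \<and>
       (\<forall>i\<in>{length gs..<length gs + length hs}. depths (gs @ hs) ! i \<le> D + d) \<and>
       (\<forall>g\<in>G \<union> G'. computes (gs @ hs) (D + d) g)"
    using hs'(1) by (intro exI[of _ "hs @ hs'"]) simp
qed

lemma extends_finite:
  assumes "finite G" "\<And>g. g \<in> G \<Longrightarrow> extends N F D d s {g}"
  shows "extends N F D d (card G * s) G"
  using assms
proof (induction G rule: finite_induct)
  case empty
  show ?case unfolding extends_def by (intro allI impI exI[of _ "[]"]) simp
next
  case (insert g G)
  thus ?case using extends_union[of N F D d s "{g}" "card G * s" G] by simp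
qed

lemma extends_snoc:
  assumes "extends N F D d s G"
    and "\<And>gs. wf_gates N gs \<Longrightarrow> (\<And>g. g \<in> G \<Longrightarrow> computes gs (D + d) g) \<Longrightarrow>
      \<exists>a. wf_gate N (length gs) a \<and> gate_depth (depths gs) a \<le> Suc (D + d) \<and> (\<forall>x. gate_value x (vals x gs) a = f x)"
  shows "extends N F D (Suc d) (Suc s) {f}"
  unfolding extends_def
proof (intro allI impI, elim conjE)
  fix gs assume gs: "wf_gates N gs" "\<forall>f\<in>F. computes gs D f"
  obtain hs where hs: "wf_gates N (gs @ hs)" "length hs \<le> s"
    "\<And>i. length gs \<le> i \<Longrightarrow> i < length gs + length hs \<Longrightarrow> depths (gs @ hs) ! i \<le> D + d"
    "\<And>g. g \<in> G \<Longrightarrow> computes (gs @ hs) (D + d) g"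
    using extendsE[OF assms(1) gs(1)] gs(2) by metis
  obtain a where a: "wf_gate N (length (gs @ hs)) a" "gate_depth (depths (gs @ hs)) a \<le> Suc (D + d)"
    "\<And>x. gate_value x (vals x (gs @ hs)) a = f x"
    using assms(2)[OF hs(1) hs(4)] by blast
  define ks where "ks = (gs @ hs) @ [a]"
  have "wf_gates N ks" using a(1) hs(1) by (simp add: ks_def wf_gates_snoc del: append_assoc)
  moreover have "depths ks ! i \<le> D + Suc d" if "i \<in> {length gs..<length gs + length (hs @ [a])}" for i
  proof (cases "i < length (gs @ hs)")
    case True
    thus ?thesis unfolding ks_def using hs(3)[of i] that by (simp add: depths_append del: append_assoc depths_simps)
  next
    case False
    hence "i = length (gs @ hs)" using that by simp
    hence "depths ks ! i = gate_depth (depths (gs @ hs)) a"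
      unfolding ks_def by (simp del: append_assoc add: nth_append)
    thus ?thesis using a(2) by simp
  qed
  moreover have "computes ks (D + Suc d) f"
    unfolding computes_def
  proof (intro exI[of _ "length (gs @ hs)"] conjI allI)
    show "vals x ks ! length (gs @ hs) = f x" for x
      unfolding ks_def using a(3) by (simp del: append_assoc add: nth_append)
    show "depths ks ! length (gs @ hs) \<le> D + Suc d"
      unfolding ks_def using a(2) by (simp del: append_assoc add: nth_append)
  qed (simp add: ks_def)
  ultimately show "\<exists>hs. wf_gates N (gs @ hs) \<and> length hs \<le> Suc s \<and>
       (\<forall>i\<in>{length gs..<length gs + length hs}. depths (gs @ hs) ! i \<le> D + Suc d) \<and>
       (\<forall>g\<in>{f}. computes (gs @ hs) (D + Suc d) g)"
    using hs(2) by (intro exI[of _ "hs @ [a]"]) (simp add: ks_def)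
qed

lemma extends_neg: "extends N F D d s {f} \<Longrightarrow> extends N F D (Suc d) (Suc s) {\<lambda>x. \<not> f x}"
proof (erule extends_snoc)
  fix gs assume "wf_gates N gs" "\<And>g. g \<in> {f} \<Longrightarrow> computes gs (D + d) g"
  then obtain i where "i < length gs" "depths gs ! i \<le> D + d" "\<And>x. vals x gs ! i = f x"
    by (auto simp: computes_def)
  thus "\<exists>a. wf_gate N (length gs) a \<and> gate_depth (depths gs) a \<le> Suc (D + d) \<and> (\<forall>x. gate_value x (vals x gs) a = (\<not> f x))"
    by (intro exI[of _ "Neg i"]) simp
qed

lemma extends_disj: "extends N F D d s G \<Longrightarrow> extends N F D (Suc d) (Suc s) {\<lambda>x. \<exists>g\<in>G. g x}"
proof (erule extends_snoc)
  fix gs assume "wf_gates N gs" and G: "\<And>g. g \<in> G \<Longrightarrow> computes gs (D + d) g"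
  \<comment> \<open>All suitable gates are wired in, rather than one chosen for each member of
    \<open>G\<close>; extra wires cost no gates.\<close>
  define J where "J = {i. i < length gs \<and> depths gs ! i \<le> D + d \<and> (\<exists>g\<in>G. \<forall>x. vals x gs ! i = g x)}"
  have J: "J \<subseteq> {..<length gs}" by (auto simp: J_def)
  have "(\<exists>j\<in>J. vals x gs ! j) \<longleftrightarrow> (\<exists>g\<in>G. g x)" for x
  proof
    assume "\<exists>g\<in>G. g x"
    then obtain g where g: "g \<in> G" "g x" by blast
    then obtain i where "i < length gs" "depths gs ! i \<le> D + d" "\<And>x. vals x gs ! i = g x"
      using G[OF g(1)] by (auto simp: computes_def)
    thus "\<exists>j\<in>J. vals x gs ! j" using g by (auto simp: J_def)
  qed (auto simp: J_def)
  moreover have "Max (insert 0 ((!) (depths gs) ` J)) \<le> D + d"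
    using finite_subset[OF J] by (intro Max.boundedI) (auto simp: J_def)
  ultimately show "\<exists>a. wf_gate N (length gs) a \<and> gate_depth (depths gs) a \<le> Suc (D + d) \<and>
      (\<forall>x. gate_value x (vals x gs) a = (\<exists>g\<in>G. g x))"
    using J by (intro exI[of _ "Disj J"]) simp
qed

lemma extends_mono: "extends N F D d s G \<Longrightarrow> s \<le> s' \<Longrightarrow> extends N F D d s' G"
  unfolding extends_def using le_trans by blast

text \<open>With \<open>k = (m + 2) ^ d - 1\<close>, at most \<open>m + 2\<close> subformulas and
  one gate on top need \<open>(m + 2) * k + 1\<close> gates, which is at most
  \<open>(m + 2) * (k + 1) - 1\<close>. The subtraction also makes formulas of depth 0 free.\<close>

lemma fo_extends: "fo F m d f \<Longrightarrow> extends N F D d ((m + 2) ^ d - 1) {f}"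
proof (induction rule: fo.induct)
  case (fo_base f d)
  show ?case
    unfolding extends_def
  proof (intro allI impI, elim conjE)
    fix gs assume "wf_gates N gs" "\<forall>f\<in>F. computes gs D f"
    thus "\<exists>hs. wf_gates N (gs @ hs) \<and> length hs \<le> (m + 2) ^ d - 1 \<and>
       (\<forall>i\<in>{length gs..<length gs + length hs}. depths (gs @ hs) ! i \<le> D + d) \<and>
       (\<forall>g\<in>{f}. computes (gs @ hs) (D + d) g)"
      using fo_base computes_mono[of gs D f "D + d"] by (intro exI[of _ "[]"]) simp
  qed
next
  case (fo_neg d f)
  obtain k where k: "(m + 2) ^ d = Suc k" by (cases "(m + 2) ^ d") auto
  have "Suc ((m + 2) ^ d - 1) \<le> (m + 2) ^ Suc d - 1" by (simp only: k power_Suc) simp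
  thus ?case using extends_neg[OF fo_neg.IH] extends_mono by blast
next
  case (fo_disj G d)
  obtain k where k: "(m + 2) ^ d = Suc k" by (cases "(m + 2) ^ d") auto
  have "Suc (card G * ((m + 2) ^ d - 1)) \<le> Suc ((m + 2) * k)"
    using fo_disj.hyps(2) by (simp only: k diff_Suc_1 Suc_le_mono mult_le_mono1)
  also have "\<dots> \<le> (m + 2) ^ Suc d - 1" by (simp only: k power_Suc) simp
  finally show ?case
    using extends_disj[OF extends_finite[OF fo_disj.hyps(1) fo_disj.IH]] extends_mono by blast
qed

section \<open>Circuits built in layers\<close>

definition circ :: "nat \<Rightarrow> nat \<Rightarrow> nat \<Rightarrow> (bool list \<Rightarrow> bool) set \<Rightarrow> bool" where
  "circ N s D F \<longleftrightarrow> (\<exists>gs. wf_gates N gs \<and> length gs \<le> s \<and> (\<forall>i<length gs. depths gs ! i \<le> D) \<and> (\<forall>f\<in>F. computes gs D f))"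

text \<open>The transition between levels: formulas over \<open>F\<close> are turned into gates,
  after which the members of \<open>F'\<close> count as formulas of depth 0.\<close>

lemma circ_step:
  assumes "circ N s D F" "finite F'" "card F' \<le> k" "\<And>f. f \<in> F' \<Longrightarrow> fo F m d f"
  shows "circ N (s + k * (m + 2) ^ d) (D + d) F'"
proof -
  obtain gs where gs: "wf_gates N gs" "length gs \<le> s" "\<forall>i<length gs. depths gs ! i \<le> D" "\<forall>f\<in>F. computes gs D f"
    using assms(1) by (auto simp: circ_def)
  have "extends N F D d (card F' * ((m + 2) ^ d - 1)) F'"
    by (rule extends_finite[OF assms(2)]) (rule fo_extends[OF assms(4)])
  then obtain hs where hs: "wf_gates N (gs @ hs)" "length hs \<le> card F' * ((m + 2) ^ d - 1)"
    "\<And>i. length gs \<le> i \<Longrightarrow> i < length gs + length hs \<Longrightarrow> depths (gs @ hs) ! i \<le> D + d"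
    "\<And>g. g \<in> F' \<Longrightarrow> computes (gs @ hs) (D + d) g"
    using extendsE[OF _ gs(1)] gs(4) by metis
  have "card F' * ((m + 2) ^ d - 1) \<le> k * (m + 2) ^ d"
    using assms(3) by (intro mult_le_mono) simp_all
  hence "length (gs @ hs) \<le> s + k * (m + 2) ^ d" using gs(2) hs(2) by simp
  moreover have "depths (gs @ hs) ! i \<le> D + d" if "i < length (gs @ hs)" for i
  proof (cases "i < length gs")
    case True
    thus ?thesis using gs(3) by (simp add: depths_append trans_le_add1)
  qed (use that hs(3) in simp)
  ultimately show ?thesis using hs(1,4) unfolding circ_def by blast
qed

lemma circ_inputs: "circ N N 0 ((\<lambda>j x. x ! j) ` {..<N})"
proof -
  have "wf_gates N (map Input [0..<n]) \<and> (\<forall>i<n. depths (map Input [0..<n]) ! i = 0 \<and>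
      (\<forall>x. vals x (map Input [0..<n]) ! i = x ! i))" if "n \<le> N" for n
    using that
  proof (induction n)
    case 0
    show ?case by (simp add: wf_gates_def)
  next
    case (Suc n)
    have "map Input [0..<Suc n] = map Input [0..<n] @ [Input n]" by simp
    thus ?case using Suc by (simp add: wf_gates_snoc nth_append less_Suc_eq del: upt_Suc)
  qed
  thus ?thesis
    unfolding circ_def by (intro exI[of _ "map Input [0..<N]"]) (auto simp: computes_def)
qed

text \<open>The size bound has the form \<open>(N + c) ^ e\<close> so that it can hold for every
  \<open>N\<close>, small ones included; the asymptotic form is derived here once.\<close>

lemma AC_I:
  fixes fs :: "nat \<Rightarrow> (bool list \<Rightarrow> bool) list"
  assumes circ: "\<And>N. circ N (s N) (D N) (set (fs N))"
    and size: "\<And>N. s N + length (fs N) \<le> (N + c) ^ e"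
    and depth: "(\<lambda>N. real (D N)) \<in> O(\<lambda>N. log 2 (real N) ^ k)"
    and correct: "\<And>x Y. (x, Y) \<in> Prob \<Longrightarrow> map (\<lambda>f. f x) (fs (length x)) \<in> Y"
  shows "Prob \<in> AC k"
proof -
  have "\<exists>C. wf_circuit N C \<and> circuit_depth C \<le> D N \<and> circuit_size C \<le> (N + c) ^ e \<and>
    (\<forall>x. circuit_output C x = map (\<lambda>f. f x) (fs N))" for N
  proof -
    obtain gs where gs: "wf_gates N gs" "length gs \<le> s N" "\<forall>i<length gs. depths gs ! i \<le> D N"
      "\<forall>f\<in>set (fs N). computes gs (D N) f"
      using circ[of N] by (auto simp: circ_def)
    then obtain g where g: "\<forall>f\<in>set (fs N). g f < length gs \<and> (\<forall>x. vals x gs ! (g f) = f x)"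
      unfolding computes_def by metis
    define C where "C = \<lparr>gates = gs, outputs = map g (fs N)\<rparr>"
    have v: "gate_values C x = vals x gs" "gate_depths C = depths gs" for x
      by (simp_all add: C_def gate_values_def vals_def gate_depths_def depths_def)
    have "wf_circuit N C" using gs(1) g by (auto simp: wf_circuit_def C_def wf_gates_def)
    moreover have "circuit_depth C \<le> D N"
      unfolding circuit_depth_def v using gs(3) by (intro Max.boundedI) (auto simp: in_set_conv_nth)
    moreover have "circuit_size C \<le> (N + c) ^ e"
      using size[of N] gs(2) by (simp add: circuit_size_def C_def)
    moreover have "circuit_output C x = map (\<lambda>f. f x) (fs N)" for x
      unfolding circuit_output_def v using g by (simp add: C_def)
    ultimately show ?thesis by blast
  qed
  then obtain C where C: "\<And>N. wf_circuit N (C N)" "\<And>N. circuit_depth (C N) \<le> D N"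
    "\<And>N. circuit_size (C N) \<le> (N + c) ^ e" "\<And>N x. circuit_output (C N) x = map (\<lambda>f. f x) (fs N)"
    by metis
  have "(\<lambda>N. real (circuit_depth (C N))) \<in> O(\<lambda>N. real (D N))"
    using C(2) by (intro landau_o.big_mono) simp
  moreover have "(\<lambda>N. real (circuit_size (C N))) \<in> O(\<lambda>N. real N ^ e)"
  \<comment> \<open>From \<open>N = c\<close> on, \<open>N + c \<le> 2 * N\<close>.\<close>
  proof (rule bigoI[where c = "2 ^ e"], rule eventually_sequentiallyI[of c])
    fix N assume "c \<le> N"
    hence "(N + c) ^ e \<le> (2 * N) ^ e" by (intro power_mono) simp_all
    hence "circuit_size (C N) \<le> 2 ^ e * N ^ e" using C(3)[of N] by (simp add: power_mult_distrib)
    hence "real (circuit_size (C N)) \<le> real (2 ^ e * N ^ e)" by (rule of_nat_mono)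
    thus "norm (real (circuit_size (C N))) \<le> 2 ^ e * norm (real N ^ e)" by simp
  qed
  ultimately show ?thesis
    unfolding AC_def using C(1,4) correct landau_o.big_trans[OF _ depth] by (auto intro!: exI[of _ C])
qed

section \<open>Words and tables computed in bounded depth\<close>

lemma fo_mono: "fo F m d f \<Longrightarrow> d \<le> d' \<Longrightarrow> fo F m d' f"
proof (induction arbitrary: d' rule: fo.induct)
  case (fo_base f d)
  thus ?case by (simp add: fo.fo_base)
next
  case (fo_neg d f)
  then obtain e where "d' = Suc e" "d \<le> e" by (cases d') auto
  thus ?case using fo_neg.IH fo.fo_neg by simp
next
  case (fo_disj G d)
  then obtain e where "d' = Suc e" "d \<le> e" by (cases d') auto
  thus ?case using fo_disj.IH fo_disj.hyps fo.fo_disj by simp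
qed

lemma fo_cong: "fo F m d g \<Longrightarrow> (\<And>x. f x \<longleftrightarrow> g x) \<Longrightarrow> fo F m d f"
  by (subgoal_tac "f = g") (simp, rule ext)

lemma fo_bex:
  assumes "finite I" "card I \<le> m + 2" "\<And>i. i \<in> I \<Longrightarrow> fo F m d (\<lambda>x. P i x)"
  shows "fo F m (Suc d) (\<lambda>x. \<exists>i\<in>I. P i x)"
proof (rule fo_cong[OF fo_disj[of "P ` I"]])
  show "card (P ` I) \<le> m + 2" using card_image_le[OF assms(1), of P] assms(2) by simp
qed (use assms in auto)

text \<open>\<open>False\<close> is the empty disjunction and \<open>True\<close> its
  negation.\<close>

lemma fo_const: "fo F m 2 (\<lambda>x. c)"
proof -
  have *: "fo F m 1 (\<lambda>x. False)" using fo_disj[of "{}" m F 0] by simp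
  show ?thesis
  proof (cases c)
    case True
    thus ?thesis using fo_neg[OF *] by (simp add: numeral_2_eq_2)
  next
    case False
    thus ?thesis using fo_mono[OF *] by simp
  qed
qed

lemma fo_or:
  assumes "fo F m d f" "fo F m e g"
  shows "fo F m (Suc (max d e)) (\<lambda>x. f x \<or> g x)"
proof -
  have "card {f, g} \<le> m + 2" by (simp add: card_insert_if)
  moreover have "fo F m (max d e) h" if "h \<in> {f, g}" for h
    using that assms fo_mono by auto
  ultimately show ?thesis using fo_disj[of "{f, g}" m F "max d e"] by simp
qed

lemma fo_and:
  assumes "fo F m d f" "fo F m e g"
  shows "fo F m (max d e + 3) (\<lambda>x. f x \<and> g x)"
  using fo_neg[OF fo_or[OF fo_neg[OF assms(1)] fo_neg[OF assms(2)]]] by (simp add: numeral_3_eq_3)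

lemma fo_imp:
  assumes "fo F m d f" "fo F m e g"
  shows "fo F m (max d e + 2) (\<lambda>x. f x \<longrightarrow> g x)"
  by (rule fo_cong[OF fo_mono[OF fo_or[OF fo_neg[OF assms(1)] assms(2)]]]) auto

lemma fo_iff:
  assumes "fo F m d f" "fo F m e g"
  shows "fo F m (max d e + 5) (\<lambda>x. f x \<longleftrightarrow> g x)"
  by (rule fo_cong[OF fo_mono[OF fo_and[OF fo_imp[OF assms(1,2)] fo_imp[OF assms(2,1)]]]]) auto

lemma fo_ball:
  assumes "finite I" "card I \<le> m + 2" "\<And>i. i \<in> I \<Longrightarrow> fo F m d (\<lambda>x. P i x)"
  shows "fo F m (d + 3) (\<lambda>x. \<forall>i\<in>I. P i x)"
  using fo_neg[OF fo_bex[OF assms(1,2) fo_neg[OF assms(3)]]] by (simp add: numeral_3_eq_3)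

lemma fo_bex_less:
  "n \<le> m + 2 \<Longrightarrow> (\<And>i. i < n \<Longrightarrow> fo F m d (\<lambda>x. P i x)) \<Longrightarrow> fo F m (Suc d) (\<lambda>x. \<exists>i\<in>{..<n}. P i x)"
  by (rule fo_bex) simp_all

lemma fo_ball_less:
  "n \<le> m + 2 \<Longrightarrow> (\<And>i. i < n \<Longrightarrow> fo F m d (\<lambda>x. P i x)) \<Longrightarrow> fo F m (d + 3) (\<lambda>x. \<forall>i\<in>{..<n}. P i x)"
  by (rule fo_ball) simp_all

lemma fo_ex:
  fixes P :: "'b::finite \<Rightarrow> bool list \<Rightarrow> bool"
  assumes "CARD('b) \<le> m" "\<And>b. fo F m d (\<lambda>x. P b x)"
  shows "fo F m (Suc d) (\<lambda>x. \<exists>b. P b x)"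
  using fo_bex[of "UNIV :: 'b set" m F d P] assms by simp

lemma fo_all:
  fixes P :: "'b::finite \<Rightarrow> bool list \<Rightarrow> bool"
  assumes "CARD('b) \<le> m" "\<And>b. fo F m d (\<lambda>x. P b x)"
  shows "fo F m (d + 3) (\<lambda>x. \<forall>b. P b x)"
  using fo_ball[of "UNIV :: 'b set" m F d P] assms by simp

lemmas fo_intros = fo_const fo_neg fo_or fo_and fo_imp fo_iff fo_bex_less fo_ball_less fo_ex fo_all

section \<open>Words given by their letter bits\<close>

text \<open>These bits describe a word of variable length completely: no letter is present beyond
  its end.\<close>

definition nth_is :: "'b list \<Rightarrow> nat \<Rightarrow> 'b \<Rightarrow> bool" where
  "nth_is w k a \<longleftrightarrow> k < length w \<and> w ! k = a"

text \<open>Alphabet and length bound stay within \<open>m\<close>, so that quantifiers over letters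
  and positions respect the fan-in and add constant depth.\<close>

definition word_fo :: "(bool list \<Rightarrow> bool) set \<Rightarrow> nat \<Rightarrow> nat \<Rightarrow> nat \<Rightarrow> (bool list \<Rightarrow> 'b::finite list) \<Rightarrow> bool" where
  "word_fo F m d B W \<longleftrightarrow> CARD('b) \<le> m \<and> B \<le> m \<and> (\<forall>x. length (W x) \<le> B) \<and>
     (\<forall>k a. fo F m d (\<lambda>x. nth_is (W x) k a))"

lemma word_foD:
  fixes W :: "bool list \<Rightarrow> 'b::finite list"
  assumes "word_fo F m d B W"
  shows "CARD('b) \<le> m" "B \<le> m" "Suc B \<le> m + 2" "B \<le> m + 2" "length (W x) \<le> B" "fo F m d (\<lambda>x. nth_is (W x) k a)"
  using assms by (auto simp: word_fo_def)

lemma word_foI: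
  fixes W :: "bool list \<Rightarrow> 'b::finite list"
  assumes "CARD('b) \<le> m" "B \<le> m" "\<And>x. length (W x) \<le> B" "\<And>k a. fo F m e (P k a)" "e \<le> d"
    "\<And>x k a. nth_is (W x) k a \<longleftrightarrow> P k a x"
  shows "word_fo F m d B W"
  unfolding word_fo_def using assms(1-3) fo_cong[OF fo_mono[OF assms(4,5)] assms(6)] by blast

lemma word_fo_mono: "word_fo F m d B W \<Longrightarrow> d \<le> d' \<Longrightarrow> B \<le> B' \<Longrightarrow> B' \<le> m \<Longrightarrow> word_fo F m d' B' W"
  unfolding word_fo_def using fo_mono le_trans by blast

text \<open>The end of a word is visible locally: no letter at \<open>l\<close>, but one just before
  it unless \<open>l = 0\<close>.\<close>

lemma fo_length:
  fixes W :: "bool list \<Rightarrow> 'b::finite list"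
  assumes W: "word_fo F m d B W"
  shows "fo F m (d + 10) (\<lambda>x. length (W x) = l)"
proof (rule fo_cong, rule fo_mono)
  \<comment> \<open>The depth is written exactly as \<open>fo_intros\<close> assembles it, so that
    the rules apply syntactically; \<open>fo_mono\<close> then rounds it up.\<close>
  show "fo F m (max (Suc d + 3) (Suc (max 2 (Suc d))) + 3) (\<lambda>x. (\<forall>a. \<not> nth_is (W x) l a) \<and> (l = 0 \<or> (\<exists>a. nth_is (W x) (l - 1) a)))"
    by (rule fo_intros word_foD[OF W])+
  show "length (W x) = l \<longleftrightarrow> (\<forall>a. \<not> nth_is (W x) l a) \<and> (l = 0 \<or> (\<exists>a. nth_is (W x) (l - 1) a))" for x
    by (cases "length (W x)") (auto simp: nth_is_def)
qed arith

lemma word_fo_const: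
  fixes w :: "'b::finite list"
  assumes "CARD('b) \<le> m" "length w \<le> B" "B \<le> m"
  shows "word_fo F m 2 B (\<lambda>x. w)"
  by (rule word_foI[where P = "\<lambda>k a x. nth_is w k a" and e = 2]) (use assms in \<open>simp_all add: fo_const\<close>)

text \<open>The second word is shifted by an amount that depends on the input. Guessing the length
  \<open>l\<close> of the first word turns \<open>k - l\<close> into a constant; dropping and
  reversing below use the same device.\<close>

lemma word_fo_append:
  fixes U V :: "bool list \<Rightarrow> 'b::finite list"
  assumes U: "word_fo F m d B U" and V: "word_fo F m e C V" and BC: "B + C \<le> m"
  shows "word_fo F m (max d e + 20) (B + C) (\<lambda>x. U x @ V x)"
proof (rule word_foI[OF word_foD(1)[OF U] BC])
  show "length (U x @ V x) \<le> B + C" for x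
    using word_foD(5)[OF U, of x] word_foD(5)[OF V, of x] by simp
  show "fo F m (Suc (max d (Suc (max (d + 10) (max 2 e + 3) + 3))))
      (\<lambda>x. nth_is (U x) k a \<or> (\<exists>l\<in>{..<Suc B}. length (U x) = l \<and> l \<le> k \<and> nth_is (V x) (k - l) a))" for k a
    by (rule word_foD(3)[OF U] word_foD(6)[OF U] word_foD(6)[OF V] fo_length[OF U] fo_intros)+
  show "nth_is (U x @ V x) k a \<longleftrightarrow>
      nth_is (U x) k a \<or> (\<exists>l\<in>{..<Suc B}. length (U x) = l \<and> l \<le> k \<and> nth_is (V x) (k - l) a)" for x k a
    using word_foD(5)[OF U, of x] by (auto simp: nth_is_def nth_append)
qed arith

lemma word_fo_drop_length:
  fixes U :: "bool list \<Rightarrow> 'c::finite list" and V :: "bool list \<Rightarrow> 'b::finite list"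
  assumes U: "word_fo F m d B U" and V: "word_fo F m e C V"
  shows "word_fo F m (max d e + 20) C (\<lambda>x. drop (length (U x)) (V x))"
proof (rule word_foI[OF word_foD(1,2)[OF V]])
  show "length (drop (length (U x)) (V x)) \<le> C" for x
    using word_foD(5)[OF V, of x] by simp
  show "fo F m (Suc (max (d + 10) e + 3)) (\<lambda>x. \<exists>l\<in>{..<Suc B}. length (U x) = l \<and> nth_is (V x) (l + k) a)" for k a
    by (rule word_foD(3)[OF U] word_foD(6)[OF V] fo_length[OF U] fo_intros)+
  show "nth_is (drop (length (U x)) (V x)) k a \<longleftrightarrow> (\<exists>l\<in>{..<Suc B}. length (U x) = l \<and> nth_is (V x) (l + k) a)" for x k a
    using word_foD(5)[OF U, of x] by (auto simp: nth_is_def)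
qed arith

lemma word_fo_rev:
  fixes W :: "bool list \<Rightarrow> 'b::finite list"
  assumes W: "word_fo F m d B W"
  shows "word_fo F m (d + 20) B (\<lambda>x. rev (W x))"
proof (rule word_foI[OF word_foD(1,2)[OF W]])
  show "length (rev (W x)) \<le> B" for x
    using word_foD(5)[OF W, of x] by simp
  show "fo F m (Suc (max (d + 10) (max 2 d + 3) + 3))
      (\<lambda>x. \<exists>l\<in>{..<Suc B}. length (W x) = l \<and> k < l \<and> nth_is (W x) (l - Suc k) a)" for k a
    by (rule word_foD(3)[OF W] word_foD(6)[OF W] fo_length[OF W] fo_intros)+
  show "nth_is (rev (W x)) k a \<longleftrightarrow> (\<exists>l\<in>{..<Suc B}. length (W x) = l \<and> k < l \<and> nth_is (W x) (l - Suc k) a)" for x k a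
    using word_foD(5)[OF W, of x] by (auto simp: nth_is_def rev_nth)
qed arith

lemma word_fo_take:
  fixes W :: "bool list \<Rightarrow> 'b::finite list"
  assumes W: "word_fo F m d B W"
  shows "word_fo F m (d + 5) B (\<lambda>x. take i (W x))"
proof (rule word_foI[OF word_foD(1,2)[OF W]])
  show "length (take i (W x)) \<le> B" for x
    using word_foD(5)[OF W, of x] by simp
  show "fo F m (max 2 d + 3) (\<lambda>x. k < i \<and> nth_is (W x) k a)" for k a
    by (rule word_foD(6)[OF W] fo_intros)+
  show "nth_is (take i (W x)) k a \<longleftrightarrow> k < i \<and> nth_is (W x) k a" for x k a
    by (auto simp: nth_is_def)
qed arith

lemma word_fo_drop:
  fixes W :: "bool list \<Rightarrow> 'b::finite list"
  assumes W: "word_fo F m d B W"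
  shows "word_fo F m d B (\<lambda>x. drop i (W x))"
proof (rule word_foI[OF word_foD(1,2)[OF W]])
  show "length (drop i (W x)) \<le> B" for x
    using word_foD(5)[OF W, of x] by simp
  show "fo F m d (\<lambda>x. nth_is (W x) (i + k) a)" for k a
    by (rule word_foD(6)[OF W])
  show "nth_is (drop i (W x)) k a \<longleftrightarrow> nth_is (W x) (i + k) a" for x k a
    by (auto simp: nth_is_def)
qed arith

lemma word_fo_map:
  fixes W :: "bool list \<Rightarrow> 'b::finite list" and f :: "'b \<Rightarrow> 'c::finite"
  assumes W: "word_fo F m d B W" and card: "CARD('c) \<le> m"
  shows "word_fo F m (d + 6) B (\<lambda>x. map f (W x))"
proof (rule word_foI[OF card word_foD(2)[OF W]])
  show "length (map f (W x)) \<le> B" for x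
    using word_foD(5)[OF W, of x] by simp
  show "fo F m (Suc (max 2 d + 3)) (\<lambda>x. \<exists>b. f b = a \<and> nth_is (W x) k b)" for k a
    by (rule word_foD(1)[OF W] word_foD(6)[OF W] fo_intros)+
  show "nth_is (map f (W x)) k a \<longleftrightarrow> (\<exists>b. f b = a \<and> nth_is (W x) k b)" for x k a
    by (auto simp: nth_is_def)
qed arith

lemma length_takeWhile_greater: "k < length (takeWhile P xs) \<longleftrightarrow> k < length xs \<and> (\<forall>r\<le>k. P (xs ! r))"
proof (induction xs arbitrary: k)
  case (Cons y xs)
  thus ?case by (cases k) (auto simp: All_less_Suc2 simp flip: less_Suc_eq_le)
qed simp

lemma word_fo_takeWhile:
  fixes W :: "bool list \<Rightarrow> 'b::finite list"
  assumes W: "word_fo F m d B W"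
  shows "word_fo F m (d + 20) B (\<lambda>x. takeWhile P (W x))"
proof (rule word_foI[OF word_foD(1,2)[OF W]])
  show "length (takeWhile P (W x)) \<le> B" for x
    using word_foD(5)[OF W, of x] length_takeWhile_le[of P "W x"] by linarith
  show "fo F m (max d (max 2 (max 2 (Suc (max 2 d + 3)) + 2 + 3) + 3) + 3)
      (\<lambda>x. nth_is (W x) k a \<and> P a \<and> (\<forall>r\<in>{..<B}. r < k \<longrightarrow> (\<exists>b. P b \<and> nth_is (W x) r b)))" for k a
    by (rule word_foD(1,4)[OF W] word_foD(6)[OF W] fo_intros)+
  show "nth_is (takeWhile P (W x)) k a \<longleftrightarrow>
      nth_is (W x) k a \<and> P a \<and> (\<forall>r\<in>{..<B}. r < k \<longrightarrow> (\<exists>b. P b \<and> nth_is (W x) r b))" for x k a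
    using word_foD(5)[OF W, of x]
    by (auto simp: nth_is_def length_takeWhile_greater takeWhile_nth le_less)
qed arith

lemma word_fo_if:
  fixes W :: "bool list \<Rightarrow> 'b::finite list"
  assumes W: "word_fo F m d B W" and f: "fo F m e f"
  shows "word_fo F m (max e d + 3) B (\<lambda>x. if f x then W x else [])"
proof (rule word_foI[OF word_foD(1,2)[OF W]])
  show "length (if f x then W x else []) \<le> B" for x
    using word_foD(5)[OF W, of x] by simp
  show "fo F m (max e d + 3) (\<lambda>x. f x \<and> nth_is (W x) k a)" for k a
    by (rule fo_and f word_foD(6)[OF W])+
  show "nth_is (if f x then W x else []) k a \<longleftrightarrow> f x \<and> nth_is (W x) k a" for x k a
    by (auto simp: nth_is_def)
qed arith

lemma fo_prefix:
  fixes U V :: "bool list \<Rightarrow> 'b::finite list"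
  assumes U: "word_fo F m d B U" and V: "word_fo F m e C V"
  shows "fo F m (max d e + 8) (\<lambda>x. prefix (U x) (V x))"
proof (rule fo_cong, rule fo_mono)
  show "fo F m (max d e + 2 + 3 + 3) (\<lambda>x. \<forall>k\<in>{..<B}. \<forall>a. nth_is (U x) k a \<longrightarrow> nth_is (V x) k a)"
    by (rule word_foD(1,4)[OF U] word_foD(6)[OF U] word_foD(6)[OF V] fo_intros)+
  show "prefix (U x) (V x) \<longleftrightarrow> (\<forall>k\<in>{..<B}. \<forall>a. nth_is (U x) k a \<longrightarrow> nth_is (V x) k a)" for x
  proof
    assume *: "\<forall>k\<in>{..<B}. \<forall>a. nth_is (U x) k a \<longrightarrow> nth_is (V x) k a"
    have n: "k < length (V x) \<and> V x ! k = U x ! k" if "k < length (U x)" for k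
      using * that word_foD(5)[OF U, of x] by (auto simp: nth_is_def)
    have "length (U x) \<le> length (V x)"
      using n[of "length (U x) - 1"] by (cases "length (U x)") auto
    hence "take (length (U x)) (V x) = U x" using n by (intro nth_equalityI) auto
    thus "prefix (U x) (V x)" by (metis take_is_prefix)
  qed (auto simp: prefix_def nth_is_def nth_append)
qed arith

lemma fo_strict_prefix:
  fixes U V :: "bool list \<Rightarrow> 'b::finite list"
  assumes U: "word_fo F m d B U" and V: "word_fo F m e C V"
  shows "fo F m (max d e + 20) (\<lambda>x. strict_prefix (U x) (V x))"
proof (rule fo_cong, rule fo_mono)
  show "fo F m (max (max d e + 8) (Suc (max e d + 8)) + 3) (\<lambda>x. prefix (U x) (V x) \<and> \<not> prefix (V x) (U x))"
    by (rule fo_and fo_neg fo_prefix[OF U V] fo_prefix[OF V U])+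
  show "strict_prefix (U x) (V x) \<longleftrightarrow> prefix (U x) (V x) \<and> \<not> prefix (V x) (U x)" for x
    by (auto simp: strict_prefix_def)
qed arith

lemma fo_eq:
  fixes U V :: "bool list \<Rightarrow> 'b::finite list"
  assumes U: "word_fo F m d B U" and V: "word_fo F m e C V"
  shows "fo F m (max d e + 20) (\<lambda>x. U x = V x)"
proof (rule fo_cong, rule fo_mono)
  show "fo F m (max (max d e + 8) (max e d + 8) + 3) (\<lambda>x. prefix (U x) (V x) \<and> prefix (V x) (U x))"
    by (rule fo_and fo_prefix[OF U V] fo_prefix[OF V U])+
  show "U x = V x \<longleftrightarrow> prefix (U x) (V x) \<and> prefix (V x) (U x)" for x
    by auto
qed arith

section \<open>Slots and tables given by their bits\<close>

definition entry_fo :: "(bool list \<Rightarrow> bool) set \<Rightarrow> nat \<Rightarrow> nat \<Rightarrow> nat \<Rightarrow> (bool list \<Rightarrow> 'a::finite entry) \<Rightarrow> bool" where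
  "entry_fo F m d B E \<longleftrightarrow> fo F m d (\<lambda>x. flag (E x)) \<and> word_fo F m d B (\<lambda>x. src (E x)) \<and> word_fo F m d B (\<lambda>x. tgt (E x))"

text \<open>The slot count is the same for all bit strings, encodings or not, so each slot
  corresponds to a fixed group of circuit bits.\<close>

definition table_fo :: "(bool list \<Rightarrow> bool) set \<Rightarrow> nat \<Rightarrow> nat \<Rightarrow> nat \<Rightarrow> nat \<Rightarrow> (bool list \<Rightarrow> 'a::finite entry list) \<Rightarrow> bool" where
  "table_fo F m d n B T \<longleftrightarrow> n \<le> m \<and> (\<forall>x. length (T x) = n) \<and> (\<forall>i<n. entry_fo F m d B (\<lambda>x. T x ! i))"

lemma entry_foD:
  assumes "entry_fo F m d B E"
  shows "fo F m d (\<lambda>x. flag (E x))" "word_fo F m d B (\<lambda>x. src (E x))" "word_fo F m d B (\<lambda>x. tgt (E x))"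
  using assms by (auto simp: entry_fo_def)

text \<open>Since \<open>R\<close> fails on the default, the case without a match needs no disjunct
  of its own.\<close>

lemma pick_iff:
  assumes "\<not> R (False, [], [])"
  shows "R (pick P T) \<longleftrightarrow> (\<exists>i\<in>{..<length T}. P (T ! i) \<and> (\<forall>j\<in>{..<length T}. j < i \<longrightarrow> \<not> P (T ! j)) \<and> R (T ! i))"
proof (cases "find P T")
  case None
  hence "\<not> P (T ! i)" if "i < length T" for i using that by (metis find_None_iff nth_mem)
  thus ?thesis using assms None by (auto simp: pick_def)
next
  case (Some e)
  then obtain i where i: "i < length T" "P (T ! i)" "e = T ! i" "\<And>j. j < i \<Longrightarrow> \<not> P (T ! j)"
    by (auto simp: find_Some_iff)
  have "R (pick P T) \<longleftrightarrow> R (T ! i)" using Some i by (simp add: pick_def)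
  moreover have "i' = i" if "P (T ! i')" "\<forall>j\<in>{..<length T}. j < i' \<longrightarrow> \<not> P (T ! j)" for i'
    using that i by (metis lessThan_iff linorder_neqE_nat)
  moreover have "\<forall>j\<in>{..<length T}. j < i \<longrightarrow> \<not> P (T ! j)" using i(4) by blast
  ultimately show ?thesis using i(1,2) by blast
qed

lemma fo_pick:
  assumes P: "\<And>i. i < n \<Longrightarrow> fo F m e (\<lambda>x. P x (T x ! i))" and R: "\<And>i. i < n \<Longrightarrow> fo F m d (\<lambda>x. R (T x ! i))"
    and n: "n \<le> m" "\<And>x. length (T x) = n" and "\<not> R (False, [], [])"
  shows "fo F m (max d e + 15) (\<lambda>x. R (pick (P x) (T x)))"
proof (rule fo_cong, rule fo_mono)
  have n': "n \<le> m + 2" using n(1) by simp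
  show "fo F m (Suc (max e (max (max 2 (Suc e) + 2 + 3) d + 3) + 3))
    (\<lambda>x. \<exists>i\<in>{..<n}. P x (T x ! i) \<and> (\<forall>j\<in>{..<n}. j < i \<longrightarrow> \<not> P x (T x ! j)) \<and> R (T x ! i))"
    by (rule n' P R fo_intros | assumption)+
  show "R (pick (P x) (T x)) \<longleftrightarrow>
    (\<exists>i\<in>{..<n}. P x (T x ! i) \<and> (\<forall>j\<in>{..<n}. j < i \<longrightarrow> \<not> P x (T x ! j)) \<and> R (T x ! i))" for x
    using pick_iff[of R "P x" "T x"] assms(5) n(2) by simp
qed arith

lemma entry_fo_pick:
  fixes T :: "bool list \<Rightarrow> 'a::finite entry list"
  assumes T: "table_fo F m d n B T" and P: "\<And>i. i < n \<Longrightarrow> fo F m e (\<lambda>x. P x (T x ! i))"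
    and card: "CARD('a) \<le> m" "B \<le> m"
  shows "entry_fo F m (max d e + 15) B (\<lambda>x. pick (P x) (T x))"
proof -
  have E: "entry_fo F m d B (\<lambda>x. T x ! i)" if "i < n" for i using T that by (simp add: table_fo_def)
  have n: "n \<le> m" "\<And>x. length (T x) = n" using T by (simp_all add: table_fo_def)
  have "length (src (pick (P x) (T x))) \<le> B \<and> length (tgt (pick (P x) (T x))) \<le> B" for x
  proof (cases rule: pick_cases[of "P x" "T x"])
    case 1
    then obtain i where "i < n" "pick (P x) (T x) = T x ! i" using n by (auto simp: in_set_conv_nth)
    thus ?thesis using word_foD(5)[OF entry_foD(2)[OF E], of i x] word_foD(5)[OF entry_foD(3)[OF E], of i x] by simp
  qed simp
  moreover have "fo F m (max d e + 15) (\<lambda>x. flag (pick (P x) (T x)))"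
    by (rule fo_pick[where P = P and T = T and R = flag, OF P entry_foD(1)[OF E] n]) simp_all
  moreover have "fo F m (max d e + 15) (\<lambda>x. nth_is (src (pick (P x) (T x))) k a)" for k a
    by (rule fo_pick[where P = P and T = T and R = "\<lambda>e. nth_is (src e) k a", OF P word_foD(6)[OF entry_foD(2)[OF E]] n])
      (simp_all add: nth_is_def)
  moreover have "fo F m (max d e + 15) (\<lambda>x. nth_is (tgt (pick (P x) (T x))) k a)" for k a
    by (rule fo_pick[where P = P and T = T and R = "\<lambda>e. nth_is (tgt e) k a", OF P word_foD(6)[OF entry_foD(3)[OF E]] n])
      (simp_all add: nth_is_def)
  ultimately show ?thesis using card by (simp add: entry_fo_def word_fo_def)
qed

lemma entry_fo_follow:
  fixes T :: "bool list \<Rightarrow> 'a::finite entry list"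
  assumes T: "table_fo F m d n B T" and E: "entry_fo F m d B E" and B: "B + B \<le> m"
  shows "entry_fo F m (d + 70) (B + B) (\<lambda>x. follow (T x) (E x))"
proof -
  have E': "entry_fo F m d B (\<lambda>x. T x ! i)" if "i < n" for i using T that by (simp add: table_fo_def)
  define P where "P = (\<lambda>x e'. flag e' \<and> prefix (src e') (tgt (E x)))"
  note c = word_foD(1,2)[OF entry_foD(2)[OF E]]
  \<comment> \<open>Testing costs 8 for \<open>fo_prefix\<close> and 3 for the conjunction,
    \<open>pick\<close> adds 15, dropping 20 and appending 20: 66 in all.\<close>
  have P: "fo F m (d + 11) (\<lambda>x. P x (T x ! i))" if "i < n" for i
    unfolding P_def by (rule fo_mono, (rule fo_and fo_prefix entry_foD[OF E] entry_foD[OF E'] that)+) arith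
  note K = entry_foD[OF entry_fo_pick[where P = P, OF T P c]]
  have "fo F m (d + 70) (\<lambda>x. flag (E x) \<and> flag (pick (P x) (T x)))"
    by (rule fo_mono, rule fo_and, rule entry_foD[OF E], rule K) simp_all
  moreover have "word_fo F m (d + 70) (B + B) (\<lambda>x. src (E x))"
    by (rule word_fo_mono[OF entry_foD(2)[OF E] _ _ B]) simp_all
  moreover have "word_fo F m (d + 70) (B + B)
      (\<lambda>x. tgt (pick (P x) (T x)) @ drop (length (src (pick (P x) (T x)))) (tgt (E x)))"
    by (rule word_fo_mono, rule word_fo_append, rule K(3), assumption, rule word_fo_drop_length, rule K(2),
        assumption, rule entry_foD(3)[OF E], rule B) (use B in simp_all)
  ultimately show ?thesis unfolding entry_fo_def follow_def P_def Let_def by simp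
qed

lemma entry_fo_precede:
  fixes T :: "bool list \<Rightarrow> 'a::finite entry list"
  assumes T: "table_fo F m d n B T" and E: "entry_fo F m d B E" and B: "B + B \<le> m"
  shows "entry_fo F m (d + 80) (B + B) (\<lambda>x. precede (T x) (E x))"
proof -
  have E': "entry_fo F m d B (\<lambda>x. T x ! i)" if "i < n" for i using T that by (simp add: table_fo_def)
  define P where "P = (\<lambda>x e. flag e \<and> strict_prefix (tgt e) (src (E x)))"
  note c = word_foD(1,2)[OF entry_foD(2)[OF E]]
  \<comment> \<open>The strict prefix test costs 20 instead of 8, so the total rises to 78. This is
    the origin of the depth 80 per level.\<close>
  have P: "fo F m (d + 23) (\<lambda>x. P x (T x ! i))" if "i < n" for i
    unfolding P_def by (rule fo_mono, (rule fo_and fo_strict_prefix entry_foD[OF E] entry_foD[OF E'] that)+) arith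
  note K = entry_foD[OF entry_fo_pick[where P = P, OF T P c]]
  have "fo F m (d + 80) (\<lambda>x. flag (E x) \<and> flag (pick (P x) (T x)))"
    by (rule fo_mono, rule fo_and, rule entry_foD[OF E], rule K) simp_all
  moreover have "word_fo F m (d + 80) (B + B) (\<lambda>x. tgt (E x))"
    by (rule word_fo_mono[OF entry_foD(3)[OF E] _ _ B]) simp_all
  moreover have "word_fo F m (d + 80) (B + B)
      (\<lambda>x. src (pick (P x) (T x)) @ drop (length (tgt (pick (P x) (T x)))) (src (E x)))"
    by (rule word_fo_mono, rule word_fo_append, rule K(2), assumption, rule word_fo_drop_length, rule K(3),
        assumption, rule entry_foD(2)[OF E], rule B) (use B in simp_all)
  ultimately show ?thesis unfolding entry_fo_def precede_def P_def Let_def by simp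
qed

lemma entry_fo_mono: "entry_fo F m d B E \<Longrightarrow> d \<le> d' \<Longrightarrow> entry_fo F m d' B E"
  unfolding entry_fo_def using fo_mono word_fo_mono[of F m d B _ d' B] word_foD(2) by blast

lemma table_fo_comp_table:
  fixes T :: "bool list \<Rightarrow> 'a::finite entry list"
  assumes T: "table_fo F m d n B T" and T': "table_fo F m d n B T'" and B: "B + B \<le> m" and n: "n + n \<le> m"
  shows "table_fo F m (d + 80) (n + n) (B + B) (\<lambda>x. comp_table (T x) (T' x))"
proof -
  have l: "length (T x) = n" "length (T' x) = n" for x using T T' by (simp_all add: table_fo_def)
  have "entry_fo F m (d + 80) (B + B) (\<lambda>x. comp_table (T x) (T' x) ! i)" if i: "i < n + n" for i
  proof (cases "i < n")
    case True
    hence "comp_table (T x) (T' x) ! i = follow (T' x) (T x ! i)" for x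
      by (simp add: comp_table_def nth_append l)
    moreover have "entry_fo F m (d + 80) (B + B) (\<lambda>x. follow (T' x) (T x ! i))"
      using entry_fo_mono[OF entry_fo_follow[OF T' _ B]] T True by (simp add: table_fo_def)
    ultimately show ?thesis by simp
  next
    case False
    hence "comp_table (T x) (T' x) ! i = precede (T x) (T' x ! (i - n))" for x
      using i by (simp add: comp_table_def nth_append l)
    moreover have "entry_fo F m (d + 80) (B + B) (\<lambda>x. precede (T x) (T' x ! (i - n)))"
      using entry_fo_precede[OF T _ B, of "\<lambda>x. T' x ! (i - n)"] T' i False by (simp add: table_fo_def)
    ultimately show ?thesis by simp
  qed
  thus ?thesis using n l by (simp add: table_fo_def comp_table_def)
qed

lemma UNIV_symbol: "(UNIV :: 'a symbol set) = range Letter \<union> {Comma, Semicolon, Bar, Blank}"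
proof -
  have "\<sigma> \<in> range Letter \<union> {Comma, Semicolon, Bar, Blank}" for \<sigma> :: "'a symbol" by (cases \<sigma>) auto
  thus ?thesis by blast
qed

instance symbol :: (finite) finite
  by standard (simp add: UNIV_symbol)

lemma card_le_card_symbol: "CARD('a::finite) \<le> CARD('a symbol)"
  using card_mono[of "UNIV :: 'a symbol set" "range Letter"] by (simp add: card_image inj_def)

text \<open>Positions \<open>k \<le> B\<close> and not just \<open>k < B\<close>: at \<open>k = B\<close> this provides the constant \<open>False\<close>, to which all
  later positions are equal.\<close>

definition bits :: "nat \<Rightarrow> nat \<Rightarrow> (bool list \<Rightarrow> 'a::finite entry list) \<Rightarrow> (bool list \<Rightarrow> bool) set" where
  "bits n B T = (\<Union>i<n. insert (\<lambda>x. flag (T x ! i))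
     ((\<lambda>(k, a) x. nth_is (src (T x ! i)) k a) ` ({..B} \<times> UNIV) \<union>
      (\<lambda>(k, a) x. nth_is (tgt (T x ! i)) k a) ` ({..B} \<times> UNIV)))"

lemma bits_cases:
  fixes T :: "bool list \<Rightarrow> 'a::finite entry list"
  assumes "f \<in> bits n B T"
  obtains i where "i < n" "f = (\<lambda>x. flag (T x ! i))"
    | i k a where "i < n" "f = (\<lambda>x. nth_is (src (T x ! i)) k a)"
    | i k a where "i < n" "f = (\<lambda>x. nth_is (tgt (T x ! i)) k a)"
proof -
  from assms obtain i where i: "i < n" and f: "f \<in> insert (\<lambda>x. flag (T x ! i))
     ((\<lambda>(k, a) x. nth_is (src (T x ! i)) k a) ` ({..B} \<times> UNIV) \<union>
      (\<lambda>(k, a) x. nth_is (tgt (T x ! i)) k a) ` ({..B} \<times> UNIV))"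
    unfolding bits_def UN_iff lessThan_iff by (elim bexE) simp
  from f show thesis
  proof (elim insertE UnE imageE)
    assume "f = (\<lambda>x. flag (T x ! i))"
    thus thesis by (rule that(1)[OF i])
  next
    fix ka :: "nat \<times> 'a" assume "f = (case ka of (k, a) \<Rightarrow> \<lambda>x. nth_is (src (T x ! i)) k a)"
    thus thesis using that(2)[OF i, of "fst ka" "snd ka"] by (simp add: case_prod_beta)
  next
    fix ka :: "nat \<times> 'a" assume "f = (case ka of (k, a) \<Rightarrow> \<lambda>x. nth_is (tgt (T x ! i)) k a)"
    thus thesis using that(3)[OF i, of "fst ka" "snd ka"] by (simp add: case_prod_beta)
  qed
qed

lemma bitsI:
  assumes "i < n"
  shows "(\<lambda>x. flag (T x ! i)) \<in> bits n B T"
    "k \<le> B \<Longrightarrow> (\<lambda>x. nth_is (src (T x ! i)) k a) \<in> bits n B T"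
    "k \<le> B \<Longrightarrow> (\<lambda>x. nth_is (tgt (T x ! i)) k a) \<in> bits n B T"
proof -
  have i: "i \<in> {..<n}" using assms by simp
  show "(\<lambda>x. flag (T x ! i)) \<in> bits n B T" unfolding bits_def by (rule UN_I[OF i insertI1])
  assume k: "k \<le> B"
  hence ka: "(k, a) \<in> {..B} \<times> UNIV" by simp
  have "(\<lambda>x. nth_is (src (T x ! i)) k a) \<in> (\<lambda>(k, a) x. nth_is (src (T x ! i)) k a) ` ({..B} \<times> UNIV)"
    by (rule image_eqI[OF _ ka]) simp
  thus "(\<lambda>x. nth_is (src (T x ! i)) k a) \<in> bits n B T"
    unfolding bits_def by (intro UN_I[OF i] insertI2 UnI1)
  have "(\<lambda>x. nth_is (tgt (T x ! i)) k a) \<in> (\<lambda>(k, a) x. nth_is (tgt (T x ! i)) k a) ` ({..B} \<times> UNIV)"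
    by (rule image_eqI[OF _ ka]) simp
  thus "(\<lambda>x. nth_is (tgt (T x ! i)) k a) \<in> bits n B T"
    unfolding bits_def by (intro UN_I[OF i] insertI2 UnI2)
qed

lemma finite_bits: "finite (bits n B T)"
  unfolding bits_def by (intro finite_UN_I finite_lessThan finite.insertI finite_UnI finite_imageI) simp_all

lemma card_bits:
  fixes T :: "bool list \<Rightarrow> 'a::finite entry list"
  shows "card (bits n B T) \<le> n * (1 + 2 * (Suc B * CARD('a)))"
proof -
  let ?s = "\<lambda>i. (\<lambda>(k, a) x. nth_is (src (T x ! i)) k a) ` ({..B} \<times> UNIV)"
  let ?t = "\<lambda>i. (\<lambda>(k, a) x. nth_is (tgt (T x ! i)) k a) ` ({..B} \<times> UNIV)"
  have "card (insert (\<lambda>x. flag (T x ! i)) (?s i \<union> ?t i)) \<le> 1 + 2 * (Suc B * CARD('a))" for i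
  proof -
    have "card (?s i) \<le> Suc B * CARD('a)" "card (?t i) \<le> Suc B * CARD('a)"
      by (rule order.trans[OF card_image_le]; simp)+
    hence "card (?s i \<union> ?t i) \<le> 2 * (Suc B * CARD('a))"
      using card_Un_le[of "?s i" "?t i"] by linarith
    thus ?thesis using card_insert_le_m1[of "1 + 2 * (Suc B * CARD('a))" "?s i \<union> ?t i"] by simp
  qed
  hence "(\<Sum>i<n. card (insert (\<lambda>x. flag (T x ! i)) (?s i \<union> ?t i))) \<le> (\<Sum>i<n. 1 + 2 * (Suc B * CARD('a)))"
    by (intro sum_mono)
  moreover have "card (bits n B T) \<le> (\<Sum>i<n. card (insert (\<lambda>x. flag (T x ! i)) (?s i \<union> ?t i)))"
    unfolding bits_def by (rule card_UN_le) simp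
  ultimately show ?thesis by simp
qed

lemma fo_bits: "table_fo F m d n B T \<Longrightarrow> f \<in> bits n B' T \<Longrightarrow> fo F m d f"
  by (erule bits_cases) (auto simp: table_fo_def entry_fo_def word_fo_def)

text \<open>Once its bits are available as gates, a table may enter the next level at depth
  0.\<close>

lemma table_fo_bits:
  fixes T :: "bool list \<Rightarrow> 'a::finite entry list"
  assumes "table_fo F m d n B T" "bits n B T \<subseteq> F'"
  shows "table_fo F' m 0 n B T"
proof -
  have "entry_fo F' m 0 B (\<lambda>x. T x ! i)" if i: "i < n" for i
  proof -
    have E: "entry_fo F m d B (\<lambda>x. T x ! i)" using assms(1) i by (simp add: table_fo_def)
    have b: "fo F' m 0 f" if "f \<in> bits n B T" for f using assms(2) that fo_base by blast
    have "fo F' m 0 (\<lambda>x. nth_is (src (T x ! i)) k a)" for k a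
    proof (cases "k \<le> B")
      case False
      hence "nth_is (src (T x ! i)) k a \<longleftrightarrow> nth_is (src (T x ! i)) B a" for x
        using word_foD(5)[OF entry_foD(2)[OF E], of x] by (auto simp: nth_is_def)
      thus ?thesis using b[OF bitsI(2)[OF i order.refl]] by simp
    qed (rule b[OF bitsI(2)[OF i]])
    moreover have "fo F' m 0 (\<lambda>x. nth_is (tgt (T x ! i)) k a)" for k a
    proof (cases "k \<le> B")
      case False
      hence "nth_is (tgt (T x ! i)) k a \<longleftrightarrow> nth_is (tgt (T x ! i)) B a" for x
        using word_foD(5)[OF entry_foD(3)[OF E], of x] by (auto simp: nth_is_def)
      thus ?thesis using b[OF bitsI(3)[OF i order.refl]] by simp
    qed (rule b[OF bitsI(3)[OF i]])
    moreover have "fo F' m 0 (\<lambda>x. flag (T x ! i))" by (rule b[OF bitsI(1)[OF i]])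
    ultimately show ?thesis
      using E by (simp add: entry_fo_def word_fo_def)
  qed
  thus ?thesis using assms(1) by (simp add: table_fo_def)
qed

section \<open>Reading slots off a decoded string\<close>

lemma word_fo_run:
  fixes z :: "bool list \<Rightarrow> 'a::finite symbol list"
  assumes z: "word_fo F m d L z"
  shows "word_fo F m (d + 26) L (\<lambda>x. run (z x))"
proof -
  have "CARD('a) \<le> m" using card_le_card_symbol word_foD(1)[OF z] le_trans by blast
  thus ?thesis
    unfolding run_def using word_fo_map[OF word_fo_takeWhile[OF z]] by (simp add: add.assoc)
qed

lemma word_fo_src_at:
  fixes z :: "bool list \<Rightarrow> 'a::finite symbol list"
  assumes z: "word_fo F m d L z"
  shows "word_fo F m (d + 100) L (\<lambda>x. src_at (z x) i)"
  unfolding src_at_def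
  by (rule word_fo_mono[OF word_fo_rev[OF word_fo_run[OF word_fo_rev[OF word_fo_take[OF z]]]]])
    (use word_foD(2)[OF z] in simp_all)

lemma word_fo_tgt_at:
  fixes z :: "bool list \<Rightarrow> 'a::finite symbol list"
  assumes z: "word_fo F m d L z"
  shows "word_fo F m (d + 100) L (\<lambda>x. tgt_at (z x) i)"
  unfolding tgt_at_def
  by (rule word_fo_mono[OF word_fo_run[OF word_fo_drop[OF z]]])
    (use word_foD(2)[OF z] in simp_all)

lemma fo_nth_eq:
  assumes z: "word_fo F m d L z" "\<And>x. length (z x) = L" and "i < L"
  shows "fo F m d (\<lambda>x. z x ! i = \<sigma>)"
  by (rule fo_cong[OF word_foD(6)[OF z(1), of i \<sigma>]]) (simp add: nth_is_def z(2) assms(3))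

lemma table_fo_parse:
  fixes z :: "bool list \<Rightarrow> 'a::finite symbol list"
  assumes z: "word_fo F m d L z" "\<And>x. length (z x) = L"
    and Q: "\<And>i. i < L \<Longrightarrow> fo F m e (\<lambda>x. Q x i)"
  shows "table_fo F m (max d e + 100) L L (\<lambda>x. parse (z x) (Q x))"
proof -
  have "entry_fo F m (max d e + 100) L (\<lambda>x. parse (z x) (Q x) ! i)" if i: "i < L" for i
  proof -
    have "parse (z x) (Q x) ! i = (z x ! i = Comma \<and> Q x i, src_at (z x) i, tgt_at (z x) i)" for x
      using i z(2)[of x] by (simp add: parse_def)
    moreover have "fo F m (max d e + 100) (\<lambda>x. z x ! i = Comma \<and> Q x i)"
      by (rule fo_mono[OF fo_and[OF fo_nth_eq[OF z i] Q[OF i]]]) simp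
    moreover have "word_fo F m (max d e + 100) L (\<lambda>x. src_at (z x) i)"
      by (rule word_fo_mono[OF word_fo_src_at[OF z(1)]]) (use word_foD(2)[OF z(1)] in simp_all)
    moreover have "word_fo F m (max d e + 100) L (\<lambda>x. tgt_at (z x) i)"
      by (rule word_fo_mono[OF word_fo_tgt_at[OF z(1)]]) (use word_foD(2)[OF z(1)] in simp_all)
    ultimately show ?thesis by (simp add: entry_fo_def)
  qed
  thus ?thesis using word_foD(2)[OF z(1)] z(2) by (simp add: table_fo_def parse_def)
qed

lemma table_fo_leaf:
  fixes z :: "bool list \<Rightarrow> 'a::finite symbol list"
  assumes z: "word_fo F m d L z" "\<And>x. length (z x) = L"
  shows "table_fo F m (d + 200) L L (\<lambda>x. leaf (z x) t)"
proof -
  have L: "L \<le> m" using word_foD(2)[OF z(1)] .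
  show ?thesis
  proof (cases "t < L")
    case False
    hence eq: "leaf (z x) t = map (\<lambda>i. (i = 0, [], [])) [0..<L]" for x by (simp add: leaf_def z(2))
    have "CARD('a) \<le> m" using card_le_card_symbol word_foD(1)[OF z(1)] le_trans by blast
    hence w: "word_fo F m (d + 200) L (\<lambda>x. [] :: 'a list)"
      using L by (intro word_fo_mono[OF word_fo_const[of m "[]" L F]]) simp_all
    have "fo F m (d + 200) (\<lambda>x. i = 0)" for i :: nat by (rule fo_mono[OF fo_const]) simp
    thus ?thesis unfolding eq using L w by (simp add: table_fo_def entry_fo_def)
  next
    case True
    define Q where "Q = (\<lambda>x i. i < t \<and> (\<forall>j\<in>{i..<t}. z x ! j \<noteq> Bar))"
    have bar: "fo F m d (\<lambda>x. z x ! t = Bar)" by (rule fo_nth_eq[OF z True])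
    have Q: "fo F m (d + 10) (\<lambda>x. Q x i)" for i
    proof -
      have "fo F m (Suc d) (\<lambda>x. z x ! j \<noteq> Bar)" if "j \<in> {i..<t}" for j
        using that True by (intro fo_neg fo_nth_eq[OF z]) simp
      moreover have "card {i..<t} \<le> m + 2" using True L by simp
      ultimately have "fo F m (Suc d + 3) (\<lambda>x. \<forall>j\<in>{i..<t}. z x ! j \<noteq> Bar)" by (intro fo_ball) simp_all
      from fo_and[OF fo_const[where c = "i < t"] this] show ?thesis
        unfolding Q_def by (rule fo_mono) simp
    qed
    have P: "table_fo F m (d + 110) L L (\<lambda>x. parse (z x) (Q x))"
      using table_fo_parse[OF z, of "d + 10" Q] Q by (simp add: add.commute)
    have "entry_fo F m (d + 200) L (\<lambda>x. leaf (z x) t ! i)" if i: "i < L" for i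
    proof -
      have E: "entry_fo F m (d + 110) L (\<lambda>x. parse (z x) (Q x) ! i)" using P i by (simp add: table_fo_def)
      \<comment> \<open>Whether position \<open>t\<close> holds a bar depends on the input, so the
        case distinction is moved into each of the three components of a slot.\<close>
      have eq: "leaf (z x) t ! i = ((z x ! t = Bar \<longrightarrow> flag (parse (z x) (Q x) ! i)) \<and> (z x ! t = Bar \<or> i = 0),
          if z x ! t = Bar then src (parse (z x) (Q x) ! i) else [],
          if z x ! t = Bar then tgt (parse (z x) (Q x) ! i) else [])" for x
        using True i z(2)[of x] by (simp add: leaf_def Q_def)
      have "fo F m (d + 200) (\<lambda>x. (z x ! t = Bar \<longrightarrow> flag (parse (z x) (Q x) ! i)) \<and> (z x ! t = Bar \<or> i = 0))"
        by (rule fo_mono, rule fo_and[OF fo_imp[OF bar entry_foD(1)[OF E]] fo_or[OF bar fo_const]]) simp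
      moreover have "word_fo F m (d + 200) L (\<lambda>x. if z x ! t = Bar then src (parse (z x) (Q x) ! i) else [])"
        by (rule word_fo_mono[OF word_fo_if[OF entry_foD(2)[OF E] bar]]) (use L in simp_all)
      moreover have "word_fo F m (d + 200) L (\<lambda>x. if z x ! t = Bar then tgt (parse (z x) (Q x) ! i) else [])"
        by (rule word_fo_mono[OF word_fo_if[OF entry_foD(3)[OF E] bar]]) (use L in simp_all)
      ultimately show ?thesis by (simp only: entry_fo_def eq fst_conv snd_conv simp_thms)
    qed
    thus ?thesis using L z(2) by (simp add: table_fo_def leaf_def parse_def)
  qed
qed

section \<open>Decoding blocks of bits\<close>

definition matches :: "('a symbol \<Rightarrow> bool list) \<Rightarrow> nat \<Rightarrow> nat \<Rightarrow> 'a symbol \<Rightarrow> bool list \<Rightarrow> bool" where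
  "matches c w t \<sigma> x \<longleftrightarrow> (\<forall>r\<in>{..<w}. x ! (w * t + r) = c \<sigma> ! r)"

text \<open>A block that is no code word is read as a blank, which makes decoding total and its
  length independent of \<open>x\<close>.\<close>

definition decode :: "('a symbol \<Rightarrow> bool list) \<Rightarrow> nat \<Rightarrow> nat \<Rightarrow> bool list \<Rightarrow> 'a symbol list" where
  "decode c w L x = map (\<lambda>t. if \<exists>\<sigma>. matches c w t \<sigma> x then SOME \<sigma>. matches c w t \<sigma> x else Blank) [0..<L]"

lemma length_decode [simp]: "length (decode c w L x) = L"
  by (simp add: decode_def)

locale coding =
  fixes c :: "'a::finite symbol \<Rightarrow> bool list" and w :: nat
  assumes inj: "inj c" and length_code: "\<And>\<sigma>. length (c \<sigma>) = w"
begin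

lemma matches_unique: "matches c w t \<sigma> x \<Longrightarrow> matches c w t \<tau> x \<Longrightarrow> \<sigma> = \<tau>"
  by (rule injD[OF inj]) (auto simp: matches_def length_code intro: nth_equalityI)

lemma nth_is_decode:
  "nth_is (decode c w L x) t \<sigma> \<longleftrightarrow> t < L \<and> (matches c w t \<sigma> x \<or> \<sigma> = Blank \<and> \<not> (\<exists>\<tau>. matches c w t \<tau> x))"
proof -
  have d: "decode c w L x ! t = (if \<exists>\<sigma>. matches c w t \<sigma> x then SOME \<sigma>. matches c w t \<sigma> x else Blank)" if "t < L"
    using that by (simp add: decode_def)
  show ?thesis
  proof (cases "\<exists>\<tau>. matches c w t \<tau> x")
    case True
    then obtain \<tau> where \<tau>: "matches c w t \<tau> x" by blast
    hence "(SOME \<sigma>. matches c w t \<sigma> x) = \<tau>" using matches_unique by blast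
    moreover have "matches c w t \<sigma> x \<longleftrightarrow> \<tau> = \<sigma>" using \<tau> matches_unique by blast
    ultimately show ?thesis using True d by (auto simp: nth_is_def)
  next
    case False
    thus ?thesis using d by (auto simp: nth_is_def)
  qed
qed

text \<open>Needed to recover the number of symbols from the number of bits by division.\<close>

lemma width_pos: "0 < w"
proof (rule ccontr)
  assume "\<not> 0 < w"
  hence "c Comma = c Bar" using length_code[of Comma] length_code[of Bar] by simp
  thus False using injD[OF inj] by blast
qed

lemma length_to_bits: "length (to_bits c s) = w * length s"
  unfolding to_bits_def by (induction s) (simp_all add: length_code)

lemma nth_to_bits: "t < length s \<Longrightarrow> r < w \<Longrightarrow> to_bits c s ! (w * t + r) = c (s ! t) ! r"
proof (induction s arbitrary: t)
  case (Cons \<sigma> s)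
  show ?case
  proof (cases t)
    case 0
    thus ?thesis using Cons.prems by (simp add: to_bits_def nth_append length_code)
  next
    case (Suc u)
    hence "to_bits c (\<sigma> # s) ! (w * t + r) = (c \<sigma> @ to_bits c s) ! (length (c \<sigma>) + (w * u + r))"
      by (simp add: to_bits_def length_code add.assoc)
    thus ?thesis using Cons Suc by (simp only: nth_append_length_plus) simp
  qed
qed simp

lemma decode_to_bits: "decode c w (length s) (to_bits c s) = s"
proof (rule nth_equalityI)
  fix t assume t: "t < length (decode c w (length s) (to_bits c s))"
  have "matches c w t (s ! t) (to_bits c s)" using t by (simp add: matches_def nth_to_bits)
  hence "nth_is (decode c w (length s) (to_bits c s)) t (s ! t)" using t nth_is_decode by simp
  thus "decode c w (length s) (to_bits c s) ! t = s ! t" by (simp add: nth_is_def)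
qed simp

abbreviation inputs :: "nat \<Rightarrow> (bool list \<Rightarrow> bool) set" where
  "inputs N \<equiv> (\<lambda>j x. x ! j) ` {..<N}"

lemma word_fo_decode:
  assumes "w \<le> m" "L \<le> m" "CARD('a symbol) \<le> m" "w * L \<le> N"
  shows "word_fo (inputs N) m 20 L (decode c w L)"
proof (rule word_foI[OF assms(3,2)])
  have M: "fo (inputs N) m 10 (matches c w t \<sigma>)" if "t < L" for t \<sigma>
  proof -
    have "w * t + r < N" if "r < w" for r
    proof -
      have "w * t + r < w * Suc t" using that by simp
      also have "\<dots> \<le> w * L" using \<open>t < L\<close> by (intro mult_le_mono2) simp
      finally show ?thesis using assms(4) by simp
    qed
    hence "fo (inputs N) m 0 (\<lambda>x. x ! (w * t + r))" if "r < w" for r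
      using that by (intro fo_base) blast
    moreover have "w \<le> m + 2" using assms(1) by simp
    ultimately show ?thesis
      unfolding matches_def by (intro fo_mono[OF fo_ball_less[OF _ fo_iff[OF _ fo_const]]]) auto
  qed
  show "fo (inputs N) m 20 (\<lambda>x. t < L \<and> (matches c w t \<sigma> x \<or> \<sigma> = Blank \<and> \<not> (\<exists>\<tau>. matches c w t \<tau> x)))" for t \<sigma>
  proof (cases "t < L")
    case True
    have "fo (inputs N) m 20 (\<lambda>x. matches c w t \<sigma> x \<or> \<sigma> = Blank \<and> \<not> (\<exists>\<tau>. matches c w t \<tau> x))"
      by (rule fo_mono, rule fo_or[OF M[OF True] fo_and[OF fo_const fo_neg[OF fo_ex[OF assms(3) M[OF True]]]]]) simp
    thus ?thesis using True by simp
  qed (use fo_mono[OF fo_const] in simp)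
qed (simp_all add: nth_is_decode)

end

lemma codingI:
  assumes "binary_code c"
  obtains w where "coding c w"
  using assms unfolding binary_code_def coding_def by blast

section \<open>The composition problem\<close>

text \<open>Every slot is padded to a common width, and an invalid one becomes entirely blank; thus
  each output bit has a fixed place.\<close>

definition render :: "nat \<Rightarrow> 'a entry \<Rightarrow> 'a symbol list" where
  "render R e = (let u = if flag e then map Letter (src e) @ [Comma] @ map Letter (tgt e) @ [Semicolon] else []
     in u @ replicate (R - length u) Blank)"

lemma writes_render: "writes (concat (map (render R) T)) (entries T)"
proof (induction T)
  case Nil
  show ?case by (simp add: writes.intros(1))
next
  case (Cons e T)
  have blanks: "writes (replicate n Blank @ concat (map (render R) T)) (entries T)" for n
    by (induction n) (use Cons writes.intros(2) in auto)
  show ?case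
  proof (cases "flag e")
    case True
    let ?u = "map Letter (src e) @ [Comma] @ map Letter (tgt e) @ [Semicolon]"
    have "render R e = ?u @ replicate (R - length ?u) Blank"
      by (simp only: render_def Let_def True if_True)
    thus ?thesis
      using writes.intros(3)[OF blanks, of "src e" "tgt e" "R - length ?u"] True by simp
  next
    case False
    hence "render R e = replicate R Blank" by (simp add: render_def Let_def)
    thus ?thesis using False blanks[of R] by simp
  qed
qed

lemma word_fo_render:
  fixes E :: "bool list \<Rightarrow> 'a::finite entry"
  assumes E: "entry_fo F m d B E" and card: "CARD('a symbol) \<le> m" and R: "R = B + (1 + (B + 1))" "R \<le> m"
  shows "word_fo F m (d + 90) R (\<lambda>x. render R (E x))"
    and "\<And>x. length (render R (E x)) = R"
proof -
  define u where "u = (\<lambda>x. if flag (E x) then map Letter (src (E x)) @ [Comma] @ map Letter (tgt (E x)) @ [Semicolon] else [])"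
  have c: "word_fo F m 2 1 (\<lambda>x. [\<sigma> :: 'a symbol])" for \<sigma>
    by (rule word_fo_const) (use card R in simp_all)
  have l: "length (map Letter (src (E x)) @ [Comma] @ map Letter (tgt (E x)) @ [Semicolon]) \<le> R" for x
    using word_foD(5)[OF entry_foD(2)[OF E], of x] word_foD(5)[OF entry_foD(3)[OF E], of x] R(1) by simp
  have "word_fo F m (d + 70) R (\<lambda>x. map Letter (src (E x)) @ [Comma] @ map Letter (tgt (E x)) @ [Semicolon])"
    unfolding R(1)
    by (rule word_fo_mono, rule word_fo_append[OF word_fo_map[OF entry_foD(2)[OF E] card]
        word_fo_append[OF c word_fo_append[OF word_fo_map[OF entry_foD(3)[OF E] card] c]]]) (use R in simp_all)
  from word_fo_if[OF this entry_foD(1)[OF E]] have u: "word_fo F m (d + 73) R u"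
    unfolding u_def by (rule word_fo_mono) (use R in simp_all)
  have r: "render R (E x) = u x @ replicate (R - length (u x)) Blank" for x
    by (simp add: render_def u_def Let_def)
  have lu: "length (u x) \<le> R" for x using word_foD(5)[OF u] .
  show len: "length (render R (E x)) = R" for x using lu[of x] by (simp add: r)
  show "word_fo F m (d + 90) R (\<lambda>x. render R (E x))"
  proof (rule word_foI[OF card R(2)])
    show "length (render R (E x)) \<le> R" for x using len by simp
    show "fo F m (Suc (max (d + 73) (max 2 (max 2 (Suc (Suc (d + 73))) + 3) + 3)))
        (\<lambda>x. nth_is (u x) k \<sigma> \<or> \<sigma> = Blank \<and> k < R \<and> \<not> (\<exists>\<tau>. nth_is (u x) k \<tau>))" for k \<sigma>
      by (rule card word_foD(6)[OF u] fo_intros)+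
    show "nth_is (render R (E x)) k \<sigma> \<longleftrightarrow>
        nth_is (u x) k \<sigma> \<or> \<sigma> = Blank \<and> k < R \<and> \<not> (\<exists>\<tau>. nth_is (u x) k \<tau>)" for x k \<sigma>
      using lu[of x] by (auto simp: r nth_is_def nth_append)
  qed simp
qed

lemma to_bits_concat: "to_bits c (concat us) = concat (map (to_bits c) us)"
  unfolding to_bits_def by (induction us) simp_all

context coding
begin

lemma to_bits_eq: "to_bits c u = concat (map (\<lambda>r. map (\<lambda>b. c (u ! r) ! b) [0..<w]) [0..<length u])"
proof -
  have "c \<sigma> = map (\<lambda>b. c \<sigma> ! b) [0..<w]" for \<sigma>
    using map_nth[of "c \<sigma>"] length_code[of \<sigma>] by simp
  hence "to_bits c u = concat (map (\<lambda>\<sigma>. map (\<lambda>b. c \<sigma> ! b) [0..<w]) u)"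
    unfolding to_bits_def by (metis (no_types, lifting) map_cong)
  also have "\<dots> = concat (map (\<lambda>\<sigma>. map (\<lambda>b. c \<sigma> ! b) [0..<w]) (map ((!) u) [0..<length u]))"
    by (simp only: map_nth)
  finally show ?thesis by (simp add: comp_def)
qed

text \<open>The symbol is guessed, so that the bit \<open>c \<sigma> ! b\<close> of its code is a
  constant.\<close>

definition output_bits :: "nat \<Rightarrow> nat \<Rightarrow> (bool list \<Rightarrow> 'a entry list) \<Rightarrow> (bool list \<Rightarrow> bool) list" where
  "output_bits R n T = concat (map (\<lambda>i. concat (map (\<lambda>r. map (\<lambda>b x. \<exists>\<sigma>. nth_is (render R (T x ! i)) r \<sigma> \<and> c \<sigma> ! b)
     [0..<w]) [0..<R])) [0..<n])"

lemma length_output_bits: "length (output_bits R n T) = n * (R * w)"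
  by (simp add: output_bits_def length_concat comp_def sum_list_triv)

lemma fo_output_bits:
  assumes T: "table_fo F m d n B T" and m: "CARD('a symbol) \<le> m" "R = B + (1 + (B + 1))" "R \<le> m"
    and f: "f \<in> set (output_bits R n T)"
  shows "fo F m (d + 100) f"
proof -
  obtain i r b where i: "i < n" and f: "f = (\<lambda>x. \<exists>\<sigma>. nth_is (render R (T x ! i)) r \<sigma> \<and> c \<sigma> ! b)"
    using f by (auto simp: output_bits_def)
  have E: "entry_fo F m d B (\<lambda>x. T x ! i)" using T i by (simp add: table_fo_def)
  show ?thesis
    unfolding f by (rule fo_mono, rule fo_ex[OF m(1) fo_and[OF word_foD(6)[OF word_fo_render(1)[OF E m]] fo_const]]) simp
qed

lemma output_bits_correct:
  assumes T: "table_fo F m d n B T" and m: "CARD('a symbol) \<le> m" "R = B + (1 + (B + 1))" "R \<le> m"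
  shows "map (\<lambda>f. f x) (output_bits R n T) = to_bits c (concat (map (render R) (T x)))"
proof -
  have l: "length (render R (T x ! i)) = R" if "i < n" for i
    using word_fo_render(2)[OF _ m, of F d "\<lambda>x. T x ! i" x] T that by (simp add: table_fo_def)
  have n: "length (T x) = n" using T by (simp add: table_fo_def)
  have "map (\<lambda>f. f x) (output_bits R n T) = concat (map (\<lambda>i. concat (map (\<lambda>r. map (\<lambda>b. \<exists>\<sigma>. nth_is (render R (T x ! i)) r \<sigma> \<and> c \<sigma> ! b)
     [0..<w]) [0..<R])) [0..<n])"
    by (simp add: output_bits_def map_concat comp_def)
  also have "\<dots> = concat (map (\<lambda>i. to_bits c (render R (T x ! i))) [0..<n])"
  proof (intro arg_cong[where f = concat] map_cong refl)
    fix i assume "i \<in> set [0..<n]"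
    hence "length (render R (T x ! i)) = R" using l by simp
    thus "concat (map (\<lambda>r. map (\<lambda>b. \<exists>\<sigma>. nth_is (render R (T x ! i)) r \<sigma> \<and> c \<sigma> ! b) [0..<w]) [0..<R]) =
        to_bits c (render R (T x ! i))"
      unfolding to_bits_eq by (intro arg_cong[where f = concat] map_cong) (auto simp: nth_is_def)
  qed
  also have "\<dots> = to_bits c (concat (map (render R) (map ((!) (T x)) [0..<length (T x)])))"
    by (simp add: to_bits_concat n comp_def)
  finally show ?thesis by (simp only: map_nth)
qed

end

text \<open>Both problems use \<open>m = M ^ 4 - 2\<close> with \<open>M = N + C\<close>: the fan-in
  \<open>m + 2\<close> is then a pure power of \<open>M\<close>, and everything up to
  \<open>M ^ 3\<close> fits below \<open>m\<close>.\<close>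

lemma le_power4:
  assumes "4 \<le> (M::nat)" "y \<le> M ^ 3"
  shows "y + 2 \<le> M ^ 4"
proof -
  have "1 \<le> M ^ 3" using assms(1) by simp
  hence "y + 2 \<le> 4 * M ^ 3" using assms(2) by linarith
  also have "\<dots> \<le> M * M ^ 3" using assms(1) by (rule mult_le_mono1)
  finally show ?thesis by (simp add: power_numeral_reduce)
qed

lemma composition_problem_AC0:
  assumes "binary_code c"
  shows "composition_problem (c :: 'a::finite symbol \<Rightarrow> bool list) \<in> AC 0"
proof -
  obtain w where "coding c w" using codingI[OF assms] .
  then interpret coding c w .
  define C where "C = CARD('a symbol) + w + 4"
  define m where "m = (\<lambda>N. (N + C) ^ 4 - 2)"
  define L where "L = (\<lambda>N. N div w)"
  define z where "z = (\<lambda>N. decode c w (L N))"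
  \<comment> \<open>With only two segments, a comma is assigned to its table by asking whether any
    bar precedes it; no bars need to be counted.\<close>
  define T1 where "T1 = (\<lambda>N x. parse (z N x) (\<lambda>i. \<forall>j\<in>{..<i}. z N x ! j \<noteq> Bar))"
  define T2 where "T2 = (\<lambda>N x. parse (z N x) (\<lambda>i. \<exists>j\<in>{..<i}. z N x ! j = Bar))"
  define T where "T = (\<lambda>N x. comp_table (T1 N x) (T2 N x))"
  define R where "R = (\<lambda>N. (L N + L N) + (1 + ((L N + L N) + 1)))"
  define fs where "fs = (\<lambda>N. output_bits (R N) (L N + L N) (T N))"
  have m2: "m N + 2 = (N + C) ^ 4" for N
    using le_power4[of "N + C" 0] by (simp add: m_def C_def)
  have le_m: "y \<le> m N" if "y \<le> 4 * (N + C)" for y N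
  proof -
    have M: "4 \<le> N + C" by (simp add: C_def)
    have "4 * (N + C) \<le> (N + C) * (N + C)" using M by (rule mult_le_mono1)
    also have "\<dots> \<le> (N + C) ^ 3" using power_increasing[of 2 3 "N + C"] M by (simp add: power2_eq_square)
    finally have "y \<le> (N + C) ^ 3" using that by simp
    thus ?thesis using le_power4[OF M, of y] by (simp add: m_def)
  qed
  have L: "L N \<le> N" "w * L N \<le> N" for N by (simp_all add: L_def)
  have card: "CARD('a symbol) \<le> m N" for N by (rule le_m) (simp add: C_def)
  have R: "R N \<le> m N" for N by (rule le_m) (use L(1)[of N] in \<open>simp add: R_def C_def\<close>)
  have wz: "word_fo (inputs N) (m N) 20 (L N) (z N)" for N
    unfolding z_def by (rule word_fo_decode[OF _ _ card L(2)]) (rule le_m, use L(1)[of N] in \<open>simp add: C_def\<close>)+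
  have lz: "length (z N x) = L N" for N x by (simp add: z_def)
  have b: "fo (inputs N) (m N) 20 (\<lambda>x. z N x ! j = Bar)" if "j < L N" for N j
    by (rule fo_nth_eq[OF wz lz that])
  have i: "i \<le> m N + 2" if "i < L N" for i N using that word_foD(2)[OF wz, of N] by simp
  have 1: "table_fo (inputs N) (m N) 150 (L N) (L N) (T1 N)" for N
  proof -
    have "fo (inputs N) (m N) 50 (\<lambda>x. \<forall>j\<in>{..<k}. z N x ! j \<noteq> Bar)" if "k < L N" for k
      by (rule fo_mono, rule fo_ball_less[OF i[OF that] fo_neg[OF b]]) (use that in simp_all)
    from table_fo_parse[OF wz lz this] show ?thesis by (simp add: T1_def)
  qed
  have 2: "table_fo (inputs N) (m N) 150 (L N) (L N) (T2 N)" for N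
  proof -
    have "fo (inputs N) (m N) 50 (\<lambda>x. \<exists>j\<in>{..<k}. z N x ! j = Bar)" if "k < L N" for k
      by (rule fo_mono, rule fo_bex_less[OF i[OF that] b]) (use that in simp_all)
    from table_fo_parse[OF wz lz this] show ?thesis by (simp add: T2_def)
  qed
  have LL: "L N + L N \<le> m N" for N using R[of N] by (simp add: R_def)
  have T: "table_fo (inputs N) (m N) 230 (L N + L N) (L N + L N) (T N)" for N
    using table_fo_comp_table[OF 1 2 LL LL, of N] by (simp add: T_def)
  have len: "length (fs N) \<le> (m N + 2) ^ 3" for N
  proof -
    have "(L N + L N) * (R N * w) \<le> (m N + 2) * ((m N + 2) * (m N + 2))"
      using LL[of N] R[of N] le_m[of w N] by (intro mult_le_mono) (simp_all add: C_def)
    thus ?thesis by (simp only: fs_def length_output_bits power3_eq_cube mult.assoc)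
  qed
  show ?thesis
  \<comment> \<open>Depth 330 consists of 150 for parsing, 80 for composing and 100 for writing the
    output; the exponent 3 bounds the number of output bits.\<close>
  proof (rule AC_I[where fs = fs and s = "\<lambda>N. N + (m N + 2) ^ 3 * (m N + 2) ^ 330" and D = "\<lambda>N. 0 + 330"])
    fix N
    have "card (set (fs N)) \<le> (m N + 2) ^ 3" using card_length le_trans len by blast
    moreover have "fo (inputs N) (m N) 330 f" if "f \<in> set (fs N)" for f
      using fo_output_bits[OF T card R_def[THEN fun_cong] R that[unfolded fs_def]] by simp
    ultimately show "circ N (N + (m N + 2) ^ 3 * (m N + 2) ^ 330) (0 + 330) (set (fs N))"
      by (intro circ_step[OF circ_inputs]) simp_all
    have M: "4 \<le> m N + 2" unfolding m2 using self_le_power[of "N + C" 4] by (simp add: C_def)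
    \<comment> \<open>Here \<open>333 = 3 + 330\<close>, and one further power absorbs the three
      summands.\<close>
    have "N + (m N + 2) ^ 3 * (m N + 2) ^ 330 + length (fs N) \<le> (m N + 2) ^ 333 + (m N + 2) ^ 333 + (m N + 2) ^ 333"
    proof (intro add_mono)
      have "N \<le> m N + 2" using le_m[of N N] by (simp add: C_def)
      thus "N \<le> (m N + 2) ^ 333" using self_le_power[of "m N + 2" 333] by simp
      show "length (fs N) \<le> (m N + 2) ^ 333"
        by (rule le_trans[OF len power_increasing]) simp_all
    qed (simp flip: power_add)
    also have "\<dots> \<le> (m N + 2) * (m N + 2) ^ 333" using mult_le_mono1[OF M, of "(m N + 2) ^ 333"] by linarith
    also have "\<dots> = (m N + 2) ^ 334" by (simp flip: power_Suc)
    also have "\<dots> = (N + C) ^ (4 * 334)" unfolding m2 by (rule power_mult[symmetric])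
    finally show "N + (m N + 2) ^ 3 * (m N + 2) ^ 330 + length (fs N) \<le> (N + C) ^ (4 * 334)" .
  next
    show "(\<lambda>N. real (0 + 330)) \<in> O(\<lambda>N. log 2 (real N) ^ 0)" by simp
  next
    fix x Y assume "(x, Y) \<in> composition_problem c"
    then obtain s t \<phi> \<psi> where x: "x = to_bits c (join [s, t])"
      and Y: "Y = {to_bits c u |u. describes u (\<psi> \<circ>\<^sub>m \<phi>)}"
      and iso: "finite_essential_iso \<phi>" "finite_essential_iso \<psi>" and "describes s \<phi>" "describes t \<psi>"
      unfolding composition_problem_def by blast
    then obtain es es' where es: "distinct es" "set es = table \<phi>" "writes s es"
      and es': "distinct es'" "set es' = table \<psi>" "writes t es'"
      by (auto simp: describes_def)
    define zz where "zz = join [s, t]"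
    have zz: "zz = [] @ s @ Bar # t @ [Bar]" "zz = (s @ [Bar]) @ t @ [Bar]" by (simp_all add: zz_def join_def)
    have "L (length x) = length zz" using width_pos by (simp add: L_def x length_to_bits zz_def)
    hence z: "z (length x) x = zz" by (simp add: z_def x zz_def decode_to_bits)
    have bar: "zz ! length s = Bar" by (simp add: zz)
    have nb: "zz ! j \<noteq> Bar" if "j < length s" for j
    proof -
      have "zz ! j = s ! j" using that by (simp add: zz(1) nth_append)
      thus ?thesis using writes_no_Bar[OF es(3)] nth_mem[OF that] by metis
    qed
    \<comment> \<open>The bar at \<open>length s\<close> passes this test too; it is not a comma and
      therefore does no harm.\<close>
    have bars: "(\<forall>j\<in>{..<i}. zz ! j \<noteq> Bar) \<longleftrightarrow> i \<le> length s" for i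
      using nb bar by (auto simp: not_less)
    have e1: "entries (T1 (length x) x) = es"
      unfolding T1_def z
    proof (rule entries_parse_segment[OF es(3) _ zz(1)])
      fix i assume "zz ! i = Comma"
      hence "i \<noteq> length s" using bar by auto
      thus "(\<forall>j\<in>{..<i}. zz ! j \<noteq> Bar) \<longleftrightarrow> length [] \<le> i \<and> i < length [] + length s"
        unfolding bars by auto
    qed simp
    have e2: "entries (T2 (length x) x) = es'"
      unfolding T2_def z
    proof (rule entries_parse_segment[OF es'(3) _ zz(2)])
      fix i assume i: "i < length zz" "zz ! i = Comma"
      \<comment> \<open>The closing bar lies behind the second segment and passes the test, but it
        is not a comma either.\<close>
      have "zz ! (length s + Suc (length t)) = Bar" by (simp add: zz nth_append)
      hence "i < length s + Suc (length t)" using i by (cases "i = length s + Suc (length t)") (auto simp: zz)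
      moreover have "(\<exists>j\<in>{..<i}. zz ! j = Bar) \<longleftrightarrow> \<not> i \<le> length s" using bars[of i] by blast
      ultimately show "(\<exists>j\<in>{..<i}. zz ! j = Bar) \<longleftrightarrow> length (s @ [Bar]) \<le> i \<and> i < length (s @ [Bar]) + length t"
        by auto
    qed simp
    have p: "presents (set es) \<phi>" "presents (set es') \<psi>"
      using iso finite_essential_iso_presents es(2) es'(2) by metis+
    have "presents (set (entries (T (length x) x))) (\<psi> \<circ>\<^sub>m \<phi>)"
      unfolding T_def by (rule presents_comp_table) (simp_all add: e1 e2 p)
    hence "set (entries (T (length x) x)) = table (\<psi> \<circ>\<^sub>m \<phi>)" using presents_table by blast
    moreover have "distinct (entries (T (length x) x))"
      unfolding T_def by (rule distinct_entries_comp_table) (use p es(1) es'(1) in \<open>auto simp: e1 e2 presents_def\<close>)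
    ultimately have "describes (concat (map (render (R (length x))) (T (length x) x))) (\<psi> \<circ>\<^sub>m \<phi>)"
      unfolding describes_def using writes_render by blast
    moreover have "map (\<lambda>f. f x) (fs (length x)) = to_bits c (concat (map (render (R (length x))) (T (length x) x)))"
      unfolding fs_def by (rule output_bits_correct[OF T card R_def[THEN fun_cong] R])
    ultimately show "map (\<lambda>f. f x) (fs (length x)) \<in> Y" unfolding Y by blast
  qed
qed

section \<open>The word problem\<close>

instance ab :: finite
proof
  have "x \<in> {Letter_a, Letter_b}" for x by (cases x) auto
  hence "(UNIV :: ab set) \<subseteq> {Letter_a, Letter_b}" by blast
  thus "finite (UNIV :: ab set)" by (rule finite_subset) simp
qed

text \<open>All bits that live on one level of the tree. Slot counts and word lengths share the
  bound \<open>2 ^ l * n\<close>, as both start at \<open>n\<close> and double.\<close>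

definition layer :: "nat \<Rightarrow> nat \<Rightarrow> (bool list \<Rightarrow> 'a::finite symbol list) \<Rightarrow> nat \<Rightarrow> (bool list \<Rightarrow> bool) set" where
  "layer K n z l = (\<Union>b<2 ^ (K - l). bits (2 ^ l * n) (2 ^ l * n) (\<lambda>x. node (z x) l b))"

lemma finite_layer: "finite (layer K n z l)"
  unfolding layer_def by (intro finite_UN_I finite_lessThan finite_bits)

text \<open>At most \<open>q\<close> nodes with at most \<open>q\<close> slots each, and at most
  \<open>q ^ 3\<close> bits per slot: the factors 3, number of positions and number of
  letters.\<close>

lemma card_layer:
  fixes z :: "bool list \<Rightarrow> 'a::finite symbol list"
  assumes l: "l \<le> K" and q: "2 ^ K \<le> q" "2 ^ K * n < q" "CARD('a) \<le> q" "3 \<le> q"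
  shows "card (layer K n z l) \<le> q ^ 5"
proof -
  define s where "s = 2 ^ l * n"
  have "s \<le> 2 ^ K * n" unfolding s_def using l by (intro mult_le_mono1) (simp add: power_increasing)
  hence s: "Suc s \<le> q" using q(2) by simp
  have "0 < Suc s * CARD('a)" by simp
  hence "1 + 2 * (Suc s * CARD('a)) \<le> 3 * (Suc s * CARD('a))" by linarith
  also have "\<dots> \<le> q * (q * q)" by (intro mult_le_mono q s)
  finally have b: "1 + 2 * (Suc s * CARD('a)) \<le> q * (q * q)" .
  have "card (bits s s (\<lambda>x. node (z x) l b)) \<le> q * (q * (q * q))" for b
    by (rule order.trans[OF card_bits mult_le_mono[OF _ b]]) (use s in simp)
  hence "(\<Sum>b<2 ^ (K - l). card (bits s s (\<lambda>x. node (z x) l b))) \<le> (\<Sum>b<(2::nat) ^ (K - l). q * (q * (q * q)))"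
    by (intro sum_mono)
  moreover have "card (layer K n z l) \<le> (\<Sum>b<2 ^ (K - l). card (bits s s (\<lambda>x. node (z x) l b)))"
    unfolding layer_def s_def by (rule card_UN_le) simp
  moreover have "(\<Sum>b<(2::nat) ^ (K - l). q * (q * (q * q))) \<le> q * (q * (q * (q * q)))"
  proof -
    have "(2::nat) ^ (K - l) \<le> 2 ^ K" by (rule power_increasing) simp_all
    from mult_le_mono1[OF le_trans[OF this q(1)]]
    have "2 ^ (K - l) * (q * (q * (q * q))) \<le> q * (q * (q * (q * q)))" .
    thus ?thesis by simp
  qed
  ultimately have "card (layer K n z l) \<le> q * (q * (q * (q * q)))" by (meson le_trans)
  thus ?thesis by (simp add: power_numeral_reduce)
qed

text \<open>Leaves have depth \<open>220 = 20 + 200\<close> (decoding, then parsing). A layer has at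
  most \<open>(m + 2) ^ 5\<close> bits of at most \<open>(m + 2) ^ 220\<close> gates each, whence
  225; the inner levels, of depth 80 only, are charged the same amount.\<close>

lemma circ_layer:
  fixes z :: "bool list \<Rightarrow> 'a::finite symbol list"
  assumes z: "word_fo F m 20 n z" "\<And>x. length (z x) = n" and F: "circ N s 0 F"
    and q: "2 ^ K \<le> m" "2 ^ K * n \<le> m" "1 \<le> m" and l: "l \<le> K"
  shows "circ N (s + Suc l * (m + 2) ^ 225) (220 + l * 80) (layer K n z l)"
    and "\<And>b. b < 2 ^ (K - l) \<Longrightarrow> table_fo (layer K n z l) m 0 (2 ^ l * n) (2 ^ l * n) (\<lambda>x. node (z x) l b)"
proof -
  let ?C = "\<lambda>l. circ N (s + Suc l * (m + 2) ^ 225) (220 + l * 80) (layer K n z l)"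
  let ?T = "\<lambda>G d l b. table_fo G m d (2 ^ l * n) (2 ^ l * n) (\<lambda>x. node (z x) l b)"
  \<comment> \<open>Shared by the leaves and the inner levels: tables of depth \<open>d\<close> over
    \<open>G\<close> become gates, and from then on they have depth 0.\<close>
  have step: "circ N (s' + (m + 2) ^ 225) (D + d) (layer K n z l) \<and> (\<forall>b<2 ^ (K - l). ?T (layer K n z l) 0 l b)"
    if T: "\<And>b. b < 2 ^ (K - l) \<Longrightarrow> ?T G d l b" and G: "circ N s' D G" and l: "l \<le> K" and d: "d \<le> 220"
    for G d l s' D
  proof -
    have "CARD('a) \<le> m" using card_le_card_symbol word_foD(1)[OF z(1)] le_trans by blast
    hence "card (layer K n z l) \<le> (m + 2) ^ 5"
      using q by (intro card_layer[OF l]) simp_all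
    moreover have "fo G m d f" if f: "f \<in> layer K n z l" for f
    proof -
      obtain b where "b < 2 ^ (K - l)" "f \<in> bits (2 ^ l * n) (2 ^ l * n) (\<lambda>x. node (z x) l b)"
        using f unfolding layer_def by (elim UN_E) simp
      thus ?thesis using fo_bits[OF T] by blast
    qed
    ultimately have "circ N (s' + (m + 2) ^ 5 * (m + 2) ^ d) (D + d) (layer K n z l)"
      using circ_step[OF G finite_layer] by blast
    moreover have "(m + 2) ^ 5 * (m + 2) ^ d \<le> (m + 2) ^ 225"
      unfolding power_add[symmetric] using d by (intro power_increasing) simp_all
    ultimately have "circ N (s' + (m + 2) ^ 225) (D + d) (layer K n z l)"
      unfolding circ_def by (meson add_left_mono le_trans)
    moreover have "?T (layer K n z l) 0 l b" if "b < 2 ^ (K - l)" for b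
      by (rule table_fo_bits[OF T[OF that]]) (unfold layer_def, rule UN_upper, use that in simp)
    ultimately show ?thesis by blast
  qed
  have "?C l \<and> (\<forall>b<2 ^ (K - l). ?T (layer K n z l) 0 l b)"
    using l
  proof (induction l)
    case 0
    have "?T F 220 0 b" for b using table_fo_leaf[OF z] by simp
    from step[OF this F] show ?case by simp
  next
    case (Suc l)
    have IH: "?C l" "\<And>b. b < 2 ^ (K - l) \<Longrightarrow> ?T (layer K n z l) 0 l b" using Suc by simp_all
    have d: "2 ^ l * n + 2 ^ l * n = 2 ^ Suc l * n" by simp
    have "2 ^ Suc l * n \<le> 2 ^ K * n" using Suc.prems by (intro mult_le_mono1 power_increasing) simp_all
    from le_trans[OF this q(2)] have le: "2 ^ l * n + 2 ^ l * n \<le> m" unfolding d .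
    have "?T (layer K n z l) 80 (Suc l) b" if b: "b < 2 ^ (K - Suc l)" for b
    proof -
      have "K - l = Suc (K - Suc l)" using Suc.prems by simp
      hence "2 * b + 1 < 2 ^ (K - l)" using b by simp
      thus ?thesis
        using table_fo_comp_table[OF IH(2)[of "2 * b + 1"] IH(2)[of "2 * b"] le le] unfolding d by simp
    qed
    from step[OF this IH(1) Suc.prems] show ?case by (simp add: algebra_simps)
  qed
  thus "?C l" "\<And>b. b < 2 ^ (K - l) \<Longrightarrow> ?T (layer K n z l) 0 l b" by blast+
qed

lemma word_problem_V_AC1:
  assumes "binary_code c"
  shows "word_problem_V c \<in> AC 1"
proof -
  obtain w where "coding c w" using codingI[OF assms] .
  then interpret coding c w .
  define C where "C = CARD(ab symbol) + w + 4"
  define m where "m = (\<lambda>N. (N + C) ^ 4 - 2)"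
  define L where "L = (\<lambda>N. N div w)"
  \<comment> \<open>\<open>floorlog\<close> is the bit length, so \<open>2 ^ K N\<close> exceeds the
    number of positions and yet stays linear in it.\<close>
  define K where "K = (\<lambda>N. floorlog 2 (L N))"
  define z where "z = (\<lambda>N. decode c w (L N))"
  define T where "T = (\<lambda>N x. node (z N x) (K N) 0)"
  define n where "n = (\<lambda>N. 2 ^ K N * L N)"
  define f where "f = (\<lambda>N x. \<forall>i\<in>{..<n N}. flag (T N x ! i) \<longrightarrow> src (T N x ! i) = tgt (T N x ! i))"
  have C: "4 \<le> N + C" for N by (simp add: C_def)
  have m2: "m N + 2 = (N + C) ^ 4" for N
    using le_power4[OF C, of 0 N] by (simp add: m_def)
  have le_m: "y \<le> m N" if "y \<le> (N + C) ^ 3" for y N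
    using le_power4[OF C that] by (simp add: m_def)
  have le_m1: "y \<le> m N" if "y \<le> N + C" for y N
    using that self_le_power[of "N + C" 3] C[of N] by (intro le_m) simp
  have L: "L N \<le> N" "w * L N \<le> N" for N by (simp_all add: L_def)
  have K: "L N < 2 ^ K N" "2 ^ K N \<le> 2 * L N + 1" for N
  proof -
    show "L N < 2 ^ K N"
      using floorlog_bounds[of "L N" 2] by (cases "L N = 0") (auto simp: K_def)
    show "2 ^ K N \<le> 2 * L N + 1"
    proof (cases "L N = 0")
      case False
      hence "2 ^ (K N - 1) \<le> L N" "K N = Suc (K N - 1)"
        using floorlog_bounds[of "L N" 2] by (auto simp: K_def floorlog_def)
      thus ?thesis by (metis mult_le_mono2 power_Suc trans_le_add1)
    qed (simp add: K_def floorlog_def)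
  qed
  have card: "CARD(ab symbol) \<le> m N" for N by (rule le_m1) (simp add: C_def)
  have wz: "word_fo (inputs N) (m N) 20 (L N) (z N)" for N
    unfolding z_def by (rule word_fo_decode[OF _ _ card L(2)]) (rule le_m1, use L(1)[of N] in \<open>simp add: C_def\<close>)+
  have lz: "length (z N x) = L N" for N x by (simp add: z_def)
  have nm: "n N \<le> m N" "2 ^ K N \<le> m N" for N
  proof -
    have a: "2 ^ K N \<le> (N + C) * (N + C)"
    proof -
      have "2 ^ K N \<le> 4 * (N + C)" using K(2)[of N] L(1)[of N] by (simp add: C_def)
      also have "\<dots> \<le> (N + C) * (N + C)" using C by (rule mult_le_mono1)
      finally show ?thesis .
    qed
    have "L N \<le> N + C" using L(1)[of N] by simp
    from mult_le_mono[OF a this] show "n N \<le> m N"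
      by (intro le_m) (simp add: n_def power3_eq_cube)
    have "1 \<le> N + C" using C[of N] by simp
    from mult_le_mono[OF a this] show "2 ^ K N \<le> m N"
      by (intro le_m) (simp add: power3_eq_cube)
  qed
  have m1: "1 \<le> m N" for N by (rule le_m1) (simp add: C_def)
  note lay = circ_layer[OF wz lz circ_inputs nm(2) nm(1)[unfolded n_def] m1 order.refl]
  have T: "table_fo (layer (K N) (L N) (z N) (K N)) (m N) 0 (n N) (n N) (T N)" for N
    unfolding T_def n_def by (rule lay(2)) simp
  have fo: "fo (layer (K N) (L N) (z N) (K N)) (m N) 30 (f N)" for N
  proof -
    have E: "entry_fo (layer (K N) (L N) (z N) (K N)) (m N) 0 (n N) (\<lambda>x. T N x ! i)" if "i < n N" for i
      using T that by (simp add: table_fo_def)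
    have "n N \<le> m N + 2" using nm(1)[of N] by simp
    thus ?thesis
      unfolding f_def
      by (intro fo_mono[OF fo_ball_less[OF _ fo_imp[OF entry_foD(1)[OF E] fo_eq[OF entry_foD(2,3)[OF E]]]]]) simp_all
  qed
  show ?thesis
  proof (rule AC_I[where fs = "\<lambda>N. [f N]" and D = "\<lambda>N. 220 + K N * 80 + 30"
        and s = "\<lambda>N. N + Suc (K N) * (m N + 2) ^ 225 + 1 * (m N + 2) ^ 30"])
    fix N
    show "circ N (N + Suc (K N) * (m N + 2) ^ 225 + 1 * (m N + 2) ^ 30) (220 + K N * 80 + 30) (set [f N])"
      by (rule circ_step[OF lay(1)]) (use fo in simp_all)
    define q where "q = m N + 2"
    have q: "4 \<le> q" unfolding q_def m2 using self_le_power[of "N + C" 4] C[of N] by simp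
    \<comment> \<open>One power beyond 225 pays for the number of levels, and another, by
      \<open>4 \<le> q\<close>, for the four summands: 227 in the end.\<close>
    have "N + Suc (K N) * q ^ 225 + 1 * q ^ 30 + length [f N] \<le> q ^ 226 + q ^ 226 + q ^ 226 + q ^ 226"
    proof (intro add_mono)
      have "N \<le> q" using le_m1[of N N] by (simp add: q_def)
      thus "N \<le> q ^ 226" using self_le_power[of q 226] q by simp
      have "K N < 2 ^ K N" by (rule less_exp)
      hence "Suc (K N) \<le> q" using nm(2)[of N] unfolding q_def by linarith
      from mult_le_mono1[OF this, of "q ^ 225"] show "Suc (K N) * q ^ 225 \<le> q ^ 226" by (simp flip: power_Suc)
      show "1 * q ^ 30 \<le> q ^ 226" using q power_increasing[of 30 226 q] by simp
      show "length [f N] \<le> q ^ 226" using q by simp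
    qed
    also have "\<dots> \<le> q * q ^ 226" using mult_le_mono1[OF q, of "q ^ 226"] by linarith
    also have "\<dots> = (N + C) ^ (4 * 227)" unfolding q_def m2 by (simp flip: power_Suc power_mult)
    finally show "N + Suc (K N) * (m N + 2) ^ 225 + 1 * (m N + 2) ^ 30 + length [f N] \<le> (N + C) ^ (4 * 227)"
      by (simp only: q_def)
  next
    \<comment> \<open>\<open>K N\<close> is at most \<open>log 2 N + 1\<close>, and the constant
      \<open>250 + 80\<close> is absorbed into the coefficient, since the logarithm is at least 1
      from \<open>N = 2\<close> on: \<open>330 + 80 = 410\<close>.\<close>
    have "real (220 + K N * 80 + 30) \<le> 410 * log 2 (real N)" if N: "2 \<le> N" for N
    proof -
      have l: "1 \<le> log 2 (real N)" using N by (simp add: le_log_iff)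
      have "real (K N) \<le> log 2 (real N) + 1"
      proof (cases "L N = 0")
        case True
        thus ?thesis using l by (simp add: K_def floorlog_def)
      next
        case False
        hence "real (K N) \<le> log 2 (real (L N)) + 1" by (simp add: K_def floorlog_def)
        moreover have "log 2 (real (L N)) \<le> log 2 (real N)" using False L(1)[of N] by simp
        ultimately show ?thesis by simp
      qed
      thus ?thesis using l by simp
    qed
    moreover have "0 \<le> log 2 (real N)" if "2 \<le> N" for N using that by simp
    ultimately show "(\<lambda>N. real (220 + K N * 80 + 30)) \<in> O(\<lambda>N. log 2 (real N) ^ 1)"
      by (intro bigoI[where c = 410] eventually_sequentiallyI[of 2]) simp
  next
    fix x Y assume "(x, Y) \<in> word_problem_V c"
    then obtain ss \<psi>s where x: "x = to_bits c (join ss)" and Y: "Y = {[V_product \<psi>s = \<one>\<^bsub>thompson_V\<^esub>]}"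
      and \<psi>s: "\<psi>s \<noteq> []" "\<forall>\<psi>\<in>set \<psi>s. finite_essential_iso \<psi>" "list_all2 describes ss \<psi>s"
      unfolding word_problem_V_def by blast
    have Lx: "L (length x) = length (join ss)" using width_pos by (simp add: L_def x length_to_bits)
    hence zx: "z (length x) x = join ss" by (simp add: z_def x decode_to_bits)
    have pr: "presents (set (entries (T (length x) x))) (composite \<psi>s)"
      unfolding T_def zx by (rule presents_root[OF \<psi>s(3,2,1)]) (use K(1)[of "length x"] Lx in simp)
    have "V_product \<psi>s = \<one>\<^bsub>thompson_V\<^esub> \<longleftrightarrow> composite \<psi>s \<subseteq>\<^sub>m Some"
      by (rule V_product_eq_one_iff) (use \<psi>s(2) finite_essential_iso_dense in blast)
    also note presents_le_Some_iff[OF pr]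
    also have "(\<forall>(p, q)\<in>set (entries (T (length x) x)). p = q) \<longleftrightarrow> (\<forall>e\<in>set (T (length x) x). flag e \<longrightarrow> src e = tgt e)"
      by (auto simp: entries_def)
    also have "\<dots> \<longleftrightarrow> f (length x) x"
      using T[of "length x"] by (auto simp: f_def table_fo_def all_set_conv_all_nth)
    finally show "map (\<lambda>f. f x) [f (length x)] \<in> Y" by (simp add: Y)
  qed
qed

theorem theorem4p1:
  fixes c :: "'a::finite symbol \<Rightarrow> bool list"
    and d :: "ab symbol \<Rightarrow> bool list"
  assumes "CARD('a) \<ge> 2" and "binary_code c" and "binary_code d"
  shows "composition_problem c \<in> AC 0 \<and> word_problem_V d \<in> AC 1"
  using composition_problem_AC0[OF assms(2)] word_problem_V_AC1[OF assms(3)] ..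

end
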